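(* There exists a family of Boolean functions $h_n\colon\{0,1\}^n\to\{0,1\}$, $n\in\mathbb{N}$, such that: (1) $h_n$ can be computed by uniform depth-$4$ formulas with unbounded fan-in of size $O(n^3)$; (2) the formula complexity of $h_n$ satisfies $L(h_n)\ge n^{3-o(1)}$.
   Context: A (De Morgan) formula is a binary tree whose leaves are labeled by literals $x_1,\overline{x_1},\dots,x_n,\overline{x_n}$ and whose internal nodes are labeled by AND or OR gates; its size is the number of leaves. A formula with unbounded fan-in is defined the same way except that internal nodes may have any number of children. The formula complexity $L(f)$ of a Boolean function $f$ is the minimal size of a (bounded fan-in De Morgan) formula computing $f$, with $L$ of a constant function defined to be $0$. *)

theory Defs
  imports Complex_Main "HOL-Library.Landau_Symbols"
begin

text \<open>
  A point of $\{0,1\}^n$ is a Boolean list of length \<open>n\<close>, and a Boolean function on $\{0,1\}^n$ is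
  a function on Boolean lists of which only the values on lists of length \<open>n\<close> matter.
  Variables are numbered \<open>0, \<dots>, n - 1\<close>.
\<close>

datatype literal = Pos nat | Neg nat

primrec lit_var :: "literal \<Rightarrow> nat" where
  "lit_var (Pos i) = i"
| "lit_var (Neg i) = i"

primrec lit_eval :: "literal \<Rightarrow> bool list \<Rightarrow> bool" where
  "lit_eval (Pos i) x = x ! i"
| "lit_eval (Neg i) x = (\<not> x ! i)"


subsection \<open>De Morgan formulas and formula complexity\<close>

datatype formula = Leaf literal | And formula formula | Or formula formula

primrec formula_eval :: "formula \<Rightarrow> bool list \<Rightarrow> bool" where
  "formula_eval (Leaf l) x = lit_eval l x"
| "formula_eval (And F G) x = (formula_eval F x \<and> formula_eval G x)"
| "formula_eval (Or F G) x = (formula_eval F x \<or> formula_eval G x)"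

primrec formula_over :: "nat \<Rightarrow> formula \<Rightarrow> bool" where
  "formula_over n (Leaf l) = (lit_var l < n)"
| "formula_over n (And F G) = (formula_over n F \<and> formula_over n G)"
| "formula_over n (Or F G) = (formula_over n F \<and> formula_over n G)"

primrec formula_size :: "formula \<Rightarrow> nat" where
  "formula_size (Leaf l) = 1"
| "formula_size (And F G) = formula_size F + formula_size G"
| "formula_size (Or F G) = formula_size F + formula_size G"

definition formula_computes :: "nat \<Rightarrow> formula \<Rightarrow> (bool list \<Rightarrow> bool) \<Rightarrow> bool" where
  "formula_computes n F f \<longleftrightarrow>
     formula_over n F \<and> (\<forall>x. length x = n \<longrightarrow> formula_eval F x = f x)"

definition formula_complexity :: "nat \<Rightarrow> (bool list \<Rightarrow> bool) \<Rightarrow> nat" where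
  "formula_complexity n f =
     (if \<exists>b. \<forall>x. length x = n \<longrightarrow> f x = b then 0
      else (LEAST s. \<exists>F. formula_computes n F f \<and> formula_size F = s))"


subsection \<open>Formulas with unbounded fan-in\<close>

datatype uformula = ULeaf literal | UAnd "uformula list" | UOr "uformula list"

fun uformula_eval :: "uformula \<Rightarrow> bool list \<Rightarrow> bool" where
  "uformula_eval (ULeaf l) x = lit_eval l x"
| "uformula_eval (UAnd Fs) x = (\<forall>F\<in>set Fs. uformula_eval F x)"
| "uformula_eval (UOr Fs) x = (\<exists>F\<in>set Fs. uformula_eval F x)"

text \<open>A gate without children would be an unlabelled leaf, so it is excluded here.\<close>

fun uformula_over :: "nat \<Rightarrow> uformula \<Rightarrow> bool" where
  "uformula_over n (ULeaf l) = (lit_var l < n)"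
| "uformula_over n (UAnd Fs) = (Fs \<noteq> [] \<and> (\<forall>F\<in>set Fs. uformula_over n F))"
| "uformula_over n (UOr Fs) = (Fs \<noteq> [] \<and> (\<forall>F\<in>set Fs. uformula_over n F))"

fun uformula_size :: "uformula \<Rightarrow> nat" where
  "uformula_size (ULeaf l) = 1"
| "uformula_size (UAnd Fs) = sum_list (map uformula_size Fs)"
| "uformula_size (UOr Fs) = sum_list (map uformula_size Fs)"

text \<open>The depth is the largest number of gates on a path from the root to a leaf.\<close>

fun uformula_depth :: "uformula \<Rightarrow> nat" where
  "uformula_depth (ULeaf l) = 0"
| "uformula_depth (UAnd Fs) = Suc (foldr max (map uformula_depth Fs) 0)"
| "uformula_depth (UOr Fs) = Suc (foldr max (map uformula_depth Fs) 0)"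

definition uformula_computes :: "nat \<Rightarrow> uformula \<Rightarrow> (bool list \<Rightarrow> bool) \<Rightarrow> bool" where
  "uformula_computes n F f \<longleftrightarrow>
     uformula_over n F \<and> (\<forall>x. length x = n \<longrightarrow> uformula_eval F x = f x)"


subsection \<open>Space-bounded Turing transducers\<close>

text \<open>
  Deterministic Turing machines with a two-way read-only input tape delimited by end markers,
  a fixed number of read/write work tapes, and a write-only output tape. States and work symbols
  are initial segments of the natural numbers; state 0 is initial and symbol 0 is the blank.
  Work tapes are infinite to the right only, and a head that moves left from cell 0 stays there.
  The machine halts when its transition function yields \<open>None\<close>.
\<close>

datatype move = MoveLeft | Stay | MoveRight

datatype insym = LeftEnd | RightEnd | InBit bool

record 'o action =
  next_state :: nat
  in_move :: move
  work_acts :: "(nat \<times> move) list"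
  emit :: "'o option"

record 'o transducer =
  num_states :: nat
  num_symbols :: nat
  num_tapes :: nat
  delta :: "nat \<Rightarrow> insym \<Rightarrow> nat list \<Rightarrow> 'o action option"

definition wf_transducer :: "'o transducer \<Rightarrow> bool" where
  "wf_transducer M \<longleftrightarrow> 0 < num_states M \<and> 0 < num_symbols M \<and>
     (\<forall>q a ws act.
        q < num_states M \<and> length ws = num_tapes M \<and> set ws \<subseteq> {..<num_symbols M} \<and>
        delta M q a ws = Some act \<longrightarrow>
          next_state act < num_states M \<and>
          length (work_acts act) = num_tapes M \<and>
          fst ` set (work_acts act) \<subseteq> {..<num_symbols M})"

record 'o config =
  state :: nat
  in_head :: nat
  work :: "((nat \<Rightarrow> nat) \<times> nat) list"
  out_tape :: "'o list"

primrec move_head :: "move \<Rightarrow> nat \<Rightarrow> nat" where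
  "move_head MoveLeft p = p - 1"
| "move_head Stay p = p"
| "move_head MoveRight p = p + 1"

text \<open>The input occupies cells \<open>1, \<dots>, length x\<close>, with the end markers in the two adjacent cells.\<close>

definition read_input :: "bool list \<Rightarrow> nat \<Rightarrow> insym" where
  "read_input x p =
     (if p = 0 then LeftEnd else if p \<le> length x then InBit (x ! (p - 1)) else RightEnd)"

definition init_config :: "'o transducer \<Rightarrow> 'o config" where
  "init_config M =
     \<lparr>state = 0, in_head = 0, work = replicate (num_tapes M) (\<lambda>_. 0, 0), out_tape = []\<rparr>"

definition chosen_action :: "'o transducer \<Rightarrow> bool list \<Rightarrow> 'o config \<Rightarrow> 'o action option" where
  "chosen_action M x c =
     delta M (state c) (read_input x (in_head c)) (map (\<lambda>(t, p). t p) (work c))"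

definition perform :: "bool list \<Rightarrow> 'o action \<Rightarrow> 'o config \<Rightarrow> 'o config" where
  "perform x act c =
     \<lparr>state = next_state act,
      in_head = min (length x + 1) (move_head (in_move act) (in_head c)),
      work = map2 (\<lambda>(t, p) (s, m). (t(p := s), move_head m p)) (work c) (work_acts act),
      out_tape = out_tape c @ (case emit act of None \<Rightarrow> [] | Some b \<Rightarrow> [b])\<rparr>"

definition step :: "'o transducer \<Rightarrow> bool list \<Rightarrow> 'o config \<Rightarrow> 'o config" where
  "step M x c = (case chosen_action M x c of None \<Rightarrow> c | Some act \<Rightarrow> perform x act c)"

definition run :: "'o transducer \<Rightarrow> bool list \<Rightarrow> nat \<Rightarrow> 'o config" where
  "run M x t = (step M x ^^ t) (init_config M)"

definition outputs_in_space ::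
    "'o transducer \<Rightarrow> bool list \<Rightarrow> 'o list \<Rightarrow> nat \<Rightarrow> bool" where
  "outputs_in_space M x y s \<longleftrightarrow>
     (\<exists>t. chosen_action M x (run M x t) = None \<and> out_tape (run M x t) = y \<and>
          (\<forall>i\<le>t. \<forall>(tape, p)\<in>set (work (run M x i)). p < s))"


subsection \<open>Uniform families of formulas\<close>

text \<open>
  Formulas are written out in prefix notation, with variable indices in binary, least significant
  bit first.
\<close>

datatype token = AndTok | OrTok | EndTok | PosTok | NegTok | BitTok bool

fun binary :: "nat \<Rightarrow> bool list" where
  "binary n = (if n = 0 then [] else odd n # binary (n div 2))"

declare binary.simps [simp del]

primrec lit_code :: "literal \<Rightarrow> token list" where
  "lit_code (Pos i) = PosTok # map BitTok (binary i)"
| "lit_code (Neg i) = NegTok # map BitTok (binary i)"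

fun uformula_code :: "uformula \<Rightarrow> token list" where
  "uformula_code (ULeaf l) = lit_code l"
| "uformula_code (UAnd Fs) = AndTok # concat (map uformula_code Fs) @ [EndTok]"
| "uformula_code (UOr Fs) = OrTok # concat (map uformula_code Fs) @ [EndTok]"

text \<open>
  Uniformity is the standard logarithmic-space uniformity: one transducer produces the description
  of the \<open>n\<close>-th formula from the input $1^n$ using $O(\log n)$ cells of its work tapes. (A mere
  computability requirement would be met by exhaustive search for a hard function.)
\<close>

definition uniform_family :: "(nat \<Rightarrow> uformula) \<Rightarrow> bool" where
  "uniform_family F \<longleftrightarrow>
     (\<exists>(M :: token transducer) s. wf_transducer M \<and> (\<lambda>n. real (s n)) \<in> O(\<lambda>n. ln (real n)) \<and>
        (\<forall>n\<ge>1. outputs_in_space M (replicate n True) (uformula_code (F n)) (s n)))"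

end

theory Submission
  imports Defs "HOL-Library.FuncSet" "HOL-Real_Asymp.Real_Asymp"
begin

text \<open>
  The function is of Andreev's type: \<open>h(f, x) = \<Or>\<^sub>z f(z) \<and> \<And>\<^sub>i Surj(x\<^bsub>i, z\<^sub>i\<^esub>)\<close>, where \<open>f\<close> is a truth
  table on \<open>r \<approx> log n\<close> bits and each of the \<open>2r\<close> blocks \<open>x\<^bsub>i, b\<^esub>\<close> is a list of numbers on which
  \<open>Surj\<close> asks whether all numbers occur. Using one block for each literal instead of each variable
  makes the formula monotone in the values of \<open>Surj\<close>, so that depth \<open>4\<close> suffices.

  For the lower bound, each block is projected at random onto one variable \<open>y\<close>, whose values select a
  list that attains all numbers or the same list with one of them erased. The position of the change is
  hidden among almost linearly many, so by Khrapchenko's argument a formula of size \<open>s\<close> becomes a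
  literal with probability about \<open>s\<^sup>1\<^sup>/\<^sup>2 / n\<close>, even conditioned on any event that is closed under fixing
  the variables \<open>y\<close>. By Hastad's induction, formulas of small depth then shrink by a factor of about
  \<open>n\<^sup>2\<close>; balancing reduces to that case. What is left computes \<open>\<Or>\<^sub>z f(z) \<and> \<And>\<^sub>i y\<^bsub>i, z\<^sub>i\<^esub>\<close>, which needs
  almost \<open>n\<close> leaves for some \<open>f\<close> by counting.
\<close>


subsection \<open>Formulas with constants\<close>

text \<open>Andreev's original function feeds parities into the table, and parity has no formulas of
  constant depth and polynomial size. \<open>Surj\<close> on about n numbers replaces it: an And of
  Ors of Ands of size about n^2 that, like parity, is quadratically hard by Khrapchenko's argument.
  Up to polylogarithmic factors, n^3 is n rows times n^2 above, and table cost n times shrinkage n^2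
  below. The obstacle is the conditioning in Hastad's induction: once one child of a gate is known
  to be a literal, the other must still shrink. Hence a projection is a family of pairs of block
  values in which an equal pair means a fixed variable. Fixing then stays inside one finite space,
  and the induction quantifies over all product weights that are \<open>hiding\<close> and all
  events closed under fixing. The parameter q is tuned so that the equal pairs cost only a constant
  factor at the end. The shrinkage bound loses the cube of the depth, which is harmless for
  logarithmic depth only. Balancing cuts each formula so unevenly that only a fraction 1/c of it is
  duplicated; the growth is then s^(1+\<epsilon>) with \<epsilon> as small as desired.\<close>

datatype (vars: 'v) fm = Const bool | Lit bool 'v | Gate bool "'v fm" "'v fm"

primrec ev :: "'v fm \<Rightarrow> ('v \<Rightarrow> bool) \<Rightarrow> bool" where
  "ev (Const c) y = c"
| "ev (Lit b v) y = (y v = b)"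
| "ev (Gate c F G) y = (if c then ev F y \<and> ev G y else ev F y \<or> ev G y)"

text \<open>Constants are free: projecting and fixing turn leaves into constants, and this loss is
  the shrinkage to be measured.\<close>

primrec leaves :: "'v fm \<Rightarrow> nat" where
  "leaves (Const c) = 0"
| "leaves (Lit b v) = 1"
| "leaves (Gate c F G) = leaves F + leaves G"

primrec height :: "'v fm \<Rightarrow> nat" where
  "height (Const c) = 0"
| "height (Lit b v) = 0"
| "height (Gate c F G) = Suc (max (height F) (height G))"

primrec negate :: "'v fm \<Rightarrow> 'v fm" where
  "negate (Const c) = Const (\<not> c)"
| "negate (Lit b v) = Lit (\<not> b) v"
| "negate (Gate c F G) = Gate (\<not> c) (negate F) (negate G)"

primrec subst :: "('v \<Rightarrow> 'w fm) \<Rightarrow> 'v fm \<Rightarrow> 'w fm" where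
  "subst \<sigma> (Const c) = Const c"
| "subst \<sigma> (Lit b v) = (if b then \<sigma> v else negate (\<sigma> v))"
| "subst \<sigma> (Gate c F G) = Gate c (subst \<sigma> F) (subst \<sigma> G)"

lemma ev_negate [simp]: "ev (negate F) y = (\<not> ev F y)"
  by (induction F) auto

lemma leaves_negate [simp]: "leaves (negate F) = leaves F"
  by (induction F) auto

lemma vars_negate [simp]: "vars (negate F) = vars F"
  by (induction F) auto

lemma ev_subst: "ev (subst \<sigma> F) y = ev F (\<lambda>v. ev (\<sigma> v) y)"
  by (induction F) auto

lemma leaves_subst_le: "(\<And>v. leaves (\<sigma> v) \<le> 1) \<Longrightarrow> leaves (subst \<sigma> F) \<le> leaves F"
  by (induction F) (auto intro: add_mono)

lemma vars_subst: "vars (subst \<sigma> F) \<subseteq> (\<Union>v\<in>vars F. vars (\<sigma> v))"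
  by (induction F) auto

lemma ev_cong: "(\<And>v. v \<in> vars F \<Longrightarrow> x v = y v) \<Longrightarrow> ev F x = ev F y"
  by (induction F) auto

lemma ev_leaves_0: "leaves F = 0 \<Longrightarrow> \<exists>c. ev F = (\<lambda>_. c)"
proof (induction F)
  case (Gate c F G)
  then obtain a b where "ev F = (\<lambda>_. a)" "ev G = (\<lambda>_. b)" by auto
  then show ?case by (intro exI[of _ "if c then a \<and> b else a \<or> b"]) auto
qed (auto simp: fun_eq_iff)

lemma ev_leaves_1: "leaves F = 1 \<Longrightarrow> (\<exists>c. ev F = (\<lambda>_. c)) \<or> (\<exists>b v. ev F = (\<lambda>y. y v = b))"
proof (induction F)
  case (Gate c F G)
  then consider "leaves F = 0" "leaves G = 1" | "leaves F = 1" "leaves G = 0" by fastforce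
  then show ?case
  proof cases
    case 1
    then obtain a where a: "ev F = (\<lambda>_. a)" using ev_leaves_0 by blast
    have "ev (Gate c F G) = (if c = a then ev G else (\<lambda>_. a))" by (auto simp: a)
    then show ?thesis using Gate.IH(2)[OF 1(2)] by metis
  next
    case 2
    then obtain a where a: "ev G = (\<lambda>_. a)" using ev_leaves_0 by blast
    have "ev (Gate c F G) = (if c = a then ev F else (\<lambda>_. a))" by (auto simp: a)
    then show ?thesis using Gate.IH(1)[OF 2(1)] by metis
  qed
qed (auto simp: fun_eq_iff)

text \<open>A semantic size, so that no explicit simplification has to follow a projection.
  \<open>LEAST\<close> carries no information for functions that no formula computes (over
  infinitely many variables such functions exist), hence the hypotheses
  \<open>\<phi> \<in> range ev\<close> below.\<close>

definition cost :: "(('v \<Rightarrow> bool) \<Rightarrow> bool) \<Rightarrow> nat" where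
  "cost \<phi> = (LEAST s. \<exists>F. ev F = \<phi> \<and> leaves F = s)"

lemma cost_le: "cost (ev F) \<le> leaves F"
  unfolding cost_def by (rule Least_le) auto

lemma cost_witness: "\<phi> \<in> range ev \<Longrightarrow> \<exists>F. ev F = \<phi> \<and> leaves F = cost \<phi>"
  unfolding cost_def by (rule LeastI_ex) auto

lemma cost_const [simp]: "cost (\<lambda>_ :: 'v \<Rightarrow> bool. c) = 0"
proof -
  have "ev (Const c :: 'v fm) = (\<lambda>_. c)" by (rule ext) (rule ev.simps(1))
  from cost_le[of "Const c :: 'v fm", unfolded this] show ?thesis by simp
qed

lemma cost_1: "\<phi> \<in> range ev \<Longrightarrow> cost \<phi> = 1 \<Longrightarrow> \<exists>b v. \<phi> = (\<lambda>y. y v = b)"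
proof -
  assume \<phi>: "\<phi> \<in> range ev" "cost \<phi> = 1"
  obtain F where F: "ev F = \<phi>" "leaves F = cost \<phi>" using cost_witness[OF \<phi>(1)] by blast
  have "\<phi> \<noteq> (\<lambda>_. c)" for c
  proof
    assume "\<phi> = (\<lambda>_. c)"
    then have "cost \<phi> = 0" by simp
    then show False using \<phi>(2) by simp
  qed
  then show ?thesis using ev_leaves_1[of F] unfolding F \<phi>(2) by blast
qed

lemma cost_gate:
  assumes "\<phi> \<in> range ev" "\<psi> \<in> range ev"
  shows "cost (\<lambda>y. if c then \<phi> y \<and> \<psi> y else \<phi> y \<or> \<psi> y) \<le> cost \<phi> + cost \<psi>"
proof -
  obtain F G where FG: "ev F = \<phi>" "leaves F = cost \<phi>" "ev G = \<psi>" "leaves G = cost \<psi>"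
    using cost_witness[OF assms(1)] cost_witness[OF assms(2)] by blast
  have "(\<lambda>y. if c then \<phi> y \<and> \<psi> y else \<phi> y \<or> \<psi> y) = ev (Gate c F G)"
    by (auto simp: FG)
  then show ?thesis using cost_le[of "Gate c F G"] FG by simp
qed

lemma range_ev_fix:
  assumes "\<phi> \<in> range ev"
  shows "(\<lambda>y. \<phi> (y(i := a))) \<in> range ev"
proof -
  obtain F where F: "\<phi> = ev F" using assms by auto
  define G where "G = subst (\<lambda>v. if v = i then Const a else Lit True v) F"
  have "ev G = (\<lambda>y. \<phi> (y(i := a)))"
    unfolding G_def F ev_subst by (intro ext arg_cong[where f = "ev F"]) auto
  then show ?thesis by (metis rangeI)
qed

text \<open>On the side where the literal does not decide the gate, its variable is known.\<close>

lemma cost_gate_literal: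
  assumes "\<psi> \<in> range ev"
  shows "cost (\<lambda>y. if c then (y i = b) \<and> \<psi> y else (y i = b) \<or> \<psi> y)
           \<le> 1 + cost (\<lambda>y. \<psi> (y(i := (b = c))))" (is "cost ?f \<le> _")
proof -
  obtain G where G: "ev G = (\<lambda>y. \<psi> (y(i := (b = c))))" "leaves G = cost (\<lambda>y. \<psi> (y(i := (b = c))))"
    using cost_witness[OF range_ev_fix[OF assms]] by blast
  have "?f = ev (Gate c (Lit b i) G)"
  proof
    fix y
    show "?f y = ev (Gate c (Lit b i) G) y"
    proof (cases "y i = (b = c)")
      case True
      then have "y(i := (b = c)) = y" by (auto simp: fun_eq_iff)
      then show ?thesis unfolding ev.simps G(1) by (simp only:)
    next
      case False
      then show ?thesis by (auto simp: G)
    qed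
  qed
  then show ?thesis using cost_le[of "Gate c (Lit b i) G"] G by simp
qed

text \<open>Cauchy-Schwarz for (sqrt s1, sqrt s2) and (sqrt a1, sqrt a2), times the common factor q
  sqrt b. The equation proved by \<open>algebra\<close> is Lagrange's identity.\<close>

lemma khrapchenko_gate:
  fixes q a\<^sub>1 a\<^sub>2 s\<^sub>1 s\<^sub>2 b :: real
  assumes "q \<ge> 0" "a\<^sub>1 \<ge> 0" "a\<^sub>2 \<ge> 0" "s\<^sub>1 \<ge> 0" "s\<^sub>2 \<ge> 0" "b \<ge> 0"
  shows "q * sqrt (s\<^sub>1 * a\<^sub>1 * b) + q * sqrt (s\<^sub>2 * a\<^sub>2 * b) \<le> q * sqrt ((s\<^sub>1 + s\<^sub>2) * (a\<^sub>1 + a\<^sub>2) * b)"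
proof -
  define p\<^sub>1 where "p\<^sub>1 = sqrt s\<^sub>1"
  define p\<^sub>2 where "p\<^sub>2 = sqrt s\<^sub>2"
  define r\<^sub>1 where "r\<^sub>1 = sqrt a\<^sub>1"
  define r\<^sub>2 where "r\<^sub>2 = sqrt a\<^sub>2"
  have e: "s\<^sub>1 = p\<^sub>1\<^sup>2" "s\<^sub>2 = p\<^sub>2\<^sup>2" "a\<^sub>1 = r\<^sub>1\<^sup>2" "a\<^sub>2 = r\<^sub>2\<^sup>2"
    using assms by (simp_all add: p\<^sub>1_def p\<^sub>2_def r\<^sub>1_def r\<^sub>2_def)
  have "(p\<^sub>1\<^sup>2 + p\<^sub>2\<^sup>2) * (r\<^sub>1\<^sup>2 + r\<^sub>2\<^sup>2) = (p\<^sub>1 * r\<^sub>1 + p\<^sub>2 * r\<^sub>2)\<^sup>2 + (p\<^sub>1 * r\<^sub>2 - p\<^sub>2 * r\<^sub>1)\<^sup>2" by algebra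
  then have "(p\<^sub>1 * r\<^sub>1 + p\<^sub>2 * r\<^sub>2)\<^sup>2 \<le> (s\<^sub>1 + s\<^sub>2) * (a\<^sub>1 + a\<^sub>2)" unfolding e by simp
  then have "p\<^sub>1 * r\<^sub>1 + p\<^sub>2 * r\<^sub>2 \<le> sqrt ((s\<^sub>1 + s\<^sub>2) * (a\<^sub>1 + a\<^sub>2))" by (rule real_le_rsqrt)
  then have "q * sqrt b * (p\<^sub>1 * r\<^sub>1 + p\<^sub>2 * r\<^sub>2) \<le> q * sqrt b * sqrt ((s\<^sub>1 + s\<^sub>2) * (a\<^sub>1 + a\<^sub>2))"
    using assms by (intro mult_left_mono) auto
  also have "\<dots> = q * sqrt ((s\<^sub>1 + s\<^sub>2) * (a\<^sub>1 + a\<^sub>2) * b)"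
    by (simp only: real_sqrt_mult mult_ac)
  finally show ?thesis
    by (simp add: p\<^sub>1_def p\<^sub>2_def r\<^sub>1_def r\<^sub>2_def real_sqrt_mult mult_ac distrib_left)
qed

text \<open>Khrapchenko's bound for a weighted multigraph with edges \<open>E\<close> from \<open>src\<close> to \<open>tgt\<close>.\<close>

lemma weighted_khrapchenko:
  fixes \<omega> :: "'e \<Rightarrow> real" and u :: "'p \<Rightarrow> real" and q :: real
  assumes "finite E" "finite A" "finite B" "q \<ge> 0"
    and "\<And>e. e \<in> E \<Longrightarrow> \<omega> e \<ge> 0" "\<And>p. p \<in> A \<union> B \<Longrightarrow> u p \<ge> 0"
    and "\<And>p. p \<in> A \<Longrightarrow> \<not> ev F (x p)" "\<And>p. p \<in> B \<Longrightarrow> ev F (x p)"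
    and "\<And>p v. p \<in> A \<Longrightarrow> v \<in> vars F \<Longrightarrow>
           (\<Sum>e | e \<in> E \<and> src e = p \<and> x (src e) v \<noteq> x (tgt e) v. \<omega> e) \<le> q * u p"
    and "\<And>p v. p \<in> B \<Longrightarrow> v \<in> vars F \<Longrightarrow>
           (\<Sum>e | e \<in> E \<and> tgt e = p \<and> x (src e) v \<noteq> x (tgt e) v. \<omega> e) \<le> q * u p"
  shows "(\<Sum>e | e \<in> E \<and> src e \<in> A \<and> tgt e \<in> B. \<omega> e)
           \<le> q * sqrt (real (leaves F) * sum u A * sum u B)"
  using assms
proof (induction F arbitrary: A B)
  case (Const c)
  then have "A = {} \<or> B = {}" by (cases c) auto
  then show ?case by auto
next
  case (Lit b v)
  let ?E = "{e \<in> E. src e \<in> A \<and> tgt e \<in> B}"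
  let ?W = "\<Sum>e\<in>?E. \<omega> e"
  \<comment> \<open>The literal tells A from B, so every counted edge flips v. The total is
    therefore bounded by the stars at A and by the stars at B, hence by the geometric mean of the
    two bounds.\<close>
  have d: "x (src e) v \<noteq> x (tgt e) v" if "e \<in> ?E" for e
    using that Lit.prems(7)[of "src e"] Lit.prems(8)[of "tgt e"] by auto
  have "?W = (\<Sum>p\<in>A. \<Sum>e | e \<in> ?E \<and> src e = p. \<omega> e)"
    using Lit.prems(1,2) by (subst sum.group) auto
  also have "\<dots> \<le> (\<Sum>p\<in>A. q * u p)"
  proof (rule sum_mono)
    fix p assume p: "p \<in> A"
    have "(\<Sum>e | e \<in> ?E \<and> src e = p. \<omega> e)
            \<le> (\<Sum>e | e \<in> E \<and> src e = p \<and> x (src e) v \<noteq> x (tgt e) v. \<omega> e)"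
      using d Lit.prems(1,5) by (intro sum_mono2) auto
    also have "\<dots> \<le> q * u p" using Lit.prems(9)[OF p] by simp
    finally show "(\<Sum>e | e \<in> ?E \<and> src e = p. \<omega> e) \<le> q * u p" .
  qed
  finally have a: "?W \<le> q * sum u A" by (simp add: sum_distrib_left)
  have "?W = (\<Sum>p\<in>B. \<Sum>e | e \<in> ?E \<and> tgt e = p. \<omega> e)"
    using Lit.prems(1,3) by (subst sum.group) auto
  also have "\<dots> \<le> (\<Sum>p\<in>B. q * u p)"
  proof (rule sum_mono)
    fix p assume p: "p \<in> B"
    have "(\<Sum>e | e \<in> ?E \<and> tgt e = p. \<omega> e)
            \<le> (\<Sum>e | e \<in> E \<and> tgt e = p \<and> x (src e) v \<noteq> x (tgt e) v. \<omega> e)"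
      using d Lit.prems(1,5) by (intro sum_mono2) auto
    also have "\<dots> \<le> q * u p" using Lit.prems(10)[OF p] by simp
    finally show "(\<Sum>e | e \<in> ?E \<and> tgt e = p. \<omega> e) \<le> q * u p" .
  qed
  finally have b: "?W \<le> q * sum u B" by (simp add: sum_distrib_left)
  have nn: "?W \<ge> 0" using Lit.prems(5) by (intro sum_nonneg) auto
  have "?W\<^sup>2 \<le> (q * sum u A) * (q * sum u B)"
    unfolding power2_eq_square using a b nn by (intro mult_mono) auto
  then have "?W \<le> sqrt ((q * sum u A) * (q * sum u B))" by (rule real_le_rsqrt)
  also have "\<dots> = sqrt (q\<^sup>2 * (sum u A * sum u B))" by (simp add: power2_eq_square algebra_simps)
  also have "\<dots> = q * sqrt (sum u A * sum u B)" using Lit.prems(4) by (simp add: real_sqrt_mult)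
  finally show ?case by simp
next
  case (Gate c F G)
  note sub = Gate.prems(1-6) Gate.prems(9,10)
  let ?w = "\<lambda>A B. \<Sum>e | e \<in> E \<and> src e \<in> A \<and> tgt e \<in> B. \<omega> e"
  have nn: "sum u X \<ge> 0" if "X \<subseteq> A \<union> B" for X
    using Gate.prems(6) that by (intro sum_nonneg) auto
  show ?case
  proof (cases c)
    case True
    \<comment> \<open>A false And has a false child: each point of A is charged to one. The children
      then separate disjoint parts of A from all of B. For Or the roles of A and B are
      exchanged.\<close>
    define A1 where "A1 = {p \<in> A. \<not> ev F (x p)}"
    define A2 where "A2 = A - A1"
    have AA: "A = A1 \<union> A2" "A1 \<inter> A2 = {}" "A1 \<subseteq> A" "A2 \<subseteq> A" "finite A1" "finite A2"
      using Gate.prems(2) by (auto simp: A1_def A2_def)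
    have F0: "\<not> ev F (x p)" if "p \<in> A1" for p using that by (auto simp: A1_def)
    have G0: "\<not> ev G (x p)" if "p \<in> A2" for p
      using that Gate.prems(7)[of p] True by (auto simp: A1_def A2_def)
    have B1: "ev F (x p)" "ev G (x p)" if "p \<in> B" for p using Gate.prems(8)[OF that] True by auto
    have "?w A B = ?w A1 B + ?w A2 B"
      using AA Gate.prems(1) by (subst sum.union_disjoint[symmetric]) (auto intro!: sum.cong)
    also have "?w A1 B \<le> q * sqrt (leaves F * sum u A1 * sum u B)"
      by (rule Gate.IH(1)) (use sub AA F0 B1 in auto)
    also have "?w A2 B \<le> q * sqrt (leaves G * sum u A2 * sum u B)"
      by (rule Gate.IH(2)) (use sub AA G0 B1 in auto)
    also have "q * sqrt (leaves F * sum u A1 * sum u B) + q * sqrt (leaves G * sum u A2 * sum u B)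
       \<le> q * sqrt ((real (leaves F) + leaves G) * (sum u A1 + sum u A2) * sum u B)"
      using nn AA Gate.prems(4) by (intro khrapchenko_gate) auto
    also have "sum u A1 + sum u A2 = sum u A"
      using AA by (simp add: sum.union_disjoint)
    finally show ?thesis by simp
  next
    case False
    define B1 where "B1 = {p \<in> B. ev F (x p)}"
    define B2 where "B2 = B - B1"
    have BB: "B = B1 \<union> B2" "B1 \<inter> B2 = {}" "B1 \<subseteq> B" "B2 \<subseteq> B" "finite B1" "finite B2"
      using Gate.prems(3) by (auto simp: B1_def B2_def)
    have F1: "ev F (x p)" if "p \<in> B1" for p using that by (auto simp: B1_def)
    have G1: "ev G (x p)" if "p \<in> B2" for p
      using that Gate.prems(8)[of p] False by (auto simp: B1_def B2_def)
    have A0: "\<not> ev F (x p)" "\<not> ev G (x p)" if "p \<in> A" for p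
      using Gate.prems(7)[OF that] False by auto
    have "?w A B = ?w A B1 + ?w A B2"
      using BB Gate.prems(1) by (subst sum.union_disjoint[symmetric]) (auto intro!: sum.cong)
    also have "?w A B1 \<le> q * sqrt (leaves F * sum u A * sum u B1)"
      by (rule Gate.IH(1)) (use sub BB F1 A0 in auto)
    also have "?w A B2 \<le> q * sqrt (leaves G * sum u A * sum u B2)"
      by (rule Gate.IH(2)) (use sub BB G1 A0 in auto)
    also have "q * sqrt (leaves F * sum u A * sum u B1) + q * sqrt (leaves G * sum u A * sum u B2)
       = q * sqrt (leaves F * sum u B1 * sum u A) + q * sqrt (leaves G * sum u B2 * sum u A)"
      by (simp add: mult_ac)
    also have "\<dots> \<le> q * sqrt ((real (leaves F) + leaves G) * (sum u B1 + sum u B2) * sum u A)"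
      using nn BB Gate.prems(4) by (intro khrapchenko_gate) auto
    also have "sum u B1 + sum u B2 = sum u B"
      using BB by (simp add: sum.union_disjoint)
    finally show ?thesis by (simp add: mult_ac)
  qed
qed

subsection \<open>Random projections\<close>

lemma literal_unique:
  assumes "(\<lambda>y :: 'v \<Rightarrow> bool. y i = b) = (\<lambda>y. y j = d)"
  shows "i = j \<and> b = d"
proof -
  have "((\<lambda>_. b) i = b) = ((\<lambda>_. b) j = d)" by (rule fun_cong[OF assms])
  moreover have "(((\<lambda>_. b)(j := \<not> b)) i = b) = (((\<lambda>_. b)(j := \<not> b)) j = d)"
    by (rule fun_cong[OF assms])
  ultimately show ?thesis by (auto split: if_splits)
qed

text \<open>Block i holds a point of S, and the variable v is one bit of the point in its block. A
  projection gives every block an ordered pair of points, between which a new variable y i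
  chooses.\<close>

locale projection_space =
  fixes I :: "'i set" and S :: "'a set" and blk :: "'v \<Rightarrow> 'i" and val :: "'v \<Rightarrow> 'a \<Rightarrow> bool"
  assumes finite_I: "finite I" and finite_S: "finite S"
begin

definition inp :: "('i \<Rightarrow> 'a \<times> 'a) \<Rightarrow> ('i \<Rightarrow> bool) \<Rightarrow> 'v \<Rightarrow> bool" where
  "inp \<pi> y v = val v (if y (blk v) then snd (\<pi> (blk v)) else fst (\<pi> (blk v)))"

definition proj :: "'v fm \<Rightarrow> ('i \<Rightarrow> 'a \<times> 'a) \<Rightarrow> ('i \<Rightarrow> bool) \<Rightarrow> bool" where
  "proj F \<pi> y = ev F (inp \<pi> y)"

text \<open>Fixing a variable as an operation on projections: the pair collapses to an equal pair,
  so the result lies in the same space as the original.\<close>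

definition fixv :: "bool \<Rightarrow> 'i \<Rightarrow> ('i \<Rightarrow> 'a \<times> 'a) \<Rightarrow> 'i \<Rightarrow> 'a \<times> 'a" where
  "fixv c i \<pi> = \<pi>(i := (if c then (snd (\<pi> i), snd (\<pi> i)) else (fst (\<pi> i), fst (\<pi> i))))"

definition \<Omega> :: "('i \<Rightarrow> 'a \<times> 'a) set" where
  "\<Omega> = (\<Pi>\<^sub>E i\<in>I. S \<times> S)"

definition closed_under_fixing :: "('i \<Rightarrow> 'a \<times> 'a) set \<Rightarrow> bool" where
  "closed_under_fixing \<Delta> \<longleftrightarrow> \<Delta> \<subseteq> \<Omega> \<and> (\<forall>\<pi>\<in>\<Delta>. \<forall>i\<in>I. \<forall>c. fixv c i \<pi> \<in> \<Delta>)"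

text \<open>The star condition of \<open>weighted_khrapchenko\<close> for one block: the vertex is
  the equal pair (a, a), and its edges are the pairs, in either order, that join a to a point with
  another bit v. Weights are not normalized.\<close>

definition hiding :: "real \<Rightarrow> ('i \<Rightarrow> 'a \<times> 'a \<Rightarrow> real) \<Rightarrow> bool" where
  "hiding q w \<longleftrightarrow> q \<ge> 0 \<and> (\<forall>i\<in>I. \<forall>p\<in>S\<times>S. w i p \<ge> 0) \<and>
     (\<forall>v. blk v \<in> I \<longrightarrow> (\<forall>a\<in>S.
        (\<Sum>b | b \<in> S \<and> val v b \<noteq> val v a. w (blk v) (a, b) + w (blk v) (b, a))
          \<le> q * w (blk v) (a, a)))"

definition wt :: "('i \<Rightarrow> 'a \<times> 'a \<Rightarrow> real) \<Rightarrow> ('i \<Rightarrow> 'a \<times> 'a) \<Rightarrow> real" where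
  "wt w \<pi> = (\<Prod>i\<in>I. w i (\<pi> i))"

lemma finite_\<Omega>: "finite \<Omega>"
  unfolding \<Omega>_def using finite_I finite_S by (intro finite_PiE) auto

lemma closed_finite: "closed_under_fixing \<Delta> \<Longrightarrow> finite \<Delta>"
  unfolding closed_under_fixing_def using finite_\<Omega> finite_subset by blast

lemma closed_\<Omega>: "closed_under_fixing \<Omega>"
  unfolding closed_under_fixing_def
proof (intro conjI ballI allI subset_refl)
  fix \<pi> i c assume \<pi>: "\<pi> \<in> \<Omega>" and i: "i \<in> I"
  have "\<pi> i \<in> S \<times> S" using \<pi> i unfolding \<Omega>_def by blast
  then have "(if c then (snd (\<pi> i), snd (\<pi> i)) else (fst (\<pi> i), fst (\<pi> i))) \<in> S \<times> S" by auto
  then have "fixv c i \<pi> \<in> (\<Pi>\<^sub>E j\<in>insert i I. S \<times> S)"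
    using \<pi> unfolding fixv_def \<Omega>_def by (intro PiE_fun_upd)
  then show "fixv c i \<pi> \<in> \<Omega>" using i by (simp add: \<Omega>_def insert_absorb)
qed

lemma wt_nonneg: "hiding q w \<Longrightarrow> \<pi> \<in> \<Omega> \<Longrightarrow> wt w \<pi> \<ge> 0"
  unfolding wt_def hiding_def \<Omega>_def PiE_iff by (intro prod_nonneg) blast

lemma wt_upd:
  assumes "i \<in> I"
  shows "wt w (\<pi>(i := p)) = w i p * (\<Prod>j\<in>I - {i}. w j (\<pi> j))"
  unfolding wt_def using assms finite_I by (subst prod.remove[of _ i]) (auto intro!: prod.cong)

lemma inp_fixv: "inp (fixv c i \<pi>) y = inp \<pi> (y(i := c))"
  by (rule ext) (auto simp: inp_def fixv_def)

lemma proj_fixv: "proj F (fixv c i \<pi>) = (\<lambda>y. proj F \<pi> (y(i := c)))"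
  by (rule ext) (simp add: proj_def inp_fixv)

text \<open>A bit on which both points of its block agree becomes a constant and any other bit a
  literal, so projecting never adds leaves.\<close>

lemma proj_formula: "\<exists>G. ev G = proj F \<pi> \<and> leaves G \<le> leaves F"
proof -
  define \<sigma> where "\<sigma> v = (let a = val v (fst (\<pi> (blk v))); b = val v (snd (\<pi> (blk v))) in
                        if a = b then Const a else Lit b (blk v))" for v
  have "ev (subst \<sigma> F) = proj F \<pi>"
    unfolding proj_def[abs_def] ev_subst
    by (intro ext arg_cong[where f = "ev F"]) (auto simp: \<sigma>_def inp_def Let_def)
  moreover have "leaves (subst \<sigma> F) \<le> leaves F" by (rule leaves_subst_le) (simp add: \<sigma>_def Let_def)
  ultimately show ?thesis by blast
qed

lemma proj_expressible: "proj F \<pi> \<in> range ev"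
  using proj_formula by (metis rangeI)

lemma cost_proj_le: "cost (proj F \<pi>) \<le> leaves F"
  using proj_formula[of F \<pi>] cost_le by (metis order_trans)

lemma proj_gate: "proj (Gate c F G) \<pi> = (\<lambda>y. if c then proj F \<pi> y \<and> proj G \<pi> y else proj F \<pi> y \<or> proj G \<pi> y)"
  by (rule ext) (simp add: proj_def)

lemma literal_in_I:
  assumes "blk ` vars F \<subseteq> I" "proj F \<pi> = (\<lambda>y. y i = b)"
  shows "i \<in> I"
proof (rule ccontr)
  assume i: "i \<notin> I"
  have "proj F \<pi> (\<lambda>_. True) = proj F \<pi> ((\<lambda>_. True)(i := False))"
    unfolding proj_def using assms(1) i by (intro ev_cong) (auto simp: inp_def)
  then show False unfolding assms(2) by simp
qed

definition literals :: "'v fm \<Rightarrow> ('i \<Rightarrow> 'a \<times> 'a) set" where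
  "literals F = {\<pi>. \<exists>i b. proj F \<pi> = (\<lambda>y. y i = b)}"

text \<open>If the projection of \<open>F\<close> is a literal, fixing its variable yields the two ends of an edge of
  Khrapchenko's graph.\<close>

lemma literals_weight:
  assumes \<Delta>: "closed_under_fixing \<Delta>" and w: "hiding q w" and F: "blk ` vars F \<subseteq> I"
  shows "(\<Sum>\<pi>\<in>\<Delta> \<inter> literals F. wt w \<pi>) \<le> q * sqrt (leaves F) * (\<Sum>\<pi>\<in>\<Delta>. wt w \<pi>)"
proof -
  let ?E = "\<Delta> \<inter> literals F"
  have q: "q \<ge> 0" using w by (simp add: hiding_def)
  have fin: "finite \<Delta>" using \<Delta> by (rule closed_finite)
  have sub: "\<Delta> \<subseteq> \<Omega>" using \<Delta> by (simp add: closed_under_fixing_def)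
  have nn: "wt w \<pi> \<ge> 0" if "\<pi> \<in> \<Delta>" for \<pi> using wt_nonneg[OF w] that sub by blast
  have "\<forall>\<pi>\<in>?E. \<exists>i b. proj F \<pi> = (\<lambda>y. y i = b)" by (auto simp: literals_def)
  then obtain ix sg where lit: "\<And>\<pi>. \<pi> \<in> ?E \<Longrightarrow> proj F \<pi> = (\<lambda>y. y (ix \<pi>) = sg \<pi>)"
    unfolding bchoice_iff by metis
  have ixI: "ix \<pi> \<in> I" if "\<pi> \<in> ?E" for \<pi> using literal_in_I[OF F lit[OF that]] .
  define src where "src \<pi> = fixv (\<not> sg \<pi>) (ix \<pi>) \<pi>" for \<pi>
  define tgt where "tgt \<pi> = fixv (sg \<pi>) (ix \<pi>) \<pi>" for \<pi>
  define A where "A = {\<pi> \<in> \<Delta>. proj F \<pi> = (\<lambda>_. False)}"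
  define B where "B = {\<pi> \<in> \<Delta>. proj F \<pi> = (\<lambda>_. True)}"
  \<comment> \<open>Elements of \<open>A\<close> and \<open>B\<close> have constant projections, so
    any setting of the y represents them.\<close>
  define x where "x \<pi> = inp \<pi> (\<lambda>_. False)" for \<pi>
  have srcA: "src \<pi> \<in> A" if "\<pi> \<in> ?E" for \<pi>
    using that lit[OF that] ixI[OF that] \<Delta>
    by (auto simp: A_def src_def proj_fixv closed_under_fixing_def)
  have tgtB: "tgt \<pi> \<in> B" if "\<pi> \<in> ?E" for \<pi>
    using that lit[OF that] ixI[OF that] \<Delta>
    by (auto simp: B_def tgt_def proj_fixv closed_under_fixing_def)
  \<comment> \<open>At an end p of an edge the block i is an equal pair (a, a). The edges at p that
    flip v replace it by (a, b) or (b, a), where b differs from a in bit v; their weights are the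
    sum in \<open>hiding\<close>, times the weight of the other blocks.\<close>
  have star: "(\<Sum>\<pi> | \<pi> \<in> ?E \<and> e \<pi> = p \<and> x (src \<pi>) v \<noteq> x (tgt \<pi>) v. wt w \<pi>) \<le> q * wt w p"
    if p: "p \<in> \<Delta>" and v: "v \<in> vars F"
      and e: "(e = src \<and> e' = tgt) \<or> (e = tgt \<and> e' = src)" for p v e e'
  proof -
    define i where "i = blk v"
    have i: "i \<in> I" using v F by (auto simp: i_def)
    define a where "a = fst (p i)"
    have aS: "a \<in> S" using p sub i by (auto simp: a_def \<Omega>_def PiE_iff mem_Times_iff)
    let ?b = "{b \<in> S. val v b \<noteq> val v a}"
    let ?P = "{\<pi> \<in> ?E. e \<pi> = p \<and> x (src \<pi>) v \<noteq> x (tgt \<pi>) v}"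
    let ?X = "(\<lambda>b. p(i := (a, b))) ` ?b" and ?Y = "(\<lambda>b. p(i := (b, a))) ` ?b"
    have fb: "finite ?b" using finite_S by auto
    have props: "\<pi> \<in> ?X \<union> ?Y \<and> p i = (a, a)" if \<pi>: "\<pi> \<in> ?P" for \<pi>
    proof -
      have ne: "x (src \<pi>) v \<noteq> x (tgt \<pi>) v" and pe: "e \<pi> = p" and \<pi>E: "\<pi> \<in> ?E" using \<pi> by auto
      have ix: "ix \<pi> = i"
      proof (rule ccontr)
        assume "ix \<pi> \<noteq> i"
        then have "x (src \<pi>) v = x (tgt \<pi>) v"
          by (auto simp: x_def src_def tgt_def inp_def fixv_def i_def)
        then show False using ne by simp
      qed
      obtain a0 b0 where ab: "\<pi> i = (a0, b0)" by (cases "\<pi> i")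
      have "\<pi> i \<in> S \<times> S" using \<pi>E sub i unfolding \<Omega>_def by blast
      then have abS: "a0 \<in> S" "b0 \<in> S" using ab by auto
      have val: "val v a0 \<noteq> val v b0"
        using ne ab by (auto simp: x_def src_def tgt_def inp_def fixv_def ix i_def split: if_splits)
      have "p = \<pi>(i := (a0, a0)) \<or> p = \<pi>(i := (b0, b0))"
        using pe e ab by (cases "sg \<pi>") (auto simp: src_def tgt_def fixv_def ix)
      then show ?thesis
      proof
        assume pp: "p = \<pi>(i := (a0, a0))"
        then have a: "a = a0" "p i = (a, a)" by (auto simp: a_def)
        have "\<pi> = p(i := (a, b0))" unfolding pp a using ab by (auto simp: fun_eq_iff)
        then show ?thesis using abS val a by auto
      next
        assume pp: "p = \<pi>(i := (b0, b0))"
        then have a: "a = b0" "p i = (a, a)" by (auto simp: a_def)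
        have "\<pi> = p(i := (a0, a))" unfolding pp a using ab by (auto simp: fun_eq_iff)
        then show ?thesis using abS val a by auto
      qed
    qed
    show ?thesis
    proof (cases "?P = {}")
      case True
      show ?thesis unfolding True using nn[OF p] q by simp
    next
      case False
      then have pi: "p i = (a, a)" using props by blast
      define R where "R = (\<Prod>j\<in>I - {i}. w j (p j))"
      have "p j \<in> S \<times> S" if "j \<in> I" for j using p sub that unfolding \<Omega>_def by blast
      then have R: "R \<ge> 0" unfolding R_def using w unfolding hiding_def
        by (intro prod_nonneg) blast
      have XYO: "\<pi> \<in> \<Omega>" if "\<pi> \<in> ?X \<union> ?Y" for \<pi>
        using that p sub aS i by (auto simp: \<Omega>_def PiE_iff extensional_def subset_iff)
      have "(\<Sum>\<pi>\<in>?P. wt w \<pi>) \<le> (\<Sum>\<pi>\<in>?X \<union> ?Y. wt w \<pi>)"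
        using props fb XYO wt_nonneg[OF w] by (intro sum_mono2) auto
      also have "\<dots> \<le> (\<Sum>\<pi>\<in>?X. wt w \<pi>) + (\<Sum>\<pi>\<in>?Y. wt w \<pi>)"
      proof -
        have "(\<Sum>\<pi>\<in>?X \<inter> ?Y. wt w \<pi>) \<ge> 0"
          using XYO wt_nonneg[OF w] by (intro sum_nonneg) auto
        then show ?thesis using sum.union_inter[of ?X ?Y "wt w"] fb by auto
      qed
      also have "(\<Sum>\<pi>\<in>?X. wt w \<pi>) \<le> (\<Sum>b\<in>?b. wt w (p(i := (a, b))))"
        using XYO wt_nonneg[OF w] fb by (intro sum_image_le[THEN order_trans]) auto
      also have "(\<Sum>\<pi>\<in>?Y. wt w \<pi>) \<le> (\<Sum>b\<in>?b. wt w (p(i := (b, a))))"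
        using XYO wt_nonneg[OF w] fb by (intro sum_image_le[THEN order_trans]) auto
      also have "(\<Sum>b\<in>?b. wt w (p(i := (a, b)))) + (\<Sum>b\<in>?b. wt w (p(i := (b, a))))
          = (\<Sum>b\<in>?b. w i (a, b) + w i (b, a)) * R"
        by (simp add: wt_upd[OF i] R_def sum.distrib sum_distrib_right distrib_right)
      also have "\<dots> \<le> (q * w i (a, a)) * R"
        using w aS i R by (intro mult_right_mono) (auto simp: hiding_def i_def)
      also have "\<dots> = q * wt w (p(i := (a, a)))"
        by (simp add: wt_upd[OF i] R_def)
      also have "p(i := (a, a)) = p" using pi by auto
      finally show ?thesis by simp
    qed
  qed
  have "?E = {\<pi> \<in> ?E. src \<pi> \<in> A \<and> tgt \<pi> \<in> B}" using srcA tgtB by blast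
  then have "(\<Sum>\<pi>\<in>?E. wt w \<pi>) = (\<Sum>\<pi> | \<pi> \<in> ?E \<and> src \<pi> \<in> A \<and> tgt \<pi> \<in> B. wt w \<pi>)" by simp
  also have "\<dots> \<le> q * sqrt (real (leaves F) * sum (wt w) A * sum (wt w) B)"
  proof (rule weighted_khrapchenko[where x = x])
    show "\<not> ev F (x p)" if "p \<in> A" for p
      using that by (auto simp: A_def x_def proj_def fun_eq_iff)
    show "ev F (x p)" if "p \<in> B" for p
      using that by (auto simp: B_def x_def proj_def fun_eq_iff)
    show "(\<Sum>e | e \<in> ?E \<and> src e = p \<and> x (src e) v \<noteq> x (tgt e) v. wt w e) \<le> q * wt w p"
      if "p \<in> A" "v \<in> vars F" for p v using star[of p v src tgt] that by (auto simp: A_def)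
    show "(\<Sum>e | e \<in> ?E \<and> tgt e = p \<and> x (src e) v \<noteq> x (tgt e) v. wt w e) \<le> q * wt w p"
      if "p \<in> B" "v \<in> vars F" for p v using star[of p v tgt src] that by (auto simp: B_def)
  qed (use fin nn q in \<open>auto simp: A_def B_def\<close>)
  also have "\<dots> \<le> q * sqrt (real (leaves F) * (sum (wt w) \<Delta> * sum (wt w) \<Delta>))"
  proof -
    have "sum (wt w) A \<le> sum (wt w) \<Delta>" "sum (wt w) B \<le> sum (wt w) \<Delta>"
      using fin nn by (auto intro!: sum_mono2 simp: A_def B_def)
    moreover have "sum (wt w) A \<ge> 0" "sum (wt w) B \<ge> 0"
      using nn by (auto intro!: sum_nonneg simp: A_def B_def)
    ultimately show ?thesis using q
      by (intro mult_left_mono real_sqrt_le_mono) (auto simp: mult.assoc intro!: mult_mono mult_left_mono)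
  qed
  also have "\<dots> = q * sqrt (leaves F) * sum (wt w) \<Delta>"
    using nn by (simp add: real_sqrt_mult sum_nonneg)
  finally show ?thesis .
qed

definition litof :: "'v fm \<Rightarrow> ('i \<Rightarrow> 'a \<times> 'a) \<Rightarrow> 'i \<times> bool" where
  "litof F \<pi> = (SOME l. proj F \<pi> = (\<lambda>y. y (fst l) = snd l))"

text \<open>The literal gets the value \<open>c\<close>, which is the one that leaves a gate of type
  \<open>c\<close> undecided: true for And, false for Or.\<close>

definition fixlit :: "bool \<Rightarrow> 'v fm \<Rightarrow> ('i \<Rightarrow> 'a \<times> 'a) \<Rightarrow> 'i \<Rightarrow> 'a \<times> 'a" where
  "fixlit c F \<pi> = fixv (snd (litof F \<pi>) = c) (fst (litof F \<pi>)) \<pi>"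

lemma proj_litof:
  assumes "\<pi> \<in> literals F"
  shows "proj F \<pi> = (\<lambda>y. y (fst (litof F \<pi>)) = snd (litof F \<pi>))"
proof -
  have "\<exists>l. proj F \<pi> = (\<lambda>y. y (fst l) = snd l)" using assms by (auto simp: literals_def)
  from someI_ex[OF this] show ?thesis unfolding litof_def .
qed

text \<open>A block frozen at (x, x) has no edges of positive weight and meets the star condition
  for every q. This makes the class of hiding weights stable under the conditioning below.\<close>

lemma hiding_point_mass:
  assumes "hiding q w" "x \<in> S"
  shows "hiding q (w(i := (\<lambda>p. if p = (x, x) then 1 else 0)))" (is "hiding q ?w")
proof -
  have "(\<Sum>b | b \<in> S \<and> val v b \<noteq> val v a. ?w (blk v) (a, b) + ?w (blk v) (b, a))
          \<le> q * ?w (blk v) (a, a)" if "blk v \<in> I" "a \<in> S" for v a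
  proof (cases "blk v = i")
    case True
    have "(\<Sum>b | b \<in> S \<and> val v b \<noteq> val v a. ?w (blk v) (a, b) + ?w (blk v) (b, a)) = 0"
      using True by (intro sum.neutral) auto
    then show ?thesis using assms(1) True by (simp add: hiding_def)
  next
    case False
    then show ?thesis using assms(1) that by (simp add: hiding_def)
  qed
  then show ?thesis using assms(1) unfolding hiding_def by auto
qed

text \<open>Conditioning on the value of block \<open>i\<close> and on the projection of \<open>F\<close> being a literal in \<open>y\<^sub>i\<close>
  leaves a set closed under fixing.\<close>

lemma literal_conditioning:
  assumes \<Delta>: "closed_under_fixing \<Delta>" and w: "hiding q w" and i: "i \<in> I"
    and G: "\<And>\<Delta>' w'. closed_under_fixing \<Delta>' \<Longrightarrow> hiding q w' \<Longrightarrow>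
              (\<Sum>\<pi>\<in>\<Delta>'. wt w' \<pi> * real (cost (proj G \<pi>))) \<le> \<beta> * (\<Sum>\<pi>\<in>\<Delta>'. wt w' \<pi>)"
  shows "(\<Sum>\<pi> | \<pi> \<in> \<Delta> \<and> proj F \<pi> = (\<lambda>y. y i = b). wt w \<pi> * real (cost (proj G (fixv d i \<pi>))))
           \<le> \<beta> * (\<Sum>\<pi> | \<pi> \<in> \<Delta> \<and> proj F \<pi> = (\<lambda>y. y i = b). wt w \<pi>)"
proof -
  let ?L = "{\<pi> \<in> \<Delta>. proj F \<pi> = (\<lambda>y. y i = b)}"
  have fin: "finite ?L" using closed_finite[OF \<Delta>] by auto
  have sub: "\<Delta> \<subseteq> \<Omega>" using \<Delta> by (simp add: closed_under_fixing_def)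
  \<comment> \<open>Split by the pair p in block i. Fixing y i keeps only one component x of p, so
    for given p the block may be regarded as frozen at (x, x).\<close>
  have part: "(\<Sum>\<pi> | \<pi> \<in> ?L \<and> \<pi> i = p. wt w \<pi> * real (cost (proj G (fixv d i \<pi>))))
                \<le> \<beta> * (\<Sum>\<pi> | \<pi> \<in> ?L \<and> \<pi> i = p. wt w \<pi>)" if p: "p \<in> S \<times> S" for p
  proof -
    define x where "x = (if d then snd p else fst p)"
    have x: "x \<in> S" using p by (auto simp: x_def)
    define w' where "w' = w(i := (\<lambda>p. if p = (x, x) then 1 else (0::real)))"
    \<comment> \<open>The fixed projections whose originals, with p put back into block i, lie in
      \<open>?L\<close>. Putting back is a bijection that multiplies the weight by w i p.\<close>
    define \<Delta>' where "\<Delta>' = {\<pi> \<in> \<Omega>. \<pi> i = (x, x) \<and> \<pi>(i := p) \<in> ?L}"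
    have w': "hiding q w'" unfolding w'_def by (rule hiding_point_mass[OF w x])
    have cl: "closed_under_fixing \<Delta>'"
      unfolding closed_under_fixing_def
    proof (intro conjI ballI allI)
      show "\<Delta>' \<subseteq> \<Omega>" by (auto simp: \<Delta>'_def)
      fix \<pi> j c assume \<pi>: "\<pi> \<in> \<Delta>'" and j: "j \<in> I"
      show "fixv c j \<pi> \<in> \<Delta>'"
      proof (cases "j = i")
        case True
        then have "fixv c j \<pi> = \<pi>" using \<pi> by (auto simp: fixv_def \<Delta>'_def)
        then show ?thesis using \<pi> by simp
      next
        case False
        have eq: "(fixv c j \<pi>)(i := p) = fixv c j (\<pi>(i := p))"
          using False by (auto simp: fixv_def fun_eq_iff)
        have "fixv c j (\<pi>(i := p)) \<in> \<Delta>"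
          using \<pi> \<Delta> j by (auto simp: \<Delta>'_def closed_under_fixing_def)
        \<comment> \<open>The literal depends on y i alone and survives the fixing of any other
          variable; fixing y i itself does nothing, since the block is already an equal
          pair.\<close>
        moreover have "proj F (fixv c j (\<pi>(i := p))) = (\<lambda>y. y i = b)"
          using \<pi> False unfolding proj_fixv by (auto simp: \<Delta>'_def)
        moreover have "fixv c j \<pi> \<in> \<Omega>"
          using \<pi> j by (auto simp: \<Delta>'_def \<Omega>_def fixv_def PiE_iff extensional_def mem_Times_iff)
        moreover have "fixv c j \<pi> i = (x, x)" using \<pi> False by (simp add: \<Delta>'_def fixv_def)
        ultimately show ?thesis by (simp add: \<Delta>'_def eq)
      qed
    qed
    have bij: "bij_betw (\<lambda>\<pi>. \<pi>(i := p)) \<Delta>' {\<pi> \<in> ?L. \<pi> i = p}"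
    proof (rule bij_betw_byWitness[where f' = "\<lambda>\<pi>. \<pi>(i := (x, x))"])
      show "(\<lambda>\<pi>. \<pi>(i := (x, x))) ` {\<pi> \<in> ?L. \<pi> i = p} \<subseteq> \<Delta>'"
      proof
        fix \<rho> assume "\<rho> \<in> (\<lambda>\<pi>. \<pi>(i := (x, x))) ` {\<pi> \<in> ?L. \<pi> i = p}"
        then obtain \<pi> where \<pi>: "\<pi> \<in> ?L" "\<pi> i = p" "\<rho> = \<pi>(i := (x, x))" by auto
        have "\<rho> \<in> \<Omega>" using \<pi> sub i x by (auto simp: \<Omega>_def PiE_iff extensional_def subset_iff)
        moreover have "\<rho>(i := p) = \<pi>" using \<pi> by auto
        ultimately show "\<rho> \<in> \<Delta>'" using \<pi> by (auto simp: \<Delta>'_def)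
      qed
    qed (auto simp: \<Delta>'_def)
    have wp: "wt w (\<pi>(i := p)) = w i p * wt w' \<pi>" if "\<pi> \<in> \<Delta>'" for \<pi>
    proof -
      have "wt w' \<pi> = wt w' (\<pi>(i := (x, x)))"
        using that by (intro arg_cong[where f = "wt w'"]) (auto simp: \<Delta>'_def)
      also have "\<dots> = (\<Prod>j\<in>I - {i}. w j (\<pi> j))"
        unfolding wt_upd[OF i] by (auto simp: w'_def intro!: prod.cong)
      finally show ?thesis by (simp add: wt_upd[OF i])
    qed
    have fx: "fixv d i (\<pi>(i := p)) = \<pi>" if "\<pi> \<in> \<Delta>'" for \<pi>
      using that by (auto simp: \<Delta>'_def fixv_def x_def fun_eq_iff)
    have "(\<Sum>\<pi> | \<pi> \<in> ?L \<and> \<pi> i = p. wt w \<pi> * real (cost (proj G (fixv d i \<pi>))))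
        = (\<Sum>\<pi>\<in>\<Delta>'. wt w (\<pi>(i := p)) * real (cost (proj G (fixv d i (\<pi>(i := p))))))"
      by (rule sum.reindex_bij_betw[OF bij, symmetric])
    also have "\<dots> = (\<Sum>\<pi>\<in>\<Delta>'. w i p * (wt w' \<pi> * real (cost (proj G \<pi>))))"
      by (rule sum.cong) (auto simp: wp fx)
    also have "\<dots> = w i p * (\<Sum>\<pi>\<in>\<Delta>'. wt w' \<pi> * real (cost (proj G \<pi>)))"
      by (simp add: sum_distrib_left)
    also have "\<dots> \<le> w i p * (\<beta> * (\<Sum>\<pi>\<in>\<Delta>'. wt w' \<pi>))"
      using w i p by (intro mult_left_mono G cl w') (auto simp: hiding_def)
    also have "\<dots> = \<beta> * (\<Sum>\<pi>\<in>\<Delta>'. wt w (\<pi>(i := p)))"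
      by (simp add: sum_distrib_left wp mult_ac)
    also have "(\<Sum>\<pi>\<in>\<Delta>'. wt w (\<pi>(i := p))) = (\<Sum>\<pi> | \<pi> \<in> ?L \<and> \<pi> i = p. wt w \<pi>)"
      by (rule sum.reindex_bij_betw[OF bij])
    finally show ?thesis .
  qed
  have im: "(\<lambda>\<pi>. \<pi> i) ` ?L \<subseteq> S \<times> S" using sub i unfolding \<Omega>_def by blast
  have fS: "finite (S \<times> S)" using finite_S by simp
  have "(\<Sum>\<pi>\<in>?L. wt w \<pi> * real (cost (proj G (fixv d i \<pi>))))
      = (\<Sum>p\<in>S \<times> S. \<Sum>\<pi> | \<pi> \<in> ?L \<and> \<pi> i = p. wt w \<pi> * real (cost (proj G (fixv d i \<pi>))))"
    by (rule sum.group[OF fin fS im, symmetric])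
  also have "\<dots> \<le> (\<Sum>p\<in>S \<times> S. \<beta> * (\<Sum>\<pi> | \<pi> \<in> ?L \<and> \<pi> i = p. wt w \<pi>))"
    by (rule sum_mono) (rule part)
  also have "\<dots> = \<beta> * (\<Sum>\<pi>\<in>?L. wt w \<pi>)"
    unfolding sum_distrib_left[symmetric] by (subst sum.group[OF fin fS im]) simp
  finally show ?thesis .
qed

text \<open>The conditional half of Hastad's induction: given that F became a literal, G with that
  literal set still has average cost at most \<beta>. The event is the disjoint union, over all
  literals, of the events in \<open>literal_conditioning\<close>.\<close>

lemma fixlit_sum:
  assumes \<Delta>: "closed_under_fixing \<Delta>" and w: "hiding q w" and F: "blk ` vars F \<subseteq> I"
    and G: "\<And>\<Delta>' w'. closed_under_fixing \<Delta>' \<Longrightarrow> hiding q w' \<Longrightarrow>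
              (\<Sum>\<pi>\<in>\<Delta>'. wt w' \<pi> * real (cost (proj G \<pi>))) \<le> \<beta> * (\<Sum>\<pi>\<in>\<Delta>'. wt w' \<pi>)"
  shows "(\<Sum>\<pi>\<in>\<Delta> \<inter> literals F. wt w \<pi> * real (cost (proj G (fixlit c F \<pi>))))
           \<le> \<beta> * (\<Sum>\<pi>\<in>\<Delta> \<inter> literals F. wt w \<pi>)"
proof -
  let ?L = "\<Delta> \<inter> literals F"
  have fin: "finite ?L" using closed_finite[OF \<Delta>] by auto
  have fI: "finite (I \<times> (UNIV :: bool set))" using finite_I by simp
  have im: "litof F ` ?L \<subseteq> I \<times> UNIV"
  proof
    fix l assume "l \<in> litof F ` ?L"
    then obtain \<pi> where "\<pi> \<in> literals F" "l = litof F \<pi>" by auto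
    then show "l \<in> I \<times> UNIV" using literal_in_I[OF F proj_litof] by (auto simp: mem_Times_iff)
  qed
  have grp: "{\<pi> \<in> ?L. litof F \<pi> = (i, b)} = {\<pi> \<in> \<Delta>. proj F \<pi> = (\<lambda>y. y i = b)}" for i b
  proof (intro equalityI subsetI)
    fix \<pi> assume "\<pi> \<in> {\<pi> \<in> ?L. litof F \<pi> = (i, b)}"
    then show "\<pi> \<in> {\<pi> \<in> \<Delta>. proj F \<pi> = (\<lambda>y. y i = b)}" using proj_litof[of \<pi> F] by auto
  next
    fix \<pi> assume a: "\<pi> \<in> {\<pi> \<in> \<Delta>. proj F \<pi> = (\<lambda>y. y i = b)}"
    then have l: "\<pi> \<in> literals F" by (auto simp: literals_def)
    have "(\<lambda>y. y i = b) = (\<lambda>y. y (fst (litof F \<pi>)) = snd (litof F \<pi>))"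
      using proj_litof[OF l] a by simp
    from literal_unique[OF this] show "\<pi> \<in> {\<pi> \<in> ?L. litof F \<pi> = (i, b)}"
      using a l by (auto simp: prod_eq_iff)
  qed
  have "(\<Sum>\<pi>\<in>?L. wt w \<pi> * real (cost (proj G (fixlit c F \<pi>))))
      = (\<Sum>l\<in>I \<times> UNIV. \<Sum>\<pi> | \<pi> \<in> ?L \<and> litof F \<pi> = l. wt w \<pi> * real (cost (proj G (fixlit c F \<pi>))))"
    by (rule sum.group[OF fin fI im, symmetric])
  also have "\<dots> \<le> (\<Sum>l\<in>I \<times> UNIV. \<beta> * (\<Sum>\<pi> | \<pi> \<in> ?L \<and> litof F \<pi> = l. wt w \<pi>))"
  proof (rule sum_mono)
    fix l assume "l \<in> I \<times> (UNIV :: bool set)"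
    then obtain i b where l: "l = (i, b)" "i \<in> I" by auto
    have "(\<Sum>\<pi> | \<pi> \<in> ?L \<and> litof F \<pi> = l. wt w \<pi> * real (cost (proj G (fixlit c F \<pi>))))
        = (\<Sum>\<pi> | \<pi> \<in> \<Delta> \<and> proj F \<pi> = (\<lambda>y. y i = b). wt w \<pi> * real (cost (proj G (fixv (b = c) i \<pi>))))"
      unfolding l grp[symmetric] by (rule sum.cong) (auto simp: fixlit_def)
    also have "\<dots> \<le> \<beta> * (\<Sum>\<pi> | \<pi> \<in> \<Delta> \<and> proj F \<pi> = (\<lambda>y. y i = b). wt w \<pi>)"
      by (rule literal_conditioning[OF \<Delta> w l(2) G])
    finally show "(\<Sum>\<pi> | \<pi> \<in> ?L \<and> litof F \<pi> = l. wt w \<pi> * real (cost (proj G (fixlit c F \<pi>))))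
        \<le> \<beta> * (\<Sum>\<pi> | \<pi> \<in> ?L \<and> litof F \<pi> = l. wt w \<pi>)"
      unfolding l grp .
  qed
  also have "\<dots> = \<beta> * (\<Sum>\<pi>\<in>?L. wt w \<pi>)"
    unfolding sum_distrib_left[symmetric] by (subst sum.group[OF fin fI im]) simp
  finally show ?thesis .
qed

end

subsection \<open>Shrinkage\<close>

text \<open>A projection to a single literal has weight of order q sqrt s, far more than the wanted
  q^2 s. Such projections are left to Khrapchenko's bound, and the induction counts only what
  exceeds them.\<close>

definition cost2 :: "(('v \<Rightarrow> bool) \<Rightarrow> bool) \<Rightarrow> nat" where
  "cost2 \<phi> = (if cost \<phi> \<ge> 2 then cost \<phi> else 0)"

text \<open>The recursion of the induction over gates, with \<eta> = q sqrt s for each child. The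
  product 4 \<eta>1 \<eta>2 is at most 2 q^2 (s1 + s2) and raises the factor t by one. The mixed
  terms, with 2 \<eta> at most 1/T, cost one more factor 1 + 1/T.\<close>

lemma shrinkage_step_arith:
  fixes q T s\<^sub>1 s\<^sub>2 e\<^sub>1 e\<^sub>2 :: real
  assumes "q \<ge> 0" "s\<^sub>1 \<ge> 0" "s\<^sub>2 \<ge> 0" "T \<ge> 1" "q * sqrt (s\<^sub>1 + s\<^sub>2) \<le> 1 / (2 * T)"
    and "e\<^sub>1 = 2 * q\<^sup>2 * s\<^sub>1 * t * (1 + 1 / T) ^ t" "e\<^sub>2 = 2 * q\<^sup>2 * s\<^sub>2 * t * (1 + 1 / T) ^ t"
  shows "e\<^sub>1 + e\<^sub>2 + 2 * ((q * sqrt s\<^sub>2 + e\<^sub>2) * (q * sqrt s\<^sub>1)) + 2 * ((q * sqrt s\<^sub>1 + e\<^sub>1) * (q * sqrt s\<^sub>2))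
           \<le> 2 * q\<^sup>2 * (s\<^sub>1 + s\<^sub>2) * Suc t * (1 + 1 / T) ^ Suc t"
proof -
  define \<eta>\<^sub>1 where "\<eta>\<^sub>1 = q * sqrt s\<^sub>1"
  define \<eta>\<^sub>2 where "\<eta>\<^sub>2 = q * sqrt s\<^sub>2"
  have "\<eta>\<^sub>1 \<le> q * sqrt (s\<^sub>1 + s\<^sub>2)" "\<eta>\<^sub>2 \<le> q * sqrt (s\<^sub>1 + s\<^sub>2)"
    unfolding \<eta>\<^sub>1_def \<eta>\<^sub>2_def using assms by (auto intro!: mult_left_mono)
  moreover have "1 / T = 2 * (1 / (2 * T))" using assms(4) by simp
  ultimately have \<eta>: "2 * \<eta>\<^sub>1 \<le> 1 / T" "2 * \<eta>\<^sub>2 \<le> 1 / T" using assms(5) by linarith+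
  have e0: "e\<^sub>1 \<ge> 0" "e\<^sub>2 \<ge> 0" using assms by auto
  have sq: "\<eta>\<^sub>1\<^sup>2 = q\<^sup>2 * s\<^sub>1" "\<eta>\<^sub>2\<^sup>2 = q\<^sup>2 * s\<^sub>2" using assms by (auto simp: \<eta>\<^sub>1_def \<eta>\<^sub>2_def power_mult_distrib)
  have am: "2 * (\<eta>\<^sub>1 * \<eta>\<^sub>2) \<le> \<eta>\<^sub>1\<^sup>2 + \<eta>\<^sub>2\<^sup>2" using sum_squares_bound[of \<eta>\<^sub>1 \<eta>\<^sub>2] by simp
  have p1: "(1 + 1 / T) ^ Suc t \<ge> 1" using assms(4) by (intro one_le_power) auto
  have "e\<^sub>1 + e\<^sub>2 + 2 * ((\<eta>\<^sub>2 + e\<^sub>2) * \<eta>\<^sub>1) + 2 * ((\<eta>\<^sub>1 + e\<^sub>1) * \<eta>\<^sub>2)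
      = e\<^sub>1 * (1 + 2 * \<eta>\<^sub>2) + e\<^sub>2 * (1 + 2 * \<eta>\<^sub>1) + 2 * (2 * (\<eta>\<^sub>1 * \<eta>\<^sub>2))" by (simp add: algebra_simps)
  also have "\<dots> \<le> e\<^sub>1 * (1 + 1 / T) + e\<^sub>2 * (1 + 1 / T) + 2 * (\<eta>\<^sub>1\<^sup>2 + \<eta>\<^sub>2\<^sup>2)"
    using \<eta> e0 am by (intro add_mono mult_left_mono) auto
  also have "\<dots> = 2 * q\<^sup>2 * (s\<^sub>1 + s\<^sub>2) * t * (1 + 1 / T) ^ Suc t + 2 * q\<^sup>2 * (s\<^sub>1 + s\<^sub>2) * 1"
    unfolding sq assms(6,7) by (simp add: algebra_simps)
  also have "\<dots> \<le> 2 * q\<^sup>2 * (s\<^sub>1 + s\<^sub>2) * t * (1 + 1 / T) ^ Suc t + 2 * q\<^sup>2 * (s\<^sub>1 + s\<^sub>2) * (1 + 1 / T) ^ Suc t"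
    using p1 assms(1-3) by (intro add_left_mono mult_left_mono) auto
  also have "\<dots> = 2 * q\<^sup>2 * (s\<^sub>1 + s\<^sub>2) * Suc t * (1 + 1 / T) ^ Suc t" by (simp add: algebra_simps)
  finally show ?thesis unfolding \<eta>\<^sub>1_def \<eta>\<^sub>2_def .
qed

context projection_space
begin

lemma cost_eq_1_literal: "cost (proj F \<pi>) = 1 \<Longrightarrow> \<pi> \<in> literals F"
  using cost_1[OF proj_expressible] unfolding literals_def by blast

text \<open>Cost 1 occurs only at literals, whose weight \<open>literals_weight\<close> bounds;
  \<open>cost2\<close> counts the rest.\<close>

lemma cost_sum_split:
  assumes \<Delta>: "closed_under_fixing \<Delta>" and w: "hiding q w" and F: "blk ` vars F \<subseteq> I"
    and e: "(\<Sum>\<pi>\<in>\<Delta>. wt w \<pi> * real (cost2 (proj F \<pi>))) \<le> e * (\<Sum>\<pi>\<in>\<Delta>. wt w \<pi>)"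
  shows "(\<Sum>\<pi>\<in>\<Delta>. wt w \<pi> * real (cost (proj F \<pi>))) \<le> (q * sqrt (leaves F) + e) * (\<Sum>\<pi>\<in>\<Delta>. wt w \<pi>)"
proof -
  have fin: "finite \<Delta>" using \<Delta> by (rule closed_finite)
  have nn: "wt w \<pi> \<ge> 0" if "\<pi> \<in> \<Delta>" for \<pi>
    using wt_nonneg[OF w] that \<Delta> by (auto simp: closed_under_fixing_def)
  have "(\<Sum>\<pi>\<in>\<Delta>. wt w \<pi> * real (cost (proj F \<pi>)))
      \<le> (\<Sum>\<pi>\<in>\<Delta>. (if \<pi> \<in> literals F then wt w \<pi> else 0) + wt w \<pi> * real (cost2 (proj F \<pi>)))"
  proof (rule sum_mono)
    fix \<pi> assume "\<pi> \<in> \<Delta>"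
    consider "cost (proj F \<pi>) = 0" | "cost (proj F \<pi>) = 1" | "cost (proj F \<pi>) \<ge> 2" by linarith
    then show "wt w \<pi> * real (cost (proj F \<pi>))
        \<le> (if \<pi> \<in> literals F then wt w \<pi> else 0) + wt w \<pi> * real (cost2 (proj F \<pi>))"
      using nn[OF \<open>\<pi> \<in> \<Delta>\<close>] by cases (auto simp: cost2_def cost_eq_1_literal)
  qed
  also have "\<dots> = (\<Sum>\<pi>\<in>\<Delta> \<inter> literals F. wt w \<pi>) + (\<Sum>\<pi>\<in>\<Delta>. wt w \<pi> * real (cost2 (proj F \<pi>)))"
    using fin by (simp add: sum.distrib sum.inter_restrict)
  also have "\<dots> \<le> q * sqrt (leaves F) * (\<Sum>\<pi>\<in>\<Delta>. wt w \<pi>) + e * (\<Sum>\<pi>\<in>\<Delta>. wt w \<pi>)"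
    using literals_weight[OF \<Delta> w F] e by (rule add_mono)
  finally show ?thesis by (simp add: distrib_right)
qed

lemma cost2_gate:
  "real (cost2 (proj (Gate c F G) \<pi>)) \<le> real (cost2 (proj F \<pi>)) + real (cost2 (proj G \<pi>))
     + 2 * (if \<pi> \<in> literals F then real (cost (proj G (fixlit c F \<pi>))) else 0)
     + 2 * (if \<pi> \<in> literals G then real (cost (proj F (fixlit c G \<pi>))) else 0)"
proof -
  have lit: "cost2 (proj (Gate c F G) \<pi>) \<le> 2 * cost (proj G (fixlit c F \<pi>))"
    if "\<pi> \<in> literals F" for F G
  proof -
    have "cost (proj (Gate c F G) \<pi>) \<le> 1 + cost (proj G (fixlit c F \<pi>))"
      unfolding proj_gate fixlit_def proj_fixv proj_litof[OF that]
      by (rule cost_gate_literal[OF proj_expressible])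
    \<comment> \<open>If the gate costs at least 2, then G with the literal set costs at least 1,
      and the summand 1 is absorbed by doubling.\<close>
    then show ?thesis by (auto simp: cost2_def)
  qed
  have sym: "proj (Gate c F G) \<pi> = proj (Gate c G F) \<pi>" unfolding proj_gate by (rule ext) auto
  consider "\<pi> \<in> literals F" | "\<pi> \<in> literals G" | "\<pi> \<notin> literals F" "\<pi> \<notin> literals G" by blast
  then show ?thesis
  proof cases
    case 1
    then show ?thesis using lit[OF 1, of G] by simp
  next
    case 2
    then show ?thesis using lit[OF 2, of F] sym by simp
  next
    case 3
    then have "cost (proj F \<pi>) \<noteq> 1" "cost (proj G \<pi>) \<noteq> 1" using cost_eq_1_literal by blast+
    moreover have "cost (proj (Gate c F G) \<pi>) \<le> cost (proj F \<pi>) + cost (proj G \<pi>)"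
      unfolding proj_gate by (rule cost_gate[OF proj_expressible proj_expressible])
    ultimately show ?thesis by (auto simp: cost2_def)
  qed
qed

text \<open>Induction with \<Delta> and w arbitrary, because \<open>fixlit_sum\<close> needs the
  bound for one child under every conditioning that the other child may cause.\<close>

lemma shrinkage_small_cost2:
  fixes T :: real
  assumes "closed_under_fixing \<Delta>" "hiding q w" "blk ` vars F \<subseteq> I" "height F \<le> t" "T \<ge> 1"
    and "q * sqrt (leaves F) \<le> 1 / (2 * T)"
  shows "(\<Sum>\<pi>\<in>\<Delta>. wt w \<pi> * real (cost2 (proj F \<pi>)))
           \<le> (2 * q\<^sup>2 * leaves F * t * (1 + 1 / T) ^ t) * (\<Sum>\<pi>\<in>\<Delta>. wt w \<pi>)"
  using assms
proof (induction F arbitrary: \<Delta> w t)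
  case (Const c)
  have "cost2 (proj (Const c) \<pi>) = 0" for \<pi> using cost_proj_le[of "Const c" \<pi>] by (simp add: cost2_def)
  then show ?case by simp
next
  case (Lit b v)
  have "cost2 (proj (Lit b v) \<pi>) = 0" for \<pi> using cost_proj_le[of "Lit b v" \<pi>] by (simp add: cost2_def)
  moreover have "(\<Sum>\<pi>\<in>\<Delta>. wt w \<pi>) \<ge> 0"
    using Lit.prems(1,2) wt_nonneg by (intro sum_nonneg) (auto simp: closed_under_fixing_def)
  ultimately show ?case using Lit.prems(5) by simp
next
  case (Gate c F G)
  obtain t' where t: "t = Suc t'" "height F \<le> t'" "height G \<le> t'" using Gate.prems(4) by (cases t) auto
  have q: "q \<ge> 0" using Gate.prems(2) by (simp add: hiding_def)
  have vF: "blk ` vars F \<subseteq> I" and vG: "blk ` vars G \<subseteq> I" using Gate.prems(3) by auto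
  have le: "sqrt (leaves F) \<le> sqrt (leaves (Gate c F G))" "sqrt (leaves G) \<le> sqrt (leaves (Gate c F G))" by auto
  have sF: "q * sqrt (leaves F) \<le> 1 / (2 * T)" and sG: "q * sqrt (leaves G) \<le> 1 / (2 * T)"
    using Gate.prems(6) mult_left_mono[OF le(1) q] mult_left_mono[OF le(2) q] by linarith+
  define e\<^sub>F where "e\<^sub>F = 2 * q\<^sup>2 * leaves F * t' * (1 + 1 / T) ^ t'"
  define e\<^sub>G where "e\<^sub>G = 2 * q\<^sup>2 * leaves G * t' * (1 + 1 / T) ^ t'"
  have IHF: "(\<Sum>\<pi>\<in>\<Delta>. wt w \<pi> * real (cost2 (proj F \<pi>))) \<le> e\<^sub>F * (\<Sum>\<pi>\<in>\<Delta>. wt w \<pi>)"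
    if "closed_under_fixing \<Delta>" "hiding q w" for \<Delta> w
    unfolding e\<^sub>F_def by (rule Gate.IH(1)[OF that vF t(2) Gate.prems(5) sF])
  have IHG: "(\<Sum>\<pi>\<in>\<Delta>. wt w \<pi> * real (cost2 (proj G \<pi>))) \<le> e\<^sub>G * (\<Sum>\<pi>\<in>\<Delta>. wt w \<pi>)"
    if "closed_under_fixing \<Delta>" "hiding q w" for \<Delta> w
    unfolding e\<^sub>G_def by (rule Gate.IH(2)[OF that vG t(3) Gate.prems(5) sG])
  let ?m = "\<Sum>\<pi>\<in>\<Delta>. wt w \<pi>"
  have fin: "finite \<Delta>" using Gate.prems(1) by (rule closed_finite)
  have nn: "wt w \<pi> \<ge> 0" if "\<pi> \<in> \<Delta>" for \<pi>
    using wt_nonneg[OF Gate.prems(2)] that Gate.prems(1) by (auto simp: closed_under_fixing_def)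
  have e0: "e\<^sub>F \<ge> 0" "e\<^sub>G \<ge> 0" using Gate.prems(5) by (auto simp: e\<^sub>F_def e\<^sub>G_def)
  have litF: "(\<Sum>\<pi>\<in>\<Delta> \<inter> literals F. wt w \<pi> * real (cost (proj G (fixlit c F \<pi>))))
      \<le> (q * sqrt (leaves G) + e\<^sub>G) * (q * sqrt (leaves F)) * ?m"
  proof -
    have "(\<Sum>\<pi>\<in>\<Delta> \<inter> literals F. wt w \<pi> * real (cost (proj G (fixlit c F \<pi>))))
      \<le> (q * sqrt (leaves G) + e\<^sub>G) * (\<Sum>\<pi>\<in>\<Delta> \<inter> literals F. wt w \<pi>)"
      by (rule fixlit_sum[OF Gate.prems(1,2) vF]) (rule cost_sum_split[OF _ _ vG IHG])
    also have "\<dots> \<le> (q * sqrt (leaves G) + e\<^sub>G) * (q * sqrt (leaves F) * ?m)"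
      using q e0 by (intro mult_left_mono literals_weight Gate.prems(1,2) vF) auto
    finally show ?thesis by (simp add: mult.assoc)
  qed
  have litG: "(\<Sum>\<pi>\<in>\<Delta> \<inter> literals G. wt w \<pi> * real (cost (proj F (fixlit c G \<pi>))))
      \<le> (q * sqrt (leaves F) + e\<^sub>F) * (q * sqrt (leaves G)) * ?m"
  proof -
    have "(\<Sum>\<pi>\<in>\<Delta> \<inter> literals G. wt w \<pi> * real (cost (proj F (fixlit c G \<pi>))))
      \<le> (q * sqrt (leaves F) + e\<^sub>F) * (\<Sum>\<pi>\<in>\<Delta> \<inter> literals G. wt w \<pi>)"
      by (rule fixlit_sum[OF Gate.prems(1,2) vG]) (rule cost_sum_split[OF _ _ vF IHF])
    also have "\<dots> \<le> (q * sqrt (leaves F) + e\<^sub>F) * (q * sqrt (leaves G) * ?m)"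
      using q e0 by (intro mult_left_mono literals_weight Gate.prems(1,2) vG) auto
    finally show ?thesis by (simp add: mult.assoc)
  qed
  have "(\<Sum>\<pi>\<in>\<Delta>. wt w \<pi> * real (cost2 (proj (Gate c F G) \<pi>)))
      \<le> (\<Sum>\<pi>\<in>\<Delta>. wt w \<pi> * (real (cost2 (proj F \<pi>)) + real (cost2 (proj G \<pi>))
          + 2 * (if \<pi> \<in> literals F then real (cost (proj G (fixlit c F \<pi>))) else 0)
          + 2 * (if \<pi> \<in> literals G then real (cost (proj F (fixlit c G \<pi>))) else 0)))"
    by (intro sum_mono mult_left_mono cost2_gate nn)
  also have "\<dots> = (\<Sum>\<pi>\<in>\<Delta>. wt w \<pi> * real (cost2 (proj F \<pi>))) + (\<Sum>\<pi>\<in>\<Delta>. wt w \<pi> * real (cost2 (proj G \<pi>)))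
      + 2 * (\<Sum>\<pi>\<in>\<Delta> \<inter> literals F. wt w \<pi> * real (cost (proj G (fixlit c F \<pi>))))
      + 2 * (\<Sum>\<pi>\<in>\<Delta> \<inter> literals G. wt w \<pi> * real (cost (proj F (fixlit c G \<pi>))))"
    unfolding sum.inter_restrict[OF fin] sum_distrib_left sum.distrib[symmetric]
    by (rule sum.cong) (auto simp: algebra_simps)
  also have "\<dots> \<le> e\<^sub>F * ?m + e\<^sub>G * ?m + 2 * ((q * sqrt (leaves G) + e\<^sub>G) * (q * sqrt (leaves F)) * ?m)
      + 2 * ((q * sqrt (leaves F) + e\<^sub>F) * (q * sqrt (leaves G)) * ?m)"
    by (intro add_mono mult_left_mono IHF IHG litF litG Gate.prems(1,2)) auto
  also have "\<dots> = (e\<^sub>F + e\<^sub>G + 2 * ((q * sqrt (leaves G) + e\<^sub>G) * (q * sqrt (leaves F)))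
      + 2 * ((q * sqrt (leaves F) + e\<^sub>F) * (q * sqrt (leaves G)))) * ?m"
    by (simp add: algebra_simps)
  also have "\<dots> \<le> (2 * q\<^sup>2 * (real (leaves F) + real (leaves G)) * Suc t' * (1 + 1 / T) ^ Suc t') * ?m"
    using Gate.prems(5,6) q nn
    by (intro mult_right_mono shrinkage_step_arith sum_nonneg) (auto simp: e\<^sub>F_def e\<^sub>G_def)
  finally show ?case unfolding t by simp
qed

text \<open>The hypothesis on q bounds the literal part by 1/2. With (1 + 1/T)^T at most 3, the
  \<open>cost2\<close> part is at most 3/(2T), hence 3/2.\<close>

lemma shrinkage_small:
  assumes "closed_under_fixing \<Delta>" "hiding q w" "blk ` vars F \<subseteq> I" "height F \<le> T" "T \<ge> 1"
    and "q * sqrt (leaves F) \<le> 1 / (2 * real T)"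
  shows "(\<Sum>\<pi>\<in>\<Delta>. wt w \<pi> * real (cost (proj F \<pi>))) \<le> 2 * (\<Sum>\<pi>\<in>\<Delta>. wt w \<pi>)"
proof -
  let ?e = "2 * q\<^sup>2 * leaves F * T * (1 + 1 / real T) ^ T"
  have q: "q \<ge> 0" using assms(2) by (simp add: hiding_def)
  have "(\<Sum>\<pi>\<in>\<Delta>. wt w \<pi> * real (cost (proj F \<pi>))) \<le> (q * sqrt (leaves F) + ?e) * (\<Sum>\<pi>\<in>\<Delta>. wt w \<pi>)"
    using assms by (intro cost_sum_split shrinkage_small_cost2) auto
  also have "\<dots> \<le> 2 * (\<Sum>\<pi>\<in>\<Delta>. wt w \<pi>)"
  proof (rule mult_right_mono)
    show "(\<Sum>\<pi>\<in>\<Delta>. wt w \<pi>) \<ge> 0"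
      using assms(1,2) wt_nonneg by (intro sum_nonneg) (auto simp: closed_under_fixing_def)
    have "(1 + 1 / real T) ^ T \<le> exp (1 / real T) ^ T"
      using exp_ge_add_one_self[of "1 / real T"] by (intro power_mono) auto
    also have "\<dots> = exp 1" using assms(5) by (simp add: exp_of_nat_mult[symmetric])
    also have "\<dots> \<le> 3" by (rule exp_le)
    finally have E: "(1 + 1 / real T) ^ T \<le> 3" .
    have "(q * sqrt (leaves F))\<^sup>2 \<le> (1 / (2 * real T))\<^sup>2" using assms(6) q by (intro power_mono) auto
    then have s: "q\<^sup>2 * leaves F \<le> 1 / (4 * (real T)\<^sup>2)" by (simp add: power_mult_distrib power_divide)
    have "?e = 2 * (q\<^sup>2 * leaves F) * T * (1 + 1 / real T) ^ T" by (simp add: mult_ac)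
    also have "\<dots> \<le> 2 * (1 / (4 * (real T)\<^sup>2)) * T * 3"
      using s E by (intro mult_mono) auto
    also have "\<dots> = 3 / (2 * real T)" using assms(5) by (simp add: power2_eq_square field_simps)
    also have "\<dots> \<le> 3 / 2" using assms(5) by (simp add: field_simps)
    finally have "?e \<le> 3 / 2" .
    moreover have "q * sqrt (leaves F) \<le> 1 / 2"
      using assms(5) by (intro order_trans[OF assms(6)]) (simp add: field_simps)
    ultimately show "q * sqrt (leaves F) + ?e \<le> 2" by simp
  qed
  finally show ?thesis .
qed

text \<open>With l = 4 T^2 q^2, subformulas of at most 1/l leaves satisfy
  \<open>shrinkage_small\<close> and have average cost at most 2; at larger gates the costs of the
  children are added. The term 4 t l s pays for the number of small pieces: few gates of one level
  can exceed the threshold.\<close>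

theorem shrinkage:
  assumes "closed_under_fixing \<Delta>" "hiding q w" "blk ` vars F \<subseteq> I" "height F \<le> T" "T \<ge> 1" "q > 0"
  shows "(\<Sum>\<pi>\<in>\<Delta>. wt w \<pi> * real (cost (proj F \<pi>)))
           \<le> (2 + 16 * q\<^sup>2 * real T ^ 3 * leaves F) * (\<Sum>\<pi>\<in>\<Delta>. wt w \<pi>)"
proof -
  define m where "m = (\<Sum>\<pi>\<in>\<Delta>. wt w \<pi>)"
  define l where "l = 4 * (real T)\<^sup>2 * q\<^sup>2"
  have nn: "wt w \<pi> \<ge> 0" if "\<pi> \<in> \<Delta>" for \<pi>
    using wt_nonneg[OF assms(2)] that assms(1) by (auto simp: closed_under_fixing_def)
  have m: "m \<ge> 0" unfolding m_def using nn by (rule sum_nonneg)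
  have l: "l > 0" using assms(5,6) by (simp add: l_def)
  have "(\<Sum>\<pi>\<in>\<Delta>. wt w \<pi> * real (cost (proj F \<pi>))) \<le> (2 + 4 * real t * (l * leaves F)) * m"
    if "blk ` vars F \<subseteq> I" "height F \<le> t" "t \<le> T" for t F
    using that
  proof (induction F arbitrary: t)
    case (Const c)
    have "cost (proj (Const c) \<pi>) = 0" for \<pi> using cost_proj_le[of "Const c" \<pi>] by simp
    then show ?case using m by simp
  next
    case (Lit b v)
    have "wt w \<pi> * real (cost (proj (Lit b v) \<pi>)) \<le> wt w \<pi> * 1" if "\<pi> \<in> \<Delta>" for \<pi>
      using nn[OF that] cost_proj_le[of "Lit b v" \<pi>] by (intro mult_left_mono) auto
    then have "(\<Sum>\<pi>\<in>\<Delta>. wt w \<pi> * real (cost (proj (Lit b v) \<pi>))) \<le> m"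
      unfolding m_def by (intro sum_mono) simp
    also have "\<dots> \<le> (2 + 4 * real t * (l * leaves (Lit b v))) * m"
      using m l by (simp add: mult_le_cancel_right1)
    finally show ?case .
  next
    case (Gate c F G)
    show ?case
    proof (cases "l * leaves (Gate c F G) \<le> 1")
      case True
      have "(2 * real T * (q * sqrt (leaves (Gate c F G))))\<^sup>2 \<le> 1\<^sup>2"
        using True by (simp add: l_def power_mult_distrib algebra_simps)
      then have "2 * real T * (q * sqrt (leaves (Gate c F G))) \<le> 1" by (rule power2_le_imp_le) simp
      then have s: "q * sqrt (leaves (Gate c F G)) \<le> 1 / (2 * real T)"
        using assms(5) by (simp add: field_simps)
      have h: "height (Gate c F G) \<le> T" using Gate.prems by linarith
      have "(\<Sum>\<pi>\<in>\<Delta>. wt w \<pi> * real (cost (proj (Gate c F G) \<pi>))) \<le> 2 * m"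
        unfolding m_def by (rule shrinkage_small[OF assms(1,2) Gate.prems(1) h assms(5) s])
      also have "\<dots> \<le> (2 + 4 * real t * (l * leaves (Gate c F G))) * m"
        using m l by (intro mult_right_mono) auto
      finally show ?thesis .
    next
      case False
      obtain t' where t: "t = Suc t'" "height F \<le> t'" "height G \<le> t'" "t' \<le> T"
        using Gate.prems by (cases t) auto
      have vF: "blk ` vars F \<subseteq> I" and vG: "blk ` vars G \<subseteq> I" using Gate.prems(1) by auto
      have "(\<Sum>\<pi>\<in>\<Delta>. wt w \<pi> * real (cost (proj (Gate c F G) \<pi>)))
          \<le> (\<Sum>\<pi>\<in>\<Delta>. wt w \<pi> * (real (cost (proj F \<pi>)) + real (cost (proj G \<pi>))))"
      proof (intro sum_mono mult_left_mono nn)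
        fix \<pi>
        have "cost (proj (Gate c F G) \<pi>) \<le> cost (proj F \<pi>) + cost (proj G \<pi>)"
          unfolding proj_gate by (rule cost_gate[OF proj_expressible proj_expressible])
        then show "real (cost (proj (Gate c F G) \<pi>)) \<le> real (cost (proj F \<pi>)) + real (cost (proj G \<pi>))"
          by linarith
      qed
      also have "\<dots> = (\<Sum>\<pi>\<in>\<Delta>. wt w \<pi> * real (cost (proj F \<pi>))) + (\<Sum>\<pi>\<in>\<Delta>. wt w \<pi> * real (cost (proj G \<pi>)))"
        by (simp add: distrib_left sum.distrib)
      also have "\<dots> \<le> (2 + 4 * real t' * (l * leaves F)) * m + (2 + 4 * real t' * (l * leaves G)) * m"
        by (intro add_mono Gate.IH vF vG t)
      also have "\<dots> = (4 + 4 * real t' * (l * leaves (Gate c F G))) * m" by (simp add: algebra_simps)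
      \<comment> \<open>Adding the children doubles the constant 2. The surplus is paid by the
        increase of t, since l times the number of leaves exceeds 1 here.\<close>
      also have "\<dots> \<le> (2 + 4 * real t * (l * leaves (Gate c F G))) * m"
        using m False by (intro mult_right_mono) (auto simp: t algebra_simps)
      finally show ?thesis .
    qed
  qed
  from this[OF assms(3,4) order_refl] show ?thesis
    by (simp add: m_def l_def power2_eq_square power3_eq_cube mult_ac)
qed

end

subsection \<open>Balancing and counting\<close>

text \<open>Cut the formula at a minimal subformula of size at least \<open>\<tau>\<close>: being monotone in that
  subformula, it has the form \<open>(z \<and> A) \<or> B\<close>.\<close>

lemma hole_decomposition:
  fixes \<tau> :: real
  assumes "\<tau> > 1" "\<tau> \<le> leaves F"
  shows "\<exists>c z\<^sub>1 z\<^sub>2 A B. ev (Gate False (Gate True (Gate c z\<^sub>1 z\<^sub>2) A) B) = ev F \<and>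
     leaves z\<^sub>1 < \<tau> \<and> leaves z\<^sub>2 < \<tau> \<and> \<tau> \<le> real (leaves z\<^sub>1) + leaves z\<^sub>2 \<and>
     leaves A + leaves z\<^sub>1 + leaves z\<^sub>2 \<le> leaves F \<and> leaves B + leaves z\<^sub>1 + leaves z\<^sub>2 \<le> leaves F \<and>
     vars z\<^sub>1 \<union> vars z\<^sub>2 \<union> vars A \<union> vars B \<subseteq> vars F"
  using assms(2)
proof (induction F)
  case (Const c)
  then show ?case using assms(1) by simp
next
  case (Lit b v)
  then show ?case using assms(1) by simp
next
  case (Gate d F G)
  have lift: ?case if "\<tau> \<le> leaves F'" "{F', G'} = {F, G}"
      "leaves F' + leaves G' = leaves F + leaves G"
      and IH: "\<exists>c z\<^sub>1 z\<^sub>2 A B. ev (Gate False (Gate True (Gate c z\<^sub>1 z\<^sub>2) A) B) = ev F' \<and>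
         leaves z\<^sub>1 < \<tau> \<and> leaves z\<^sub>2 < \<tau> \<and> \<tau> \<le> real (leaves z\<^sub>1) + leaves z\<^sub>2 \<and>
         leaves A + leaves z\<^sub>1 + leaves z\<^sub>2 \<le> leaves F' \<and> leaves B + leaves z\<^sub>1 + leaves z\<^sub>2 \<le> leaves F' \<and>
         vars z\<^sub>1 \<union> vars z\<^sub>2 \<union> vars A \<union> vars B \<subseteq> vars F'" for F' G'
  proof -
    obtain c z\<^sub>1 z\<^sub>2 A B where h: "ev (Gate False (Gate True (Gate c z\<^sub>1 z\<^sub>2) A) B) = ev F'"
      "leaves z\<^sub>1 < \<tau>" "leaves z\<^sub>2 < \<tau>" "\<tau> \<le> real (leaves z\<^sub>1) + leaves z\<^sub>2"
      "leaves A + leaves z\<^sub>1 + leaves z\<^sub>2 \<le> leaves F'" "leaves B + leaves z\<^sub>1 + leaves z\<^sub>2 \<le> leaves F'"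
      "vars z\<^sub>1 \<union> vars z\<^sub>2 \<union> vars A \<union> vars B \<subseteq> vars F'"
      using IH by blast
    have F': "ev F' y = ((ev (Gate c z\<^sub>1 z\<^sub>2) y \<and> ev A y) \<or> ev B y)" for y
      unfolding h(1)[symmetric] by simp
    have FG: "ev (Gate d F G) y = (if d then ev F' y \<and> ev G' y else ev F' y \<or> ev G' y)" for y
      using that(2) by (auto simp: doubleton_eq_iff)
    have vs: "vars F' \<union> vars G' = vars (Gate d F G)" using that(2) by (auto simp: doubleton_eq_iff)
    \<comment> \<open>Pushing the outer gate inwards: (zA or B) and G = z(A and G) or (B and G),
      while (zA or B) or G needs G in the second part only. G may be duplicated but z never
      is.\<close>
    define A' where "A' = (if d then Gate True A G' else A)"
    define B' where "B' = Gate d B G'"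
    have "ev (Gate False (Gate True (Gate c z\<^sub>1 z\<^sub>2) A') B') = ev (Gate d F G)"
    proof
      fix y
      show "ev (Gate False (Gate True (Gate c z\<^sub>1 z\<^sub>2) A') B') y = ev (Gate d F G) y"
        unfolding FG F' by (cases d) (auto simp: A'_def B'_def)
    qed
    moreover have "leaves A' + leaves z\<^sub>1 + leaves z\<^sub>2 \<le> leaves (Gate d F G)"
        "leaves B' + leaves z\<^sub>1 + leaves z\<^sub>2 \<le> leaves (Gate d F G)"
      using h(5,6) that(3) by (simp_all add: A'_def B'_def)
    moreover have "vars z\<^sub>1 \<union> vars z\<^sub>2 \<union> vars A' \<union> vars B' \<subseteq> vars (Gate d F G)"
      unfolding vs[symmetric] using h(7) by (auto simp: A'_def B'_def)
    ultimately show ?thesis using h(2-4) by blast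
  qed
  consider "\<tau> \<le> leaves F" | "\<tau> \<le> leaves G" | "leaves F < \<tau>" "leaves G < \<tau>" by linarith
  then show ?case
  proof cases
    case 1
    then show ?thesis using lift[OF 1 _ _ Gate.IH(1)[OF 1]] by blast
  next
    case 2
    then show ?thesis using lift[OF 2 _ _ Gate.IH(2)[OF 2], of F] by fastforce
  next
    case 3
    have "ev (Gate False (Gate True (Gate d F G) (Const True)) (Const False)) = ev (Gate d F G)"
      by (rule ext) simp
    then show ?thesis using 3 Gate.prems
      by (intro exI[of _ d] exI[of _ F] exI[of _ G] exI[of _ "Const True"] exI[of _ "Const False"]) auto
  qed
qed

lemma small_formula:
  assumes "leaves F \<le> 1"
  shows "\<exists>F'. ev F' = ev F \<and> vars F' \<subseteq> vars F \<and> height F' = 0 \<and> leaves F' \<le> leaves F"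
proof -
  have "(\<exists>c. ev F = (\<lambda>_. c)) \<or> (leaves F = 1 \<and> (\<exists>b v. ev F = (\<lambda>y. y v = b)))"
    using assms ev_leaves_0[of F] ev_leaves_1[of F] by (cases "leaves F") auto
  then consider c where "ev F = (\<lambda>_. c)" | b v where "leaves F = 1" "ev F = (\<lambda>y. y v = b)" by blast
  then show ?thesis
  proof cases
    case 1
    have "ev (Const c) = ev F" unfolding 1 by (rule ext) simp
    then show ?thesis by (intro exI[of _ "Const c"]) simp
  next
    case 2
    have "ev (Lit b v) = ev F" unfolding 2 by (rule ext) simp
    moreover have "v \<in> vars F"
    proof (rule ccontr)
      assume "v \<notin> vars F"
      then have "ev F (\<lambda>_. True) = ev F ((\<lambda>_. True)(v := False))" by (intro ev_cong) auto
      then show False unfolding 2 by simp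
    qed
    ultimately show ?thesis using 2(1) by (intro exI[of _ "Lit b v"]) simp
  qed
qed

text \<open>The part outside the cut, of size w, is used twice, as a and as b. Since w is at most
  s/c and c^\<epsilon> = 2, each copy gets at most half of w s^\<epsilon>, so the duplication is
  free.\<close>

lemma powr_superadditive_step:
  fixes z\<^sub>1 z\<^sub>2 a b w s c \<epsilon> :: real
  assumes "\<epsilon> > 0" "c > 0" "c powr \<epsilon> = 2" "z\<^sub>1 \<ge> 0" "z\<^sub>2 \<ge> 0" "a \<ge> 0" "b \<ge> 0" "a \<le> w" "b \<le> w"
    "w \<le> s / c" "z\<^sub>1 + z\<^sub>2 + w = s" "s > 0"
  shows "z\<^sub>1 powr (1 + \<epsilon>) + z\<^sub>2 powr (1 + \<epsilon>) + a powr (1 + \<epsilon>) + b powr (1 + \<epsilon>) \<le> s powr (1 + \<epsilon>)"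
proof -
  have w0: "w \<ge> 0" using assms by linarith
  have z: "z powr (1 + \<epsilon>) \<le> z * s powr \<epsilon>" if "z \<ge> 0" "z \<le> s" for z
    using that assms(1) by (auto simp: powr_add intro!: mult_left_mono powr_mono2)
  have "z\<^sub>1 \<le> s" "z\<^sub>2 \<le> s" using assms w0 by linarith+
  then have 1: "z\<^sub>1 powr (1 + \<epsilon>) \<le> z\<^sub>1 * s powr \<epsilon>" "z\<^sub>2 powr (1 + \<epsilon>) \<le> z\<^sub>2 * s powr \<epsilon>"
    using z assms by blast+
  have 2: "x powr (1 + \<epsilon>) \<le> w * s powr \<epsilon> / 2" if "x \<ge> 0" "x \<le> w" for x
  proof -
    have "x powr (1 + \<epsilon>) \<le> w powr (1 + \<epsilon>)" using that assms(1) by (intro powr_mono2) auto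
    also have "\<dots> = w * w powr \<epsilon>" using w0 by (simp add: powr_add)
    also have "\<dots> \<le> w * (s / c) powr \<epsilon>" using w0 assms by (intro mult_left_mono powr_mono2) auto
    also have "(s / c) powr \<epsilon> = s powr \<epsilon> / 2" using assms by (simp add: powr_divide)
    finally show ?thesis by simp
  qed
  have "z\<^sub>1 powr (1 + \<epsilon>) + z\<^sub>2 powr (1 + \<epsilon>) + a powr (1 + \<epsilon>) + b powr (1 + \<epsilon>)
      \<le> z\<^sub>1 * s powr \<epsilon> + z\<^sub>2 * s powr \<epsilon> + w * s powr \<epsilon> / 2 + w * s powr \<epsilon> / 2"
    using 1 2[of a] 2[of b] assms by linarith
  also have "\<dots> = (z\<^sub>1 + z\<^sub>2 + w) * s powr \<epsilon>" by (simp add: algebra_simps)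
  also have "\<dots> = s powr (1 + \<epsilon>)" using assms(11,12) by (simp add: powr_add)
  finally show ?thesis .
qed

text \<open>Cut at \<tau> = (1 - 1/c) s. The two halves of the cut subformula are smaller than
  \<tau> by its minimality, and the remainder has at most s/c leaves, so one round of three levels
  shrinks every piece by the factor 1 - 1/c. A large c means many rounds but little growth.\<close>

lemma balance:
  fixes c \<epsilon> :: real
  assumes "c \<ge> 3" "\<epsilon> > 0" "c powr \<epsilon> = 2" "leaves F \<le> (c / (c - 1)) ^ t"
  shows "\<exists>F'. ev F' = ev F \<and> vars F' \<subseteq> vars F \<and> height F' \<le> 3 * t \<and> leaves F' \<le> leaves F powr (1 + \<epsilon>)"
  using assms(4)
proof (induction t arbitrary: F)
  case 0
  then have "leaves F \<le> 1" by simp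
  then obtain F' where "ev F' = ev F" "vars F' \<subseteq> vars F" "height F' = 0" "leaves F' \<le> leaves F"
    using small_formula by blast
  moreover have "real (leaves F) = leaves F powr (1 + \<epsilon>)"
    using \<open>leaves F \<le> 1\<close> by (cases "leaves F") auto
  ultimately show ?case by (intro exI[of _ F']) auto
next
  case (Suc t)
  show ?case
  proof (cases "leaves F \<le> 1")
    case True
    then obtain F' where "ev F' = ev F" "vars F' \<subseteq> vars F" "height F' = 0" "leaves F' \<le> leaves F"
      using small_formula by blast
    moreover have "real (leaves F) = leaves F powr (1 + \<epsilon>)"
      using True by (cases "leaves F") auto
    ultimately show ?thesis by (intro exI[of _ F']) auto
  next
    case False
    define s where "s = real (leaves F)"
    define \<tau> where "\<tau> = (1 - 1 / c) * s"
    have s: "s \<ge> 2" using False by (simp add: s_def)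
    have c3: "1 / c \<le> 1 / 3" using assms(1) by (simp add: field_simps)
    have "(2 / 3) * 2 \<le> \<tau>" unfolding \<tau>_def using s c3 by (intro mult_mono) auto
    then have \<tau>1: "\<tau> > 1" by simp
    have \<tau>s: "\<tau> \<le> leaves F" using s assms(1) by (simp add: \<tau>_def s_def field_simps)
    obtain d z\<^sub>1 z\<^sub>2 A B where h: "ev (Gate False (Gate True (Gate d z\<^sub>1 z\<^sub>2) A) B) = ev F"
      "leaves z\<^sub>1 < \<tau>" "leaves z\<^sub>2 < \<tau>" "\<tau> \<le> real (leaves z\<^sub>1) + leaves z\<^sub>2"
      "leaves A + leaves z\<^sub>1 + leaves z\<^sub>2 \<le> leaves F" "leaves B + leaves z\<^sub>1 + leaves z\<^sub>2 \<le> leaves F"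
      "vars z\<^sub>1 \<union> vars z\<^sub>2 \<union> vars A \<union> vars B \<subseteq> vars F"
      using hole_decomposition[OF \<tau>1 \<tau>s] by blast
    define w where "w = s - leaves z\<^sub>1 - leaves z\<^sub>2"
    have wc: "w \<le> s / c" using h(4) by (simp add: w_def \<tau>_def algebra_simps)
    have aw: "leaves A \<le> w" "leaves B \<le> w" using h(5,6) by (simp_all add: w_def s_def)
    have \<tau>t: "\<tau> \<le> (c / (c - 1)) ^ t"
    proof -
      have "\<tau> = s * ((c - 1) / c)" using assms(1) by (simp add: \<tau>_def field_simps)
      also have "\<dots> \<le> (c / (c - 1)) ^ Suc t * ((c - 1) / c)"
        using Suc.prems assms(1) by (intro mult_right_mono) (auto simp: s_def)
      also have "\<dots> = (c / (c - 1)) ^ t" using assms(1) by simp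
      finally show ?thesis .
    qed
    have "s / c \<le> \<tau>"
    proof -
      have "s * (1 / c) \<le> s * (1 - 1 / c)" using s c3 by (intro mult_left_mono) auto
      then show ?thesis by (simp add: \<tau>_def mult.commute)
    qed
    then have le: "leaves z\<^sub>1 \<le> (c / (c - 1)) ^ t" "leaves z\<^sub>2 \<le> (c / (c - 1)) ^ t"
      "leaves A \<le> (c / (c - 1)) ^ t" "leaves B \<le> (c / (c - 1)) ^ t"
      using h(2,3) \<tau>t aw wc by linarith+
    obtain y\<^sub>1 where y1: "ev y\<^sub>1 = ev z\<^sub>1" "vars y\<^sub>1 \<subseteq> vars z\<^sub>1" "height y\<^sub>1 \<le> 3 * t" "leaves y\<^sub>1 \<le> leaves z\<^sub>1 powr (1 + \<epsilon>)"
      using Suc.IH[OF le(1)] by blast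
    obtain y\<^sub>2 where y2: "ev y\<^sub>2 = ev z\<^sub>2" "vars y\<^sub>2 \<subseteq> vars z\<^sub>2" "height y\<^sub>2 \<le> 3 * t" "leaves y\<^sub>2 \<le> leaves z\<^sub>2 powr (1 + \<epsilon>)"
      using Suc.IH[OF le(2)] by blast
    obtain A' where A': "ev A' = ev A" "vars A' \<subseteq> vars A" "height A' \<le> 3 * t" "leaves A' \<le> leaves A powr (1 + \<epsilon>)"
      using Suc.IH[OF le(3)] by blast
    obtain B' where B': "ev B' = ev B" "vars B' \<subseteq> vars B" "height B' \<le> 3 * t" "leaves B' \<le> leaves B powr (1 + \<epsilon>)"
      using Suc.IH[OF le(4)] by blast
    define F' where "F' = Gate False (Gate True (Gate d y\<^sub>1 y\<^sub>2) A') B'"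
    have "ev F' = ev F" unfolding h(1)[symmetric] F'_def by (rule ext) (simp add: y1 y2 A' B')
    moreover have "vars F' \<subseteq> vars F" using h(7) y1 y2 A' B' by (auto simp: F'_def)
    moreover have "height F' \<le> 3 * Suc t" using y1 y2 A' B' by (simp add: F'_def)
    moreover have "leaves F' \<le> leaves F powr (1 + \<epsilon>)"
    proof -
      have "real (leaves F') \<le> leaves z\<^sub>1 powr (1 + \<epsilon>) + leaves z\<^sub>2 powr (1 + \<epsilon>)
              + leaves A powr (1 + \<epsilon>) + leaves B powr (1 + \<epsilon>)"
        using y1(4) y2(4) A'(4) B'(4) by (simp add: F'_def)
      also have "\<dots> \<le> s powr (1 + \<epsilon>)"
        using assms(1-3) aw wc s by (intro powr_superadditive_step[where c = c and w = w]) (auto simp: w_def)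
      finally show ?thesis by (simp add: s_def)
    qed
    ultimately show ?thesis by blast
  qed
qed

section \<open>Counting functions of small cost\<close>

primrec const_free :: "'v fm \<Rightarrow> bool" where
  "const_free (Const c) = False"
| "const_free (Lit b v) = True"
| "const_free (Gate c F G) = (const_free F \<and> const_free G)"

text \<open>Constants have no leaves, so infinitely many formulas share each size. Without constants
  the number of symbols is determined by the number of leaves.\<close>

lemma const_free_form:
  "(\<exists>c. ev F = (\<lambda>_. c)) \<or>
   (\<exists>F'. const_free F' \<and> ev F' = ev F \<and> leaves F' \<le> leaves F \<and> vars F' \<subseteq> vars F)"
proof (induction F)
  case (Const c)
  have "ev (Const c) = (\<lambda>_. c)" by (rule ext) simp
  then show ?case by blast
next
  case (Lit b v)
  show ?case by (rule disjI2, rule exI[of _ "Lit b v"]) simp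
next
  case (Gate c F G)
  have one: ?case if "ev F1 = (\<lambda>_. a)" "ev (Gate c F G) = ev (Gate c F1 G1)"
    "leaves G1 \<le> leaves (Gate c F G)" "vars G1 \<subseteq> vars (Gate c F G)"
    "(\<exists>c. ev G1 = (\<lambda>_. c)) \<or>
     (\<exists>F'. const_free F' \<and> ev F' = ev G1 \<and> leaves F' \<le> leaves G1 \<and> vars F' \<subseteq> vars G1)" for a F1 G1
  proof (cases "a = c")
    case True
    have "ev (Gate c F G) = ev G1" unfolding that(2) by (rule ext) (simp add: that(1) True)
    then show ?thesis using that(3-5) by (metis order_trans)
  next
    case False
    have "ev (Gate c F G) = (\<lambda>_. a)" unfolding that(2) using False by (intro ext) (auto simp: that(1))
    then show ?thesis by blast
  qed
  have comm: "ev (Gate c F G) = ev (Gate c G F)" by (rule ext) auto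
  show ?case
  proof (cases "\<exists>a. ev F = (\<lambda>_. a)")
    case True
    then obtain a where a: "ev F = (\<lambda>_. a)" by (elim exE)
    show ?thesis by (rule one[OF a refl _ _ Gate.IH(2)]) simp_all
  next
    case F: False
    show ?thesis
    proof (cases "\<exists>a. ev G = (\<lambda>_. a)")
      case True
      then obtain a where a: "ev G = (\<lambda>_. a)" by (elim exE)
      show ?thesis by (rule one[OF a comm _ _ Gate.IH(1)]) simp_all
    next
      case G: False
      obtain F' where F': "const_free F'" "ev F' = ev F" "leaves F' \<le> leaves F" "vars F' \<subseteq> vars F"
        using mp[OF iffD1[OF disj_imp Gate.IH(1)] F] by (elim exE conjE)
      obtain G' where G': "const_free G'" "ev G' = ev G" "leaves G' \<le> leaves G" "vars G' \<subseteq> vars G"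
        using mp[OF iffD1[OF disj_imp Gate.IH(2)] G] by (elim exE conjE)
      have "ev (Gate c F' G') = ev (Gate c F G)" by (rule ext) (simp add: F' G')
      moreover have "const_free (Gate c F' G')" "leaves (Gate c F' G') \<le> leaves (Gate c F G)"
          "vars (Gate c F' G') \<subseteq> vars (Gate c F G)" using F' G' by auto
      ultimately show ?thesis by (intro disjI2 exI[of _ "Gate c F' G'"] conjI)
    qed
  qed
qed

primrec prefix_code :: "'v fm \<Rightarrow> ((bool \<times> 'v) + bool) list" where
  "prefix_code (Const c) = []"
| "prefix_code (Lit b v) = [Inl (b, v)]"
| "prefix_code (Gate c F G) = Inr c # prefix_code F @ prefix_code G"

text \<open>Polish notation delimits itself; the trailing words xs and ys are what the induction
  needs for the first child of a gate.\<close>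

lemma prefix_code_inject:
  "const_free F \<Longrightarrow> const_free G \<Longrightarrow> prefix_code F @ xs = prefix_code G @ ys \<Longrightarrow> F = G \<and> xs = ys"
proof (induction F arbitrary: G xs ys)
  case (Gate c F1 F2)
  obtain G1 G2 where G: "G = Gate c G1 G2" using Gate.prems by (cases G) auto
  have "prefix_code F1 @ (prefix_code F2 @ xs) = prefix_code G1 @ (prefix_code G2 @ ys)"
    using Gate.prems G by simp
  then have "F1 = G1 \<and> prefix_code F2 @ xs = prefix_code G2 @ ys"
    using Gate.prems G by (intro Gate.IH(1)) auto
  moreover from this have "F2 = G2 \<and> xs = ys" using Gate.prems G by (intro Gate.IH(2)) auto
  ultimately show ?case using G by simp
next
  case (Lit b v)
  then show ?case by (cases G) auto
qed auto

lemma length_prefix_code: "const_free F \<Longrightarrow> Suc (length (prefix_code F)) = 2 * leaves F"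
  by (induction F) auto

lemma set_prefix_code: "vars F \<subseteq> I \<Longrightarrow> set (prefix_code F) \<subseteq> (UNIV \<times> I) <+> UNIV"
  by (induction F) auto

lemma sum_powers_le: "(\<Sum>i\<le>n. k ^ i) \<le> Suc k ^ n"
proof (induction n)
  case (Suc n)
  have "(\<Sum>i\<le>Suc n. k ^ i) \<le> Suc k ^ n + k * k ^ n" using Suc by simp
  also have "\<dots> \<le> Suc k ^ n + k * Suc k ^ n" by (intro add_left_mono mult_left_mono power_mono) auto
  finally show ?case by simp
qed simp

lemma card_const_free:
  assumes "finite I"
  shows "finite {F. const_free F \<and> vars F \<subseteq> I \<and> leaves F \<le> s}"
    and "card {F. const_free F \<and> vars F \<subseteq> I \<and> leaves F \<le> s} \<le> (2 * card I + 3) ^ (2 * s)"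
proof -
  let ?\<F> = "{F. const_free F \<and> vars F \<subseteq> I \<and> leaves F \<le> s}"
  let ?A = "((UNIV :: bool set) \<times> I) <+> (UNIV :: bool set)"
  let ?L = "{xs. set xs \<subseteq> ?A \<and> length xs \<le> 2 * s}"
  have fA: "finite ?A" using assms by simp
  have cA: "card ?A = 2 * card I + 2"
    using assms by (subst card_Plus) (auto simp: card_cartesian_product)
  have inj: "inj_on prefix_code ?\<F>"
    using prefix_code_inject[where xs = "[]" and ys = "[]"] by (auto intro!: inj_onI)
  have im: "prefix_code ` ?\<F> \<subseteq> ?L"
    using set_prefix_code length_prefix_code by fastforce
  have fL: "finite ?L" by (rule finite_lists_length_le[OF fA])
  show "finite ?\<F>" by (rule inj_on_finite[OF inj im fL])
  have "card ?\<F> \<le> card ?L" by (rule card_inj_on_le[OF inj im fL])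
  also have "\<dots> = (\<Sum>i\<le>2 * s. card ?A ^ i)" by (rule card_lists_length_le[OF fA])
  also have "\<dots> \<le> (2 * card I + 3) ^ (2 * s)"
    using sum_powers_le[of "card ?A" "2 * s"] by (simp add: cA eval_nat_numeral)
  finally show "card ?\<F> \<le> (2 * card I + 3) ^ (2 * s)" .
qed

text \<open>The summand 2 stands for the constant functions, which have no constant-free formula of
  size 0.\<close>

lemma card_low_cost:
  fixes \<Phi> :: "(('i \<Rightarrow> bool) \<Rightarrow> bool) set"
  assumes "finite I" and "\<And>\<phi>. \<phi> \<in> \<Phi> \<Longrightarrow> \<phi> \<in> range ev \<and> cost \<phi> \<le> s"
    and loc: "\<And>\<phi> y y'. \<phi> \<in> \<Phi> \<Longrightarrow> (\<And>i. i \<in> I \<Longrightarrow> y i = y' i) \<Longrightarrow> \<phi> y = \<phi> y'"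
  shows "card \<Phi> \<le> 2 + (2 * card I + 3) ^ (2 * s)"
proof -
  let ?\<F> = "{F. const_free F \<and> vars F \<subseteq> I \<and> leaves F \<le> s}"
  let ?C = "{(\<lambda>_ :: 'i \<Rightarrow> bool. True), (\<lambda>_. False)}"
  have sub: "\<Phi> \<subseteq> ?C \<union> ev ` ?\<F>"
  proof
    fix \<phi> assume \<phi>: "\<phi> \<in> \<Phi>"
    obtain F where F: "ev F = \<phi>" "leaves F = cost \<phi>" using cost_witness assms(2)[OF \<phi>] by blast
    \<comment> \<open>A cheapest formula may mention variables outside I, on which the function does
      not depend; they are set to false.\<close>
    define G where "G = subst (\<lambda>v. if v \<in> I then Lit True v else Const False) F"
    have "ev G = \<phi>"
    proof
      fix y
      have "ev G y = \<phi> (\<lambda>v. ev (if v \<in> I then Lit True v else Const False) y)"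
        unfolding G_def ev_subst F(1) ..
      also have "\<dots> = \<phi> y" by (rule loc[OF \<phi>]) simp
      finally show "ev G y = \<phi> y" .
    qed
    moreover have "vars G \<subseteq> I" unfolding G_def using vars_subst by (fastforce split: if_splits)
    moreover have "leaves G \<le> leaves F" unfolding G_def by (rule leaves_subst_le) auto
    moreover have "leaves F \<le> s" using F assms(2)[OF \<phi>] by simp
    ultimately show "\<phi> \<in> ?C \<union> ev ` ?\<F>"
    proof -
      assume G: "ev G = \<phi>" "vars G \<subseteq> I" "leaves G \<le> leaves F" "leaves F \<le> s"
      show ?thesis
      proof (cases "\<exists>c. ev G = (\<lambda>_. c)")
        case True
        then obtain c where "ev G = (\<lambda>_. c)" by (elim exE)
        then show ?thesis using G(1) by (cases c) simp_all
      next
        case False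
        obtain F' where F': "const_free F'" "ev F' = ev G" "leaves F' \<le> leaves G" "vars F' \<subseteq> vars G"
          using mp[OF iffD1[OF disj_imp const_free_form] False] by (elim exE conjE)
        have "F' \<in> ?\<F>" using F' G by auto
        moreover have "\<phi> = ev F'" using F'(2) G(1) by simp
        ultimately show ?thesis by (intro UnI2 image_eqI)
      qed
    qed
  qed
  have "card \<Phi> \<le> card (?C \<union> ev ` ?\<F>)"
    using card_const_free(1)[OF assms(1)] by (intro card_mono sub) auto
  also have "\<dots> \<le> card ?C + card (ev ` ?\<F>)" by (rule card_Un_le)
  also have "card ?C \<le> 2" by (simp add: card_insert_if)
  also have "card (ev ` ?\<F>) \<le> card ?\<F>" using card_const_free(1)[OF assms(1)] by (rule card_image_le)
  also have "\<dots> \<le> (2 * card I + 3) ^ (2 * s)" by (rule card_const_free(2)[OF assms(1)])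
  finally show ?thesis by simp
qed

subsection \<open>Hiding projections for surjectivity\<close>

text \<open>A point writes a value from V at every position of J. Having twice as many positions as
  values leaves at least \<open>card V\<close> blanks, so that neither an erased entry nor the place
  to fill can be located cheaply.\<close>

locale surjectivity =
  fixes J :: "'j set" and V :: "'c set" and blank :: 'c
  assumes finite_J: "finite J" and finite_V: "finite V" and blank_in_V: "blank \<in> V"
    and card_J: "card J \<ge> 2 * card V" and card_V: "card V \<ge> 2"
begin

definition supp :: "('j \<Rightarrow> 'c) \<Rightarrow> 'j set" where
  "supp p = {j \<in> J. p j \<noteq> blank}"

definition full :: "('j \<Rightarrow> 'c) set" where
  "full = {p \<in> J \<rightarrow>\<^sub>E V. bij_betw p (supp p) (V - {blank})}"

definition missing :: "('j \<Rightarrow> 'c) set" where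
  "missing = {p \<in> J \<rightarrow>\<^sub>E V. \<exists>v\<in>V - {blank}. bij_betw p (supp p) (V - {blank, v})}"

text \<open>Erasing one entry of a full list. Both directions have large degree: a full list has
  \<open>card V - 1\<close> entries to erase, and the absent value of a missing list fits at every
  blank.\<close>

definition edges :: "(('j \<Rightarrow> 'c) \<times> ('j \<Rightarrow> 'c)) set" where
  "edges = (\<lambda>(b, j). (b(j := blank), b)) ` (SIGMA b:full. supp b)"

lemma points_PiE: "p \<in> full \<union> missing \<Longrightarrow> p \<in> J \<rightarrow>\<^sub>E V"
  by (auto simp: full_def missing_def)

lemma finite_points: "finite (full \<union> missing)"
proof -
  have "full \<union> missing \<subseteq> (J \<rightarrow>\<^sub>E V)" using points_PiE by blast
  moreover have "finite (J \<rightarrow>\<^sub>E V)" using finite_J finite_V by (intro finite_PiE) auto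
  ultimately show ?thesis by (rule finite_subset)
qed

lemma finite_supp: "finite (supp p)"
  using finite_J by (simp add: supp_def)

lemma finite_edges: "finite edges"
  unfolding edges_def using finite_points finite_supp by (intro finite_imageI finite_SigmaI) auto

lemma supp_upd: "j \<in> J \<Longrightarrow> supp (p(j := v)) = (if v = blank then supp p - {j} else insert j (supp p))"
  by (auto simp: supp_def)

lemma full_clear:
  assumes "b \<in> full" "j \<in> supp b"
  shows "b(j := blank) \<in> missing"
proof -
  have j: "j \<in> J" "b j \<noteq> blank" using assms(2) by (auto simp: supp_def)
  have b: "b \<in> J \<rightarrow>\<^sub>E V" "inj_on b (supp b)" "b ` supp b = V - {blank}"
    using assms(1) by (auto simp: full_def bij_betw_def)
  have "b ` (supp b - {j}) = b ` supp b - {b j}"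
    using inj_on_image_set_diff[OF b(2), of "supp b" "{j}"] assms(2) by auto
  then have "b ` (supp b - {j}) = V - {blank, b j}" using b(3) by auto
  moreover have "(b(j := blank)) ` (supp b - {j}) = b ` (supp b - {j})" by auto
  moreover have "inj_on (b(j := blank)) (supp b - {j})" using b(2) by (auto simp: inj_on_def)
  ultimately have "bij_betw (b(j := blank)) (supp (b(j := blank))) (V - {blank, b j})"
    by (simp add: bij_betw_def supp_upd[OF j(1)])
  moreover have "b j \<in> V - {blank}" using b(1) j by auto
  moreover have "b(j := blank) \<in> J \<rightarrow>\<^sub>E V" using b(1) j blank_in_V by (auto simp: PiE_iff extensional_def)
  ultimately show ?thesis by (auto simp: missing_def)
qed

lemma missing_fill:
  assumes "p \<in> missing"
  obtains v where "v \<in> V - {blank}" "v \<notin> p ` J" "\<And>j. j \<in> J \<Longrightarrow> p j = blank \<Longrightarrow> p(j := v) \<in> full"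
    "card (supp p) = card V - 2"
proof -
  obtain v where v: "v \<in> V - {blank}" "bij_betw p (supp p) (V - {blank, v})" and p: "p \<in> J \<rightarrow>\<^sub>E V"
    using assms by (auto simp: missing_def)
  have im: "p ` supp p = V - {blank, v}" "inj_on p (supp p)" using v(2) by (auto simp: bij_betw_def)
  have nv: "v \<notin> p ` J"
  proof
    assume "v \<in> p ` J"
    then obtain j where "j \<in> J" "p j = v" by auto
    then have "j \<in> supp p" using v(1) by (auto simp: supp_def)
    then show False using im(1) \<open>p j = v\<close> by auto
  qed
  have "p(j := v) \<in> full" if j: "j \<in> J" "p j = blank" for j
  proof -
    have js: "j \<notin> supp p" using j by (simp add: supp_def)
    have s: "supp (p(j := v)) = insert j (supp p)" using v(1) by (simp add: supp_upd[OF j(1)])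
    have "inj_on (p(j := v)) (insert j (supp p))"
      using im js by (auto simp: inj_on_def)
    moreover have "(p(j := v)) ` insert j (supp p) = V - {blank}"
    proof -
      have "(p(j := v)) ` insert j (supp p) = insert v (p ` supp p)" using js by auto
      then show ?thesis using im(1) v(1) by auto
    qed
    moreover have "p(j := v) \<in> J \<rightarrow>\<^sub>E V" using p j v(1) by (auto simp: PiE_iff extensional_def)
    ultimately show ?thesis by (simp add: full_def bij_betw_def s)
  qed
  moreover have "card {blank, v} = 2" using v(1) by (simp add: card_2_iff) blast
  then have "card (supp p) = card V - 2"
    using bij_betw_same_card[OF v(2)] finite_V v(1) blank_in_V by (simp add: card_Diff_subset)
  ultimately show thesis using that v(1) nv by blast
qed

lemma full_onto:
  assumes "b \<in> full" "u \<in> V"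
  shows "\<exists>j\<in>J. b j = u"
proof (cases "u = blank")
  case True
  \<comment> \<open>The value \<open>blank\<close> must occur too: only \<open>card V - 1\<close>
    positions hold anything else.\<close>
  have "bij_betw b (supp b) (V - {blank})" using assms(1) by (simp add: full_def)
  from bij_betw_same_card[OF this] have "card (supp b) < card J"
    using card_J card_V finite_V blank_in_V by (simp add: card_Diff_subset)
  moreover have "supp b \<subseteq> J" by (auto simp: supp_def)
  ultimately obtain j where "j \<in> J" "j \<notin> supp b" by (metis subsetI less_irrefl subset_antisym)
  then show ?thesis using True by (auto simp: supp_def)
next
  case False
  then have "u \<in> b ` supp b" using assms by (auto simp: full_def bij_betw_def)
  then show ?thesis by (auto simp: supp_def)
qed

lemma missing_not_onto: "p \<in> missing \<Longrightarrow> \<exists>u\<in>V. \<forall>j\<in>J. p j \<noteq> u"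
proof -
  assume "p \<in> missing"
  then obtain v where "v \<in> V - {blank}" "v \<notin> p ` J" by (rule missing_fill)
  then show ?thesis by (intro bexI[of _ v]) auto
qed

lemma disjoint_points: "full \<inter> missing = {}"
  using full_onto missing_not_onto by blast

lemma edges_points: "(p, b) \<in> edges \<Longrightarrow> p \<in> missing \<and> b \<in> full"
  unfolding edges_def using full_clear by auto

lemma edge_update: "(p, b) \<in> edges \<Longrightarrow> \<exists>i\<in>J. p i = blank \<and> b i \<noteq> blank \<and> p = b(i := blank)"
  unfolding edges_def by (auto simp: supp_def)

text \<open>Together with the next lemma: a point and the position of the change determine the edge.
  So a single bit sees at most one edge at each point, against about \<open>card V\<close> edges in
  all.\<close>

lemma edge_unique_source:
  assumes "(p, b) \<in> edges" "(p', b) \<in> edges" "p j \<noteq> b j" "p' j \<noteq> b j"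
  shows "p = p'"
  using edge_update[OF assms(1)] edge_update[OF assms(2)] assms(3,4) by (metis fun_upd_other)

text \<open>The value written at j is forced, being the only one absent from p.\<close>

lemma edge_unique_target:
  assumes "(p, b) \<in> edges" "(p, b') \<in> edges" "p j \<noteq> b j" "p j \<noteq> b' j"
  shows "b = b'"
proof -
  obtain v where v: "v \<in> V - {blank}" "v \<notin> p ` J" using edges_points[OF assms(1)] missing_fill by metis
  have fill: "c = p(j := v)" if c: "(p, c) \<in> edges" "p j \<noteq> c j" for c
  proof -
    obtain i where i: "i \<in> J" "p = c(i := blank)" using edge_update[OF c(1)] by blast
    have ij: "i = j" using i(2) c(2) by (metis fun_upd_other)
    have "c \<in> full" using edges_points[OF c(1)] by simp
    then obtain k where k: "k \<in> J" "c k = v" using full_onto v(1) by blast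
    have "k = j"
    proof (rule ccontr)
      assume "k \<noteq> j"
      then have "p k = v" using i(2) ij k by simp
      then show False using v(2) k(1) by blast
    qed
    then show ?thesis using i(2) ij k(2) by (auto simp: fun_eq_iff)
  qed
  show ?thesis using fill[OF assms(1,3)] fill[OF assms(2,4)] by simp
qed

lemma card_edges_full: "card full * (card V - 1) \<le> card edges"
proof -
  have "card edges = card (SIGMA b:full. supp b)"
    unfolding edges_def
  proof (rule card_image, rule inj_onI, clarsimp)
    fix b j j' assume b: "j \<in> supp b" "j' \<in> supp b" "b(j := blank) = b(j' := blank)"
    show "j = j'"
    proof (rule ccontr)
      assume "j \<noteq> j'"
      then have "b j = blank" using fun_cong[OF b(3), of j] by simp
      then show False using b(1) by (simp add: supp_def)
    qed
  qed
  also have "\<dots> = (\<Sum>b\<in>full. card (supp b))"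
    using finite_points finite_supp by (intro card_SigmaI) auto
  also have "\<dots> = (\<Sum>b\<in>full. card V - 1)"
  proof (rule sum.cong[OF refl])
    fix b assume "b \<in> full"
    then have "bij_betw b (supp b) (V - {blank})" by (simp add: full_def)
    from bij_betw_same_card[OF this] show "card (supp b) = card V - 1"
      using finite_V blank_in_V by (simp add: card_Diff_subset)
  qed
  finally show ?thesis by simp
qed

text \<open>A missing list has \<open>card V - 2\<close> entries and hence more than
  \<open>card V\<close> blanks, each of which may receive the absent value.\<close>

lemma card_edges_missing: "card missing * (card V - 1) \<le> card edges"
proof -
  have "\<forall>p\<in>missing. \<exists>v. v \<in> V - {blank} \<and> v \<notin> p ` J \<and> (\<forall>j\<in>J. p j = blank \<longrightarrow> p(j := v) \<in> full)"
  proof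
    fix p assume "p \<in> missing"
    then show "\<exists>v. v \<in> V - {blank} \<and> v \<notin> p ` J \<and> (\<forall>j\<in>J. p j = blank \<longrightarrow> p(j := v) \<in> full)"
      by (elim missing_fill) blast
  qed
  then obtain m where m: "\<And>p. p \<in> missing \<Longrightarrow> m p \<in> V - {blank} \<and> m p \<notin> p ` J \<and>
      (\<forall>j\<in>J. p j = blank \<longrightarrow> p(j := m p) \<in> full)"
    unfolding bchoice_iff by blast
  let ?X = "SIGMA p:missing. J - supp p"
  have inj: "inj_on (\<lambda>(p, j). (p, p(j := m p))) ?X"
  proof (rule inj_onI, clarsimp)
    fix p j j' assume p: "p \<in> missing" and j: "j \<in> J" "j \<notin> supp p" "p(j := m p) = p(j' := m p)"
    show "j = j'"
    proof (rule ccontr)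
      assume "j \<noteq> j'"
      then have "m p = p j" using fun_cong[OF j(3), of j] by simp
      then show False using m[OF p] j(1) by auto
    qed
  qed
  have im: "(\<lambda>(p, j). (p, p(j := m p))) ` ?X \<subseteq> edges"
  proof
    fix e assume "e \<in> (\<lambda>(p, j). (p, p(j := m p))) ` ?X"
    then obtain p j where pj: "p \<in> missing" "j \<in> J" "p j = blank" "e = (p, p(j := m p))"
      by (auto simp: supp_def)
    have "p(j := m p) \<in> full" "m p \<noteq> blank" using m[OF pj(1)] pj by auto
    moreover have "j \<in> supp (p(j := m p))" using pj(2) \<open>m p \<noteq> blank\<close> by (simp add: supp_def)
    moreover have "e = (\<lambda>(b, j). (b(j := blank), b)) (p(j := m p), j)" using pj(3,4) by (auto simp: fun_eq_iff)
    ultimately show "e \<in> edges" unfolding edges_def by blast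
  qed
  have "card missing * (card V - 1) = (\<Sum>p\<in>missing. card V - 1)" by simp
  also have "\<dots> \<le> (\<Sum>p\<in>missing. card (J - supp p))"
  proof (rule sum_mono)
    fix p assume "p \<in> missing"
    then have "card (supp p) = card V - 2" by (elim missing_fill)
    moreover have "card (J - supp p) = card J - card (supp p)"
      using finite_supp by (intro card_Diff_subset) (auto simp: supp_def)
    ultimately show "card V - 1 \<le> card (J - supp p)" using card_J by linarith
  qed
  also have "\<dots> = card ?X" using finite_points finite_J by (intro card_SigmaI[symmetric]) auto
  also have "\<dots> = card ((\<lambda>(p, j). (p, p(j := m p))) ` ?X)" using card_image[OF inj] by simp
  also have "\<dots> \<le> card edges" by (intro card_mono finite_edges im)
  finally show ?thesis .
qed

lemma full_nonempty: "full \<noteq> {}"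
proof -
  have "card (V - {blank}) \<le> card J" using card_J finite_V blank_in_V by (simp add: card_Diff_subset)
  then obtain f where f: "f ` (V - {blank}) \<subseteq> J" "inj_on f (V - {blank})"
    using card_le_inj[of "V - {blank}" J] finite_V finite_J by auto
  define b where "b j = (if j \<in> f ` (V - {blank}) then the_inv_into (V - {blank}) f j
                          else if j \<in> J then blank else undefined)" for j
  have bf: "b (f v) = v" if "v \<in> V - {blank}" for v
    using that f(2) by (simp add: b_def the_inv_into_f_f)
  have s: "supp b = f ` (V - {blank})"
  proof (intro equalityI subsetI)
    fix j assume "j \<in> supp b"
    then show "j \<in> f ` (V - {blank})" by (auto simp: supp_def b_def split: if_splits)
  next
    fix j assume "j \<in> f ` (V - {blank})"
    then obtain v where v: "v \<in> V - {blank}" "j = f v" by blast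
    then show "j \<in> supp b" using bf[OF v(1)] f(1) by (auto simp: supp_def)
  qed
  have "bij_betw b (supp b) (V - {blank})"
    unfolding s
  proof (rule bij_betw_byWitness[where f' = f])
    show "\<forall>a\<in>f ` (V - {blank}). f (b a) = a" using bf by auto
    show "\<forall>a'\<in>V - {blank}. b (f a') = a'" using bf by blast
    show "b ` f ` (V - {blank}) \<subseteq> V - {blank}"
    proof
      fix a assume "a \<in> b ` f ` (V - {blank})"
      then obtain v where v: "v \<in> V - {blank}" "a = b (f v)" by blast
      then show "a \<in> V - {blank}" using bf[OF v(1)] by simp
    qed
  qed auto
  moreover have "b \<in> J \<rightarrow>\<^sub>E V"
  proof (rule PiE_I)
    fix j assume "j \<in> J"
    show "b j \<in> V"
    proof (cases "j \<in> f ` (V - {blank})")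
      case True
      then show ?thesis using bf by force
    next
      case False
      then show ?thesis using \<open>j \<in> J\<close> blank_in_V by (simp add: b_def)
    qed
  next
    fix j assume "j \<notin> J"
    then show "b j = undefined" using f(1) by (auto simp: b_def)
  qed
  ultimately show ?thesis by (auto simp: full_def)
qed

lemma card_edges_pos: "card edges > 0"
proof -
  have "card full > 0" using full_nonempty finite_points by (simp add: card_gt_0_iff)
  then have "card full * (card V - 1) > 0" using card_V by simp
  then show ?thesis using card_edges_full by linarith
qed

text \<open>With at most one unit edge per point and bit, 1/q is just the weight that the star
  condition demands of an equal pair.\<close>

definition edge_weight :: "real \<Rightarrow> ('j \<Rightarrow> 'c) \<times> ('j \<Rightarrow> 'c) \<Rightarrow> real" where
  "edge_weight q e = (if fst e = snd e then 1 / q else if e \<in> edges then 1 else 0)"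

text \<open>A full list occurs only as a target and a missing list only as a source, so all edges at
  a run in one direction; among them the position j singles out at most one.\<close>

lemma edge_weight_hiding:
  assumes a: "a \<in> full \<union> missing" and q: "q > 0" and B: "B \<subseteq> {b \<in> full \<union> missing. b j \<noteq> a j}"
  shows "(\<Sum>b\<in>B. edge_weight q (a, b) + edge_weight q (b, a)) \<le> q * edge_weight q (a, a)"
proof -
  let ?N = "{b \<in> B. (a, b) \<in> edges \<or> (b, a) \<in> edges}"
  have fB: "finite B" using B finite_points by (auto intro: finite_subset)
  have ne: "b \<noteq> a" if "b \<in> B" for b using B that by auto
  have noboth: "\<not> ((a, b) \<in> edges \<and> (b', a) \<in> edges)" for b b'
    using edges_points disjoint_points by blast
  have "(\<Sum>b\<in>B. edge_weight q (a, b) + edge_weight q (b, a)) = (\<Sum>b\<in>B. if b \<in> ?N then 1 else 0)"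
  proof (rule sum.cong[OF refl])
    fix b assume "b \<in> B"
    then show "edge_weight q (a, b) + edge_weight q (b, a) = (if b \<in> ?N then 1 else 0)"
      using ne[of b] noboth[of b b] by (auto simp: edge_weight_def)
  qed
  also have "\<dots> = real (card ?N)" using fB by (simp add: sum.If_cases Int_def)
  also have "card ?N \<le> 1"
  proof (rule card_le_Suc0_iff_eq[THEN iffD2, unfolded One_nat_def[symmetric]])
    show "finite ?N" using fB by simp
    show "\<forall>b\<in>?N. \<forall>b'\<in>?N. b = b'"
    proof (intro ballI)
      fix b b' assume b: "b \<in> ?N" "b' \<in> ?N"
      have j: "b j \<noteq> a j" "b' j \<noteq> a j" using b B by auto
      consider "(a, b) \<in> edges" "(a, b') \<in> edges" | "(b, a) \<in> edges" "(b', a) \<in> edges"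
        using b noboth by blast
      then show "b = b'"
      proof cases
        case 1
        show ?thesis by (rule edge_unique_target[OF 1, where j = j]) (use j in auto)
      next
        case 2
        show ?thesis by (rule edge_unique_source[OF 2 j])
      qed
    qed
  qed
  finally show ?thesis using q by (simp add: edge_weight_def)
qed

text \<open>Counting edges from either side bounds the number of points by 2
  \<open>card edges\<close> / (\<open>card V\<close> - 1), and each point contributes one equal
  pair.\<close>

lemma edge_weight_total:
  assumes "q > 0"
  shows "(\<Sum>e\<in>(full \<union> missing) \<times> (full \<union> missing). edge_weight q e)
           \<le> card edges * (1 + 2 / ((real (card V) - 1) * q))"
proof -
  let ?S = "full \<union> missing"
  have sub: "edges \<subseteq> ?S \<times> ?S" using edges_points by auto
  have ne: "fst e \<noteq> snd e" if "e \<in> edges" for e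
    using edges_points[of "fst e" "snd e"] that disjoint_points by auto
  have f: "finite (?S \<times> ?S)" using finite_points by simp
  have "(\<Sum>e\<in>?S \<times> ?S. edge_weight q e)
      = (\<Sum>e\<in>?S \<times> ?S. (if fst e = snd e then 1 / q else 0) + (if e \<in> edges then 1 else 0))"
    by (rule sum.cong) (auto simp: edge_weight_def dest: ne)
  also have "\<dots> = (\<Sum>e\<in>?S \<times> ?S. if fst e = snd e then 1 / q else 0) + (\<Sum>e\<in>?S \<times> ?S. if e \<in> edges then 1 else 0)"
    by (rule sum.distrib)
  also have "(\<Sum>e\<in>?S \<times> ?S. if e \<in> edges then (1::real) else 0) = card edges"
    using sub f by (simp add: sum.If_cases Int_absorb1)
  also have "(\<Sum>e\<in>?S \<times> ?S. if fst e = snd e then 1 / q else 0) = (\<Sum>a\<in>?S. \<Sum>b\<in>?S. if a = b then 1 / q else 0)"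
    by (simp add: sum.cartesian_product case_prod_beta)
  also have "\<dots> = (\<Sum>a\<in>?S. 1 / q)" using finite_points by (intro sum.cong) auto
  also have "\<dots> = real (card ?S) / q" by simp
  also have "real (card ?S) / q + card edges \<le> card edges * (1 + 2 / ((real (card V) - 1) * q))"
  proof -
    have "card ?S * (card V - 1) \<le> 2 * card edges"
    proof -
      have "card ?S * (card V - 1) \<le> (card full + card missing) * (card V - 1)"
        by (intro mult_right_mono card_Un_le) simp
      then show ?thesis using card_edges_full card_edges_missing by (simp add: add_mult_distrib)
    qed
    then have "real (card ?S * (card V - 1)) \<le> real (2 * card edges)" by (rule of_nat_mono)
    then have "real (card ?S) * (real (card V) - 1) \<le> 2 * card edges"
      using card_V by (simp add: of_nat_diff)
    then have "real (card ?S) \<le> 2 * card edges / (real (card V) - 1)"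
      using card_V by (simp add: field_simps)
    then have "real (card ?S) / q \<le> 2 * card edges / (real (card V) - 1) / q"
      using assms by (intro divide_right_mono) auto
    then show ?thesis by (simp add: algebra_simps)
  qed
  finally show ?thesis .
qed

end

text \<open>All but a fraction \<open>1 / card I\<close> of the weight of a block lies on edges. Only the projections
  with an edge in every block are of interest; the constant pairs are there to make the weights hiding.\<close>

lemma (in surjectivity) composition_cost:
  fixes I :: "'i set" and F :: "('i \<times> 'j \<times> 't) fm" and bit :: "'c \<Rightarrow> 't \<Rightarrow> bool"
  assumes I: "finite I" "card I \<ge> 1" and F: "fst ` vars F \<subseteq> I" "height F \<le> T" "T \<ge> 1"
    and \<phi>: "\<And>\<pi>. \<pi> \<in> (\<Pi>\<^sub>E i\<in>I. edges) \<Longrightarrow>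
      (\<lambda>y. ev F (\<lambda>(i, j, t). bit ((if y i then snd (\<pi> i) else fst (\<pi> i)) j) t)) = \<phi>"
  shows "cost \<phi> \<le> 3 * (2 + 16 * (2 * card I / (real (card V) - 1))\<^sup>2 * real T ^ 3 * leaves F)"
proof -
  \<comment> \<open>Makes 2 / ((card V - 1) q) equal to 1 / card I, so that over all blocks the
    equal pairs enlarge the total weight by at most (1 + 1/card I)^(card I), which is below
    3.\<close>
  define q where "q = 2 * card I / (real (card V) - 1)"
  have q: "q > 0" unfolding q_def using I card_V by (intro divide_pos_pos) auto
  define val where "val = (\<lambda>(i :: 'i, j, t) (p :: 'j \<Rightarrow> 'c). bit (p j) t)"
  interpret projection_space I "full \<union> missing" fst val
    by unfold_locales (use I finite_points in auto)
  define w where "w = (\<lambda>i :: 'i. edge_weight q)"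
  have hid: "hiding q w"
    unfolding hiding_def
  proof (intro conjI ballI allI impI)
    show "q \<ge> 0" using q by simp
    show "w i p \<ge> 0" for i p using q by (simp add: w_def edge_weight_def)
    fix v :: "'i \<times> 'j \<times> 't" and a assume a: "a \<in> full \<union> missing"
    obtain i j t where v: "v = (i, j, t)" by (cases v)
    show "(\<Sum>b | b \<in> full \<union> missing \<and> val v b \<noteq> val v a. w (fst v) (a, b) + w (fst v) (b, a))
            \<le> q * w (fst v) (a, a)"
      unfolding w_def by (rule edge_weight_hiding[OF a q, where j = j]) (auto simp: v val_def)
  qed
  let ?E = "\<Pi>\<^sub>E i\<in>I. edges"
  have sub: "?E \<subseteq> \<Omega>" unfolding \<Omega>_def by (rule PiE_mono) (use edges_points in auto)
  have one: "wt w \<pi> = 1" if "\<pi> \<in> ?E" for \<pi>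
  proof -
    have "w i (\<pi> i) = 1" if "i \<in> I" for i
    proof -
      have "\<pi> i \<in> edges" using that \<open>\<pi> \<in> ?E\<close> by blast
      moreover have "fst (\<pi> i) \<noteq> snd (\<pi> i)"
        using edges_points[of "fst (\<pi> i)" "snd (\<pi> i)"] calculation disjoint_points by auto
      ultimately show ?thesis by (simp add: w_def edge_weight_def)
    qed
    then show ?thesis by (simp add: wt_def)
  qed
  have pr: "proj F \<pi> = \<phi>" if "\<pi> \<in> ?E" for \<pi>
  proof -
    have "inp \<pi> y = (\<lambda>(i, j, t). bit ((if y i then snd (\<pi> i) else fst (\<pi> i)) j) t)" for y
      by (rule ext, simp only: inp_def) (simp add: val_def split_beta)
    then show ?thesis using \<phi>[OF that] by (simp add: proj_def[abs_def])
  qed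
  define X where "X = real (card edges) ^ card I"
  have X: "X > 0" using card_edges_pos by (simp add: X_def)
  define R where "R = 2 + 16 * q\<^sup>2 * real T ^ 3 * leaves F"
  have R: "R \<ge> 0" by (simp add: R_def)
  \<comment> \<open>Only projections with an edge in every block are kept; each has weight 1 and
    projects F to \<phi>.\<close>
  have "X * cost \<phi> = (\<Sum>\<pi>\<in>?E. wt w \<pi> * real (cost (proj F \<pi>)))"
    using one pr I(1) by (simp add: X_def card_PiE)
  also have "\<dots> \<le> (\<Sum>\<pi>\<in>\<Omega>. wt w \<pi> * real (cost (proj F \<pi>)))"
    using sub finite_\<Omega> wt_nonneg[OF hid] by (intro sum_mono2) auto
  also have "\<dots> \<le> R * (\<Sum>\<pi>\<in>\<Omega>. wt w \<pi>)"
    unfolding R_def by (rule shrinkage[OF closed_\<Omega> hid F q])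
  finally have up: "X * cost \<phi> \<le> R * (\<Sum>\<pi>\<in>\<Omega>. wt w \<pi>)" .
  have "(\<Sum>\<pi>\<in>\<Omega>. wt w \<pi>) = (\<Prod>i\<in>I. \<Sum>e\<in>(full \<union> missing) \<times> (full \<union> missing). w i e)"
    unfolding wt_def \<Omega>_def using I(1) finite_points by (subst prod_sum_PiE) auto
  also have "\<dots> = (\<Sum>e\<in>(full \<union> missing) \<times> (full \<union> missing). edge_weight q e) ^ card I"
    by (simp add: w_def)
  also have "\<dots> \<le> (card edges * (1 + 1 / card I)) ^ card I"
  proof (rule power_mono)
    have "(real (card V) - 1) * q = 2 * card I" using card_V by (simp add: q_def)
    then have "2 / ((real (card V) - 1) * q) = 1 / card I" using I by simp
    then show "(\<Sum>e\<in>(full \<union> missing) \<times> (full \<union> missing). edge_weight q e) \<le> card edges * (1 + 1 / card I)"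
      using edge_weight_total[OF q] by simp
    show "(\<Sum>e\<in>(full \<union> missing) \<times> (full \<union> missing). edge_weight q e) \<ge> 0"
      using q by (intro sum_nonneg) (auto simp: edge_weight_def)
  qed
  also have "\<dots> = X * (1 + 1 / card I) ^ card I" by (simp add: X_def power_mult_distrib)
  also have "\<dots> \<le> X * 3"
  proof -
    have "(1 + 1 / real (card I)) ^ card I \<le> exp (1 / real (card I)) ^ card I"
      using exp_ge_add_one_self[of "1 / real (card I)"] by (intro power_mono) auto
    also have "\<dots> = exp 1" using I(2) by (subst exp_of_nat_mult[symmetric]) auto
    also have "\<dots> \<le> 3" by (rule exp_le)
    finally show ?thesis using X by simp
  qed
  finally have "R * (\<Sum>\<pi>\<in>\<Omega>. wt w \<pi>) \<le> R * (X * 3)" using R by (rule mult_left_mono)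
  then have "X * cost \<phi> \<le> X * (3 * R)" using up by (simp add: mult_ac)
  then show ?thesis using X by (simp add: R_def q_def)
qed

subsection \<open>The hard function\<close>

primrec bval :: "bool list \<Rightarrow> nat" where
  "bval [] = 0"
| "bval (b # bs) = of_bool b + 2 * bval bs"

text \<open>An overflow appends a digit, which agrees with \<open>binary\<close>. A counter of width
  w reaches this only at 2^w.\<close>

primrec binc :: "bool list \<Rightarrow> bool list" where
  "binc [] = [True]"
| "binc (b # bs) = (if b then False # binc bs else True # bs)"

lemma binary_0 [simp]: "binary 0 = []"
  by (simp add: binary.simps)

lemma binary_bit: "b \<or> m > 0 \<Longrightarrow> binary (of_bool b + 2 * m) = b # binary m"
  by (subst binary.simps) auto

lemma bval_binary: "bval (binary n) = n"
proof (induction n rule: binary.induct)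
  case (1 n)
  then show ?case by (subst binary.simps) (auto simp: odd_iff_mod_2_eq_one)
qed

lemma bval_snoc_True_pos: "bval (bs @ [True]) > 0"
  by (induction bs) auto

lemma binary_bval_True: "binary (bval (bs @ [True])) = bs @ [True]"
proof (induction bs)
  case Nil
  show ?case using binary_bit[of True 0] by simp
next
  case (Cons b bs)
  then show ?case using binary_bit[of b "bval (bs @ [True])"] bval_snoc_True_pos[of bs] by simp
qed

lemma bval_less: "bval bs < 2 ^ length bs"
  by (induction bs) (auto split: split_of_bool)

lemma bval_inject: "length as = length bs \<Longrightarrow> bval as = bval bs \<Longrightarrow> as = bs"
proof (induction as bs rule: list_induct2)
  case (Cons a as b bs)
  have "(of_bool a + 2 * bval as) mod 2 = (of_bool b + 2 * bval bs) mod 2" using Cons.prems by simp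
  then have "a = b" by (cases a; cases b) auto
  then show ?case using Cons by simp
qed simp

lemma bval_binc: "bval (binc bs) = Suc (bval bs)"
  by (induction bs) auto

lemma bval_binc_pow: "bval ((binc ^^ v) bs) = bval bs + v"
  by (induction v) (auto simp: bval_binc)

lemma length_binc: "Suc (bval bs) < 2 ^ length bs \<Longrightarrow> length (binc bs) = length bs"
  by (induction bs) auto

lemma length_binc_pow: "bval bs + v < 2 ^ length bs \<Longrightarrow> length ((binc ^^ v) bs) = length bs"
proof (induction v)
  case (Suc v)
  then have "length ((binc ^^ v) bs) = length bs" by simp
  moreover have "length (binc ((binc ^^ v) bs)) = length ((binc ^^ v) bs)"
    using Suc by (intro length_binc) (auto simp: bval_binc_pow)
  ultimately show ?case by simp
qed simp

lemma binc_binary: "binc (binary n) = binary (Suc n)"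
proof (induction n rule: binary.induct)
  case (1 n)
  show ?case
  proof (cases "n = 0")
    case True
    then show ?thesis using binary_bit[of True 0] by simp
  next
    case False
    have n: "binary n = odd n # binary (n div 2)" using False by (subst binary.simps) simp
    show ?thesis
    proof (cases "odd n")
      case True
      then have "Suc n = of_bool False + 2 * Suc (n div 2)" by (auto elim: oddE)
      then have "binary (Suc n) = False # binary (Suc (n div 2))"
        using binary_bit[of False "Suc (n div 2)"] by simp
      then show ?thesis using 1[OF False] True by (simp add: n)
    next
      case even: False
      then have "Suc n = of_bool True + 2 * (n div 2)" by auto
      then have "binary (Suc n) = True # binary (n div 2)"
        using binary_bit[of True "n div 2"] by simp
      then show ?thesis using even by (simp add: n)
    qed
  qed
qed

lemma length_binary_bounds: "n > 0 \<Longrightarrow> 2 ^ length (binary n) \<le> 2 * n" "n < 2 ^ length (binary n)"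
proof -
  show "n > 0 \<Longrightarrow> 2 ^ length (binary n) \<le> 2 * n"
  proof (induction n rule: binary.induct)
    case (1 n)
    have n: "binary n = odd n # binary (n div 2)" using 1 by (subst binary.simps) simp
    show ?case
    proof (cases "n div 2 = 0")
      case True
      then show ?thesis using 1(2) by (simp add: n)
    next
      case False
      then have "2 ^ length (binary (n div 2)) \<le> 2 * (n div 2)" using 1 by simp
      then show ?thesis by (simp add: n)
    qed
  qed
  show "n < 2 ^ length (binary n)" using bval_less[of "binary n"] by (simp add: bval_binary)
qed

text \<open>Fixed-width numerals, defined by repeated incrementing because the transducer produces
  them this way; \<open>all_bits\<close> inherits its order of enumeration from here.\<close>

definition counter :: "nat \<Rightarrow> nat \<Rightarrow> bool list" where
  "counter w i = (binc ^^ i) (replicate w False)"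

lemma bval_replicate [simp]: "bval (replicate w False) = 0"
  by (induction w) auto

lemma bval_counter: "bval (counter w i) = i"
  by (simp add: counter_def bval_binc_pow)

lemma length_counter: "i < 2 ^ w \<Longrightarrow> length (counter w i) = w"
  by (simp add: counter_def length_binc_pow)

lemma counter_bval: "length bs = w \<Longrightarrow> counter w (bval bs) = bs"
  using bval_less[of bs] by (intro bval_inject) (auto simp: bval_counter length_counter)

definition all_bits :: "nat \<Rightarrow> bool list list" where
  "all_bits r = map (counter r) [0..<2 ^ r]"

lemma set_all_bits: "set (all_bits r) = {bs. length bs = r}"
proof (intro equalityI subsetI)
  fix bs :: "bool list" assume "bs \<in> {bs. length bs = r}"
  then have "bs = counter r (bval bs)" "bval bs < 2 ^ r"
    using counter_bval[of bs r] bval_less[of bs] by auto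
  then show "bs \<in> set (all_bits r)" unfolding all_bits_def by (metis atLeast0LessThan imageI lessThan_iff set_map set_upt)
qed (auto simp: all_bits_def length_counter)

lemma length_all_bits: "length (all_bits r) = 2 ^ r"
  by (simp add: all_bits_def)

section \<open>Parameters and the numbering of variables\<close>

definition bit_length :: "nat \<Rightarrow> nat" where
  "bit_length n = length (binary n)"

text \<open>The number of digits that suffices for a block number or a bit number below
  \<open>addr_width n\<close>.\<close>

definition field_width :: "nat \<Rightarrow> nat" where
  "field_width n = bit_length (bit_length n)"

text \<open>With r and w for the two widths, the index of a block variable has r + 2w + 2 binary
  digits: j, the bit b, two fields of width w and a leading one. If r > 0, n has r + 2w + 3 digits,
  so all indices lie below n. As 2^w is of order \<open>bit_length n\<close>, 2^r falls short of n
  by a polylogarithmic factor only.\<close>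

definition addr_width :: "nat \<Rightarrow> nat" where
  "addr_width n = bit_length n - (3 + 2 * field_width n)"

lemma addr_width_le: "addr_width n < 2 ^ field_width n"
proof -
  have "addr_width n \<le> bit_length n" by (simp add: addr_width_def)
  also have "\<dots> < 2 ^ field_width n" unfolding field_width_def bit_length_def by (rule length_binary_bounds(2))
  finally show ?thesis .
qed

text \<open>Variables are numbered by their binary expansions: \<open>fvar z\<close> is the entry of the truth table
  at \<open>z\<close>, and \<open>xvar w ((i, b), j, t)\<close> is bit \<open>t\<close> of the value at position \<open>j\<close> of block \<open>(i, b)\<close>.\<close>

definition fvar :: "bool list \<Rightarrow> nat" where
  "fvar z = bval (z @ [True])"

definition xvar :: "nat \<Rightarrow> (nat \<times> bool) \<times> bool list \<times> nat \<Rightarrow> nat" where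
  "xvar w = (\<lambda>((i, b), j, t). bval ((j @ [b] @ counter w i @ counter w t) @ [True]))"

definition xvars :: "nat \<Rightarrow> ((nat \<times> bool) \<times> bool list \<times> nat) set" where
  "xvars r = {((i, b), j, t) | i b j t. i < r \<and> length j = r \<and> 1 \<le> t \<and> t < r}"

lemma inj_fvar: "inj fvar"
  by (rule injI) (metis fvar_def binary_bval_True butlast_snoc)

text \<open>The final \<open>True\<close> is a leading one and protects the zeros before it. The
  digits of an index are thus its fields verbatim, and the transducer can print them straight from
  its tapes.\<close>

lemma binary_fvar: "binary (fvar z) = z @ [True]"
  by (simp only: fvar_def binary_bval_True)

lemma binary_xvar: "binary (xvar w ((i, b), j, t)) = j @ [b] @ counter w i @ counter w t @ [True]"
  using binary_bval_True[of "j @ [b] @ counter w i @ counter w t"] by (simp add: xvar_def)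

lemma inj_xvar:
  assumes "r \<le> 2 ^ w"
  shows "inj_on (xvar w) (xvars r)"
proof (rule inj_onI)
  fix v v' assume v: "v \<in> xvars r" "v' \<in> xvars r" "xvar w v = xvar w v'"
  obtain i b j t where vi: "v = ((i, b), j, t)" "i < r" "length j = r" "t < r"
    using v(1) by (auto simp: xvars_def)
  obtain i' b' j' t' where vi': "v' = ((i', b'), j', t')" "i' < r" "length j' = r" "t' < r"
    using v(2) by (auto simp: xvars_def)
  have "j @ [b] @ counter w i @ counter w t @ [True] = j' @ [b'] @ counter w i' @ counter w t' @ [True]"
    using v(3) vi(1) vi'(1) by (metis binary_xvar)
  moreover have "length (counter w i) = length (counter w i')"
    using vi vi' assms by (simp add: length_counter)
  ultimately have "j = j'" "b = b'" "counter w i = counter w i'" "counter w t = counter w t'"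
    using vi vi' by auto
  moreover from this have "i = i'" "t = t'" by (metis bval_counter)+
  ultimately show "v = v'" using vi(1) vi'(1) by simp
qed

text \<open>The two kinds of index have expansions of different lengths.\<close>

lemma fvar_neq_xvar:
  assumes "length z = r" "v \<in> xvars r"
  shows "fvar z \<noteq> xvar w v"
proof
  obtain i b j t where v: "v = ((i, b), j, t)" "length j = r" using assms(2) by (auto simp: xvars_def)
  assume "fvar z = xvar w v"
  then have "length (binary (fvar z)) = length (binary (xvar w v))" by simp
  then show False using assms(1) v by (simp add: binary_fvar binary_xvar)
qed

lemma index_bounds:
  assumes "addr_width n \<ge> 2"
  shows "length z = addr_width n \<Longrightarrow> fvar z < n"
    and "v \<in> xvars (addr_width n) \<Longrightarrow> xvar (field_width n) v < n"
proof -
  define r w where "r = addr_width n" and "w = field_width n"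
  have "n > 0" using assms by (cases n) (auto simp: addr_width_def bit_length_def)
  then have "2 ^ length (binary n) \<le> 2 * n" by (rule length_binary_bounds(1))
  moreover have "length (binary n) = Suc (r + 2 * w + 2)"
    using assms by (simp add: r_def w_def addr_width_def bit_length_def)
  ultimately have n: "2 ^ (r + 2 * w + 2) \<le> n" by simp
  have le: "bval bs < n" if "length bs \<le> r + 2 * w + 2" for bs
  proof -
    have "bval bs < 2 ^ length bs" by (rule bval_less)
    also have "\<dots> \<le> 2 ^ (r + 2 * w + 2)" using that by (rule power_increasing) simp
    finally show ?thesis using n by linarith
  qed
  show "length z = addr_width n \<Longrightarrow> fvar z < n" unfolding fvar_def by (rule le) (simp add: r_def)
  assume "v \<in> xvars (addr_width n)"
  then obtain i b j t where v: "v = ((i, b), j, t)" "i < r" "length j = r" "t < r"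
    by (auto simp: xvars_def r_def)
  have rw: "r < 2 ^ w" unfolding r_def w_def by (rule addr_width_le)
  show "xvar (field_width n) v < n"
    unfolding v xvar_def split w_def[symmetric]
    by (rule le) (use v rw in \<open>simp add: length_counter\<close>)
qed

text \<open>Bit \<open>0\<close> of \<open>u\<close> is ignored: this makes twice as many positions \<open>j\<close> as values, without which
  the erased position would not be hidden.\<close>

definition cell_formula :: "nat \<Rightarrow> nat \<Rightarrow> nat \<times> bool \<Rightarrow> bool list \<Rightarrow> bool list \<Rightarrow> uformula" where
  "cell_formula r w ib u j =
     UAnd (map (\<lambda>t. ULeaf ((if u ! t then Pos else Neg) (xvar w (ib, j, t)))) [1..<r])"

definition value_formula :: "nat \<Rightarrow> nat \<Rightarrow> nat \<times> bool \<Rightarrow> bool list \<Rightarrow> uformula" where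
  "value_formula r w ib u = UOr (map (cell_formula r w ib u) (all_bits r))"

text \<open>The conjunctions over i and over u are merged into the gate that tests the table entry;
  this saves the levels that would exceed depth four.\<close>

definition row_formula :: "nat \<Rightarrow> nat \<Rightarrow> bool list \<Rightarrow> uformula" where
  "row_formula r w z = UAnd (ULeaf (Pos (fvar z)) #
     concat (map (\<lambda>i. map (value_formula r w (i, z ! i)) (all_bits r)) [0..<r]))"

text \<open>For addresses of fewer than two bits a cell would be a gate without children, which
  \<open>uformula_over\<close> forbids; a single literal takes the place of the formula.\<close>

definition hard_formula :: "nat \<Rightarrow> uformula" where
  "hard_formula n =
     (if 2 \<le> addr_width n then UOr (map (row_formula (addr_width n) (field_width n)) (all_bits (addr_width n)))
      else ULeaf (Pos 0))"

lemma all_bits_nonempty: "all_bits r \<noteq> []"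
  using length_all_bits[of r] by (metis list.size(3) power_not_zero zero_neq_numeral)

lemma foldr_max_le: "(\<And>x. x \<in> set xs \<Longrightarrow> x \<le> k) \<Longrightarrow> foldr max xs 0 \<le> (k :: nat)"
  by (induction xs) auto

lemma hard_formula_depth: "uformula_depth (hard_formula n) \<le> 4"
proof -
  have 1: "uformula_depth (cell_formula r w ib u j) \<le> 1" for r w ib u j
  proof -
    have "foldr max (map uformula_depth
        (map (\<lambda>t. ULeaf ((if u ! t then Pos else Neg) (xvar w (ib, j, t)))) [1..<r])) 0 \<le> 0"
      by (rule foldr_max_le) auto
    then show ?thesis by (simp add: cell_formula_def)
  qed
  have 2: "uformula_depth (value_formula r w ib u) \<le> 2" for r w ib u
  proof -
    have "foldr max (map uformula_depth (map (cell_formula r w ib u) (all_bits r))) 0 \<le> 1"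
      by (rule foldr_max_le) (auto intro: 1[simplified])
    then show ?thesis by (simp add: value_formula_def)
  qed
  have 3: "uformula_depth (row_formula r w z) \<le> 3" for r w z
  proof -
    have "foldr max (map uformula_depth (ULeaf (Pos (fvar z)) #
     concat (map (\<lambda>i. map (value_formula r w (i, z ! i)) (all_bits r)) [0..<r]))) 0 \<le> 2"
      by (rule foldr_max_le) (auto intro: 2)
    then show ?thesis by (simp add: row_formula_def)
  qed
  have "foldr max (map uformula_depth (map (row_formula r w) zs)) 0 \<le> 3" for r w zs
    by (rule foldr_max_le) (auto intro: 3)
  then show ?thesis by (simp add: hard_formula_def)
qed

lemma hard_formula_over:
  assumes "n \<ge> 1"
  shows "uformula_over n (hard_formula n)"
proof (cases "addr_width n \<ge> 2")
  case True
  have "uformula_over n (row_formula (addr_width n) (field_width n) z)" if "length z = addr_width n" for z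
  proof -
    have "xvar (field_width n) ((i, b), j, t) < n" if "i < addr_width n" "length j = addr_width n" "1 \<le> t" "t < addr_width n" for i b j t
      using that by (intro index_bounds(2)[OF True]) (auto simp: xvars_def)
    then show ?thesis
      using True that index_bounds(1)[OF True that] all_bits_nonempty
      by (auto simp: row_formula_def value_formula_def cell_formula_def set_all_bits)
  qed
  then show ?thesis using True all_bits_nonempty by (auto simp: hard_formula_def set_all_bits)
next
  case False
  then show ?thesis using assms by (simp add: hard_formula_def)
qed

lemma sum_list_concat: "sum_list (concat xss) = sum_list (map sum_list xss)"
  for xss :: "nat list list"
  by (induction xss) auto

text \<open>There are 2^r rows of r blocks, each with 2^r values, 2^r positions and fewer than r
  bits. As r < 2^w, this is at most 2^(3r + 2w + 1), and the cube of n is at least 2^(3(r + 2w +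
  2)).\<close>

lemma hard_formula_size:
  assumes "n \<ge> 1"
  shows "uformula_size (hard_formula n) \<le> n ^ 3"
proof (cases "addr_width n \<ge> 2")
  case True
  define r w where "r = addr_width n" and "w = field_width n"
  have 1: "uformula_size (cell_formula r w ib u j) \<le> r" for ib u j
    by (simp add: cell_formula_def comp_def sum_list_triv)
  have 2: "uformula_size (value_formula r w ib u) \<le> 2 ^ r * r" for ib u
  proof -
    have "uformula_size (value_formula r w ib u) \<le> sum_list (map (\<lambda>_. r) (all_bits r))"
      unfolding value_formula_def uformula_size.simps map_map
      by (rule sum_list_mono) (use 1 in simp)
    then show ?thesis by (simp add: sum_list_triv length_all_bits)
  qed
  have 3: "uformula_size (row_formula r w z) \<le> 1 + r * (2 ^ r * (2 ^ r * r))" for z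
  proof -
    have "sum_list (map uformula_size (concat (map (\<lambda>i. map (value_formula r w (i, z ! i)) (all_bits r)) [0..<r])))
        = sum_list (map (\<lambda>i. sum_list (map (\<lambda>u. uformula_size (value_formula r w (i, z ! i) u)) (all_bits r))) [0..<r])"
      by (simp add: map_concat comp_def sum_list_concat)
    also have "\<dots> \<le> sum_list (map (\<lambda>i. sum_list (map (\<lambda>u. 2 ^ r * r) (all_bits r))) [0..<r])"
      by (intro sum_list_mono 2)
    also have "\<dots> = r * (2 ^ r * (2 ^ r * r))" by (simp add: sum_list_triv length_all_bits)
    finally show ?thesis by (simp add: row_formula_def)
  qed
  have rw: "r < 2 ^ w" unfolding r_def w_def by (rule addr_width_le)
  have "n > 0" using assms by simp
  then have "2 ^ length (binary n) \<le> 2 * n" by (rule length_binary_bounds(1))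
  moreover have "length (binary n) = Suc (r + 2 * w + 2)"
    using True by (simp add: r_def w_def addr_width_def bit_length_def)
  ultimately have n: "2 ^ (r + 2 * w + 2) \<le> n" by simp
  have "uformula_size (hard_formula n) = sum_list (map (\<lambda>z. uformula_size (row_formula r w z)) (all_bits r))"
    using True by (simp add: hard_formula_def r_def w_def comp_def)
  also have "\<dots> \<le> sum_list (map (\<lambda>z. 1 + r * (2 ^ r * (2 ^ r * r))) (all_bits r))"
    by (intro sum_list_mono 3)
  also have "\<dots> = 2 ^ r * (1 + r * (2 ^ r * (2 ^ r * r)))" by (simp add: sum_list_triv length_all_bits)
  also have "\<dots> \<le> 2 ^ r * (2 * (2 ^ w * (2 ^ r * (2 ^ r * 2 ^ w))))"
  proof (rule mult_left_mono)
    have "r * (2 ^ r * (2 ^ r * r)) \<le> 2 ^ w * (2 ^ r * (2 ^ r * 2 ^ w))" using rw by (intro mult_mono) auto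
    moreover have "(1 :: nat) \<le> 2 ^ w * (2 ^ r * (2 ^ r * 2 ^ w))" by simp
    ultimately show "1 + r * (2 ^ r * (2 ^ r * r)) \<le> 2 * (2 ^ w * (2 ^ r * (2 ^ r * 2 ^ w)))" by linarith
  qed simp
  also have "\<dots> = 2 ^ (r + (1 + (w + (r + (r + w)))))" by (simp only: power_add power_one_right)
  also have "\<dots> \<le> 2 ^ ((r + 2 * w + 2) * 3)" by (rule power_increasing) auto
  also have "\<dots> = (2 ^ (r + 2 * w + 2)) ^ 3" by (rule power_mult)
  also have "\<dots> \<le> n ^ 3" using n by (rule power_mono) simp
  finally show ?thesis .
next
  case False
  then show ?thesis using assms by (simp add: hard_formula_def)
qed

section \<open>From De Morgan formulas to table functions\<close>

primrec translate :: "(nat \<Rightarrow> 'v fm) \<Rightarrow> formula \<Rightarrow> 'v fm" where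
  "translate \<sigma> (Leaf l) = (case l of Pos k \<Rightarrow> \<sigma> k | Neg k \<Rightarrow> negate (\<sigma> k))"
| "translate \<sigma> (And F G) = Gate True (translate \<sigma> F) (translate \<sigma> G)"
| "translate \<sigma> (Or F G) = Gate False (translate \<sigma> F) (translate \<sigma> G)"

lemma ev_translate:
  "formula_over n F \<Longrightarrow> ev (translate \<sigma> F) \<xi> = formula_eval F (map (\<lambda>k. ev (\<sigma> k) \<xi>) [0..<n])"
  by (induction F) (auto split: literal.split)

lemma leaves_translate: "(\<And>k. leaves (\<sigma> k) \<le> 1) \<Longrightarrow> leaves (translate \<sigma> F) \<le> formula_size F"
  by (induction F) (auto split: literal.split intro: add_mono)

lemma vars_translate: "(\<And>k. vars (\<sigma> k) \<subseteq> X) \<Longrightarrow> vars (translate \<sigma> F) \<subseteq> X"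
  by (induction F) (auto split: literal.split)

lemma finite_support_expressible:
  assumes "finite I" "\<And>y y'. (\<And>i. i \<in> I \<Longrightarrow> y i = y' i) \<Longrightarrow> \<phi> y = \<phi> y'"
  shows "\<phi> \<in> range ev"
  using assms
proof (induction I arbitrary: \<phi> rule: finite_induct)
  case empty
  have "\<phi> = ev (Const (\<phi> (\<lambda>_. False)))"
  proof
    fix y
    have "\<phi> y = \<phi> (\<lambda>_. False)" by (rule empty) simp
    then show "\<phi> y = ev (Const (\<phi> (\<lambda>_. False))) y" by simp
  qed
  then show ?case by (rule range_eqI)
next
  case (insert i I)
  have "(\<lambda>y. \<phi> (y(i := b))) \<in> range ev" for b
    by (rule insert.IH) (rule insert.prems, auto)
  then have "\<exists>G. (\<lambda>y. \<phi> (y(i := b))) = ev G" for b unfolding image_iff by blast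
  then obtain G where G: "\<And>b. (\<lambda>y. \<phi> (y(i := b))) = ev (G b)" by metis
  \<comment> \<open>Shannon expansion in the variable i.\<close>
  have "\<phi> = ev (Gate False (Gate True (Lit True i) (G True)) (Gate True (Lit False i) (G False)))"
  proof
    fix y
    have "\<phi> y = \<phi> (y(i := y i))" by simp
    then show "\<phi> y = ev (Gate False (Gate True (Lit True i) (G True)) (Gate True (Lit False i) (G False))) y"
      using fun_cong[OF G[of "y i"], of y] by (cases "y i") auto
  qed
  then show ?case by (rule range_eqI)
qed

text \<open>What a projection leaves of the hard function with table A: the value of
  \<open>Surj\<close> on block (i, b) has become the variable y (i, b).\<close>

definition table_function :: "nat \<Rightarrow> bool list set \<Rightarrow> (nat \<times> bool \<Rightarrow> bool) \<Rightarrow> bool" where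
  "table_function r A y \<longleftrightarrow> (\<exists>z. length z = r \<and> z \<in> A \<and> (\<forall>i<r. y (i, z ! i)))"

text \<open>On inputs in which exactly one of y (i, True), y (i, False) holds, the table can be read
  off. Hence different tables give different functions, although all of these are monotone.\<close>

lemma table_function_dual_rail:
  assumes "length z = r"
  shows "table_function r A (\<lambda>(i, b). z ! i = b) \<longleftrightarrow> z \<in> A"
proof -
  have "z' = z" if "length z' = r" "\<forall>i<r. z ! i = z' ! i" for z'
    using that assms by (intro nth_equalityI) auto
  then show ?thesis using assms by (auto simp: table_function_def)
qed

text \<open>Shannon's counting argument in contrapositive form: the 2^(2^r) different table
  functions must fit among the formulas of at most s leaves over 2r variables.\<close>

lemma exists_hard_table:
  fixes s :: nat
  assumes "\<And>A. cost (table_function r A) \<le> s"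
  shows "2 ^ r \<le> (r + 2) * (2 * s + 1)"
proof -
  let ?I = "{..<r} \<times> (UNIV :: bool set)"
  let ?B = "{z :: bool list. length z = r}"
  let ?\<Phi> = "table_function r ` Pow ?B"
  have B: "finite ?B" "card ?B = 2 ^ r"
    using finite_lists_length_eq[of "UNIV :: bool set" r] card_lists_length_eq[of "UNIV :: bool set" r] by auto
  have I: "card ?I = 2 * r" by (simp add: card_cartesian_product)
  have loc: "table_function r A y = table_function r A y'" if "\<And>i. i \<in> ?I \<Longrightarrow> y i = y' i" for A y y'
    using that by (auto simp: table_function_def)
  have inj: "inj_on (table_function r) (Pow ?B)"
  proof (rule inj_onI)
    fix A A' assume A: "A \<in> Pow ?B" "A' \<in> Pow ?B" "table_function r A = table_function r A'"
    have "z \<in> A \<longleftrightarrow> z \<in> A'" if "length z = r" for z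
      using table_function_dual_rail[OF that, of A] table_function_dual_rail[OF that, of A'] A(3) by simp
    then show "A = A'" using A(1,2) by blast
  qed
  have "card ?\<Phi> = 2 ^ 2 ^ r" using card_image[OF inj] B by (simp add: card_Pow)
  moreover have "card ?\<Phi> \<le> 2 + (2 * card ?I + 3) ^ (2 * s)"
  proof (rule card_low_cost)
    show "finite ?I" by simp
    show "\<phi> \<in> range ev \<and> cost \<phi> \<le> s" if \<phi>: "\<phi> \<in> ?\<Phi>" for \<phi>
    proof -
      obtain A where A: "\<phi> = table_function r A" using \<phi> by blast
      have "\<phi> \<in> range ev" unfolding A
        by (rule finite_support_expressible[of ?I], simp, rule loc, simp)
      then show ?thesis using assms A by simp
    qed
    show "\<phi> y = \<phi> y'" if \<phi>: "\<phi> \<in> ?\<Phi>" and y: "\<And>i. i \<in> ?I \<Longrightarrow> y i = y' i" for \<phi> y y'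
    proof -
      obtain A where "\<phi> = table_function r A" using \<phi> by blast
      then show ?thesis using loc[OF y] by simp
    qed
  qed
  ultimately have "2 ^ 2 ^ r \<le> 2 + (4 * r + 3) ^ (2 * s)" by (simp add: I)
  also have "\<dots> \<le> (4 * r + 3) ^ (2 * s + 1)"
  proof -
    have "(1 :: nat) \<le> (4 * r + 3) ^ (2 * s)" by simp
    moreover have "(4 * r + 3) ^ (2 * s) * 3 \<le> (4 * r + 3) ^ (2 * s) * (4 * r + 3)"
      by (intro mult_left_mono) auto
    ultimately show ?thesis unfolding power_add power_one_right by linarith
  qed
  also have "\<dots> \<le> (2 ^ (r + 2)) ^ (2 * s + 1)"
  proof (rule power_mono)
    have "Suc r \<le> 2 ^ r" by (rule Suc_leI) (rule less_exp)
    then show "4 * r + 3 \<le> (2 :: nat) ^ (r + 2)" unfolding power_add by simp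
  qed simp
  also have "\<dots> = 2 ^ ((r + 2) * (2 * s + 1))" by (rule power_mult[symmetric])
  finally show ?thesis by (rule power_le_imp_le_exp[rotated]) simp
qed

context
  fixes n r w :: nat and F :: formula and A :: "bool list set"
  assumes r_def: "r = addr_width n" and w_def: "w = field_width n" and r2: "r \<ge> 2"
begin

text \<open>Fixes the truth table to A and keeps the block variables. Indices that number no
  variable of the formula are set to false.\<close>

definition assign :: "nat \<Rightarrow> ((nat \<times> bool) \<times> bool list \<times> nat) fm" where
  "assign k = (if k \<in> fvar ` {z. length z = r} then Const (inv fvar k \<in> A)
     else if k \<in> xvar w ` xvars r then Lit True (inv_into (xvars r) (xvar w) k) else Const False)"

lemma addr_width_le_pow: "r \<le> 2 ^ w"
  using addr_width_le[of n] by (simp add: r_def w_def)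

lemma assign_fvar: "length z = r \<Longrightarrow> assign (fvar z) = Const (z \<in> A)"
  by (auto simp: assign_def inv_f_f[OF inj_fvar])

lemma assign_xvar: "v \<in> xvars r \<Longrightarrow> assign (xvar w v) = Lit True v"
  using fvar_neq_xvar[of _ r v w] inv_into_f_f[OF inj_xvar[OF addr_width_le_pow]] by (auto simp: assign_def dest: sym)

lemma vars_assign: "vars (assign k) \<subseteq> xvars r"
  by (auto simp: assign_def inv_into_into)

lemma leaves_assign: "leaves (assign k) \<le> 1"
  by (simp add: assign_def)

lemma eval_assigned:
  fixes \<xi> :: "(nat \<times> bool) \<times> bool list \<times> nat \<Rightarrow> bool"
  defines "x \<equiv> map (\<lambda>k. ev (assign k) \<xi>) [0..<n]"
  shows "uformula_eval (hard_formula n) x \<longleftrightarrow>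
     (\<exists>z. length z = r \<and> z \<in> A \<and> (\<forall>i<r. \<forall>u. length u = r \<longrightarrow>
        (\<exists>j. length j = r \<and> (\<forall>t\<in>{1..<r}. \<xi> ((i, z ! i), j, t) = u ! t))))"
proof -
  have n2: "addr_width n \<ge> 2" using r2 r_def by simp
  have f: "x ! fvar z = (z \<in> A)" if "length z = r" for z
  proof -
    have "fvar z < n" using index_bounds(1)[OF n2] that r_def by simp
    then show ?thesis by (simp add: x_def assign_fvar[OF that])
  qed
  have xx: "x ! xvar w v = \<xi> v" if "v \<in> xvars r" for v
  proof -
    have "xvar w v < n" using index_bounds(2)[OF n2] that r_def w_def by simp
    then show ?thesis by (simp add: x_def assign_xvar[OF that])
  qed
  have cell: "uformula_eval (cell_formula r w (i, b) u j) x \<longleftrightarrow> (\<forall>t\<in>{1..<r}. \<xi> ((i, b), j, t) = u ! t)"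
    if "i < r" "length j = r" for i b u j
  proof -
    have "x ! xvar w ((i, b), j, t) = \<xi> ((i, b), j, t)" if "t \<in> {1..<r}" for t
      using that \<open>i < r\<close> \<open>length j = r\<close> by (intro xx) (auto simp: xvars_def)
    then show ?thesis by (auto simp: cell_formula_def)
  qed
  have valf: "uformula_eval (value_formula r w (i, b) u) x \<longleftrightarrow>
      (\<exists>j. length j = r \<and> (\<forall>t\<in>{1..<r}. \<xi> ((i, b), j, t) = u ! t))" if "i < r" for i b u
    using cell[OF that] by (auto simp: value_formula_def set_all_bits)
  have row: "uformula_eval (row_formula r w z) x \<longleftrightarrow> z \<in> A \<and> (\<forall>i<r. \<forall>u. length u = r \<longrightarrow>
        (\<exists>j. length j = r \<and> (\<forall>t\<in>{1..<r}. \<xi> ((i, z ! i), j, t) = u ! t)))" if "length z = r" for z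
    using valf f[OF that] by (auto simp: row_formula_def set_all_bits)
  show ?thesis using n2 row by (auto simp: hard_formula_def r_def[symmetric] w_def[symmetric] set_all_bits)
qed

text \<open>The table is substituted into F, the result is balanced to height 3t, and
  \<open>composition_cost\<close> is applied with 2r blocks, 2^r positions and 2^(r-1)
  values.\<close>

lemma table_cost:
  fixes c \<epsilon> :: real
  assumes F: "formula_computes n F (uformula_eval (hard_formula n))"
    and c: "c \<ge> 3" "\<epsilon> > 0" "c powr \<epsilon> = 2" and t: "formula_size F \<le> (c / (c - 1)) ^ t" "t \<ge> 1"
  shows "real (cost (table_function r A))
     \<le> 3 * (2 + 16 * (4 * r / (2 ^ (r - 1) - 1))\<^sup>2 * (3 * real t) ^ 3 * formula_size F powr (1 + \<epsilon>))"
proof -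
  define G where "G = translate assign F"
  have over: "formula_over n F" using F by (simp add: formula_computes_def)
  have lG: "leaves G \<le> formula_size F" unfolding G_def by (rule leaves_translate[OF leaves_assign])
  have "leaves G \<le> (c / (c - 1)) ^ t" using lG t(1) by simp
  then obtain H where H: "ev H = ev G" "vars H \<subseteq> vars G" "height H \<le> 3 * t" "leaves H \<le> leaves G powr (1 + \<epsilon>)"
    using balance[OF c] by blast
  let ?J = "{j :: bool list. length j = r}" and ?V = "{u :: bool list. length u = r - 1}"
  let ?I = "{..<r} \<times> (UNIV :: bool set)"
  have cJ: "finite ?J" "card ?J = 2 ^ r" and cV: "finite ?V" "card ?V = 2 ^ (r - 1)"
    using finite_lists_length_eq[of "UNIV :: bool set"] card_lists_length_eq[of "UNIV :: bool set"] by auto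
  have p2: "2 ^ r = 2 * (2 :: nat) ^ (r - 1)" using r2 by (cases r) auto
  have p1: "(2 :: nat) ^ (r - 1) \<ge> 2" using r2 by (cases "r - 1") auto
  \<comment> \<open>Values have only r - 1 bits because bit 0 is ignored, which gives the required
    factor 2 between positions and values. Bit t of a block variable is therefore entry t - 1 of a
    value.\<close>
  interpret surjectivity ?J ?V "replicate (r - 1) False"
    by unfold_locales (use cJ cV p1 p2 in auto)
  have I: "finite ?I" "card ?I = 2 * r" by (auto simp: card_cartesian_product)
  have "real (cost (table_function r A))
     \<le> 3 * (2 + 16 * (2 * card ?I / (real (card ?V) - 1))\<^sup>2 * real (3 * t) ^ 3 * leaves H)"
  proof (rule composition_cost[where bit = "\<lambda>u t. u ! (t - 1)"])
    show "finite ?I" "1 \<le> card ?I" "1 \<le> 3 * t" "height H \<le> 3 * t" using I r2 t(2) H(3) by auto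
    have "vars H \<subseteq> xvars r" 
      using H(2) vars_translate[of assign "xvars r" F, OF vars_assign] unfolding G_def by blast
    then show "fst ` vars H \<subseteq> ?I" by (force simp: xvars_def)
    fix \<pi> assume \<pi>: "\<pi> \<in> (\<Pi>\<^sub>E i\<in>?I. edges)"
    show "(\<lambda>y. ev H (\<lambda>(i, j, t). (if y i then snd (\<pi> i) else fst (\<pi> i)) j ! (t - 1))) = table_function r A"
    proof
      fix y :: "nat \<times> bool \<Rightarrow> bool"
      define p where "p i = (if y i then snd (\<pi> i) else fst (\<pi> i))" for i
      define \<xi> where "\<xi> = (\<lambda>(i, j, t). p i j ! (t - 1))"
      have pV: "length (p (i, b) j) = r - 1" if "i < r" "length j = r" for i b j
      proof -
        have "\<pi> (i, b) \<in> edges" using \<pi> that by auto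
        then have "fst (\<pi> (i, b)) \<in> missing" "snd (\<pi> (i, b)) \<in> full"
          using edges_points[of "fst (\<pi> (i, b))" "snd (\<pi> (i, b))"] by auto
        then have "fst (\<pi> (i, b)) \<in> ?J \<rightarrow>\<^sub>E ?V" "snd (\<pi> (i, b)) \<in> ?J \<rightarrow>\<^sub>E ?V"
          by (auto intro!: points_PiE simp only: Un_iff)
        then have "p (i, b) \<in> ?J \<rightarrow>\<^sub>E ?V" 
          unfolding p_def by (cases "y (i, b)") (simp_all only: if_True if_False)
        then show ?thesis using that by auto
      qed
      have onto: "(\<forall>u\<in>?V. \<exists>j\<in>?J. p (i, b) j = u) \<longleftrightarrow> y (i, b)" if "i < r" for i b
      proof -
        have "\<pi> (i, b) \<in> edges" using \<pi> that by auto
        then have e: "fst (\<pi> (i, b)) \<in> missing" "snd (\<pi> (i, b)) \<in> full"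
          using edges_points[of "fst (\<pi> (i, b))" "snd (\<pi> (i, b))"] by auto
        show ?thesis
        proof (cases "y (i, b)")
          case True
          then show ?thesis using full_onto[OF e(2)] by (simp add: p_def)
        next
          case False
          then show ?thesis using missing_not_onto[OF e(1)] by (auto simp: p_def)
        qed
      qed
      have val: "(\<forall>u. length u = r \<longrightarrow> (\<exists>j. length j = r \<and> (\<forall>t\<in>{1..<r}. \<xi> ((i, b), j, t) = u ! t)))
          \<longleftrightarrow> y (i, b)" if i: "i < r" for i b
      proof -
        \<comment> \<open>The head a is the ignored bit 0, so asking for all u of length r is the
          same as asking for all tails of length r - 1.\<close>
        have eq: "(\<forall>t\<in>{1..<r}. \<xi> ((i, b), j, t) = (a # u) ! t) \<longleftrightarrow> p (i, b) j = u"
          if "length u = r - 1" "length j = r" for a u j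
        proof -
          have "(\<forall>t\<in>{1..<r}. \<xi> ((i, b), j, t) = (a # u) ! t) \<longleftrightarrow> (\<forall>t<r - 1. p (i, b) j ! t = u ! t)"
          proof
            assume h: "\<forall>t\<in>{1..<r}. \<xi> ((i, b), j, t) = (a # u) ! t"
            show "\<forall>t<r - 1. p (i, b) j ! t = u ! t"
            proof (intro allI impI)
              fix t assume "t < r - 1"
              then have "Suc t \<in> {1..<r}" by auto
              from bspec[OF h this] show "p (i, b) j ! t = u ! t" by (simp add: \<xi>_def)
            qed
          next
            assume h: "\<forall>t<r - 1. p (i, b) j ! t = u ! t"
            show "\<forall>t\<in>{1..<r}. \<xi> ((i, b), j, t) = (a # u) ! t"
            proof
              fix t assume "t \<in> {1..<r}"
              then obtain t' where "t = Suc t'" "t' < r - 1" by (cases t) auto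
              then show "\<xi> ((i, b), j, t) = (a # u) ! t" using h by (simp add: \<xi>_def)
            qed
          qed
          also have "\<dots> \<longleftrightarrow> p (i, b) j = u"
            using pV[OF i that(2), of b] that(1) by (auto simp: list_eq_iff_nth_eq)
          finally show ?thesis .
        qed
        have "(\<forall>u. length u = r \<longrightarrow> (\<exists>j. length j = r \<and> (\<forall>t\<in>{1..<r}. \<xi> ((i, b), j, t) = u ! t)))
            \<longleftrightarrow> (\<forall>u. length u = r - 1 \<longrightarrow> (\<exists>j. length j = r \<and> p (i, b) j = u))"
        proof
          assume h: "\<forall>u. length u = r \<longrightarrow> (\<exists>j. length j = r \<and> (\<forall>t\<in>{1..<r}. \<xi> ((i, b), j, t) = u ! t))"
          show "\<forall>u. length u = r - 1 \<longrightarrow> (\<exists>j. length j = r \<and> p (i, b) j = u)"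
          proof (intro allI impI)
            fix u :: "bool list" assume u: "length u = r - 1"
            then have "length (True # u) = r" using r2 by simp
            then obtain j where "length j = r" "\<forall>t\<in>{1..<r}. \<xi> ((i, b), j, t) = (True # u) ! t" using h by blast
            then show "\<exists>j. length j = r \<and> p (i, b) j = u" using eq[OF u] by blast
          qed
        next
          assume h: "\<forall>u. length u = r - 1 \<longrightarrow> (\<exists>j. length j = r \<and> p (i, b) j = u)"
          show "\<forall>u. length u = r \<longrightarrow> (\<exists>j. length j = r \<and> (\<forall>t\<in>{1..<r}. \<xi> ((i, b), j, t) = u ! t))"
          proof (intro allI impI)
            fix u :: "bool list" assume "length u = r"
            then obtain a u' where u: "u = a # u'" "length u' = r - 1" using r2 by (cases u) auto
            then obtain j where "length j = r" "p (i, b) j = u'" using h by blast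
            then show "\<exists>j. length j = r \<and> (\<forall>t\<in>{1..<r}. \<xi> ((i, b), j, t) = u ! t)"
              using eq[OF u(2)] u(1) by blast
          qed
        qed
        then show ?thesis using onto[OF i, of b] by simp
      qed
      have "ev H \<xi> = formula_eval F (map (\<lambda>k. ev (assign k) \<xi>) [0..<n])"
        unfolding H(1) G_def by (rule ev_translate[OF over])
      also have "\<dots> = uformula_eval (hard_formula n) (map (\<lambda>k. ev (assign k) \<xi>) [0..<n])"
        using F by (simp add: formula_computes_def)
      also have "\<dots> = table_function r A y"
        unfolding eval_assigned table_function_def using val by blast
      finally show "ev H (\<lambda>(i, j, t). (if y i then snd (\<pi> i) else fst (\<pi> i)) j ! (t - 1)) = table_function r A y"
        by (simp add: \<xi>_def p_def)
    qed
  qed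
  also have "\<dots> = 3 * (2 + 16 * (4 * r / (2 ^ (r - 1) - 1))\<^sup>2 * (3 * real t) ^ 3 * leaves H)"
    unfolding I(2) cV(2) by simp
  also have "\<dots> \<le> 3 * (2 + 16 * (4 * r / (2 ^ (r - 1) - 1))\<^sup>2 * (3 * real t) ^ 3 * formula_size F powr (1 + \<epsilon>))"
  proof -
    have "real (leaves H) \<le> formula_size F powr (1 + \<epsilon>)"
      using H(4) lG c(2) by (elim order_trans) (intro powr_mono2, auto)
    then show ?thesis by (intro mult_left_mono add_left_mono) auto
  qed
  finally show ?thesis .
qed

end

subsection \<open>The lower bound\<close>

definition hard_function :: "nat \<Rightarrow> bool list \<Rightarrow> bool" where
  "hard_function n = uformula_eval (hard_formula n)"

text \<open>Supplies some De Morgan formula, so that the \<open>LEAST\<close> in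
  \<open>formula_complexity\<close> is attained.\<close>

lemma bounded_fan_in:
  "uformula_over n U \<Longrightarrow> \<exists>F. formula_over n F \<and> (\<forall>x. formula_eval F x = uformula_eval U x)"
proof (induction U)
  case (ULeaf l)
  then show ?case by (intro exI[of _ "Leaf l"]) simp
next
  case (UAnd Us)
  have "Vs \<noteq> [] \<Longrightarrow> set Vs \<subseteq> set Us \<Longrightarrow>
      \<exists>F. formula_over n F \<and> (\<forall>x. formula_eval F x = (\<forall>V\<in>set Vs. uformula_eval V x))" for Vs
  proof (induction Vs)
    case (Cons V Vs)
    obtain G where G: "formula_over n G" "\<And>x. formula_eval G x = uformula_eval V x"
      using UAnd.IH[of V] UAnd.prems Cons.prems by auto
    show ?case
    proof (cases "Vs = []")
      case True
      then show ?thesis using G by auto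
    next
      case False
      then obtain H where "formula_over n H" "\<And>x. formula_eval H x = (\<forall>V\<in>set Vs. uformula_eval V x)"
        using Cons by auto
      then show ?thesis using G by (intro exI[of _ "And G H"]) auto
    qed
  qed simp
  then show ?case using UAnd.prems by simp
next
  case (UOr Us)
  have "Vs \<noteq> [] \<Longrightarrow> set Vs \<subseteq> set Us \<Longrightarrow>
      \<exists>F. formula_over n F \<and> (\<forall>x. formula_eval F x = (\<exists>V\<in>set Vs. uformula_eval V x))" for Vs
  proof (induction Vs)
    case (Cons V Vs)
    obtain G where G: "formula_over n G" "\<And>x. formula_eval G x = uformula_eval V x"
      using UOr.IH[of V] UOr.prems Cons.prems by auto
    show ?case
    proof (cases "Vs = []")
      case True
      then show ?thesis using G by auto
    next
      case False
      then obtain H where "formula_over n H" "\<And>x. formula_eval H x = (\<exists>V\<in>set Vs. uformula_eval V x)"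
        using Cons by auto
      then show ?thesis using G by (intro exI[of _ "Or G H"]) auto
    qed
  qed simp
  then show ?case using UOr.prems by simp
qed

text \<open>Excludes the convention that constants have complexity 0, which no formula
  attains.\<close>

lemma hard_function_nonconstant:
  assumes "n \<ge> 1"
  shows "\<not> (\<exists>b. \<forall>x. length x = n \<longrightarrow> hard_function n x = b)"
proof (cases "addr_width n \<ge> 2")
  case True
  \<comment> \<open>Position j of every block holds j itself, so all values occur and the function
    depends only on whether the table is empty.\<close>
  let ?\<xi> = "\<lambda>(ib :: nat \<times> bool, j, t). j ! t"
  let ?x = "\<lambda>A. map (\<lambda>k. ev (assign (addr_width n) (field_width n) A k) ?\<xi>) [0..<n]"
  have "\<exists>z :: bool list. length z = addr_width n" by (rule exI[of _ "replicate (addr_width n) True"]) simp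
  then have "hard_function n (?x UNIV)"
    unfolding hard_function_def eval_assigned[OF refl refl True] by auto
  moreover have "\<not> hard_function n (?x {})"
    unfolding hard_function_def eval_assigned[OF refl refl True] by simp
  moreover have "length (?x A) = n" for A by simp
  ultimately show ?thesis by metis
next
  case False
  have "hard_function n (replicate n b) = b" for b
    using False assms by (simp add: hard_function_def hard_formula_def)
  then show ?thesis by (metis length_replicate)
qed

lemma hard_function_optimal_formula:
  assumes "n \<ge> 1"
  shows "\<exists>F. formula_computes n F (hard_function n) \<and> formula_size F = formula_complexity n (hard_function n)"
proof -
  obtain F where "formula_over n F" "\<And>x. formula_eval F x = hard_function n x"
    using bounded_fan_in[OF hard_formula_over[OF assms]] by (auto simp: hard_function_def)
  then have "\<exists>s F. formula_computes n F (hard_function n) \<and> formula_size F = s"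
    by (auto simp: formula_computes_def)
  from LeastI_ex[OF this] show ?thesis
    by (simp only: formula_complexity_def hard_function_nonconstant[OF assms] if_False)
qed

lemma formula_size_pos: "formula_size F \<ge> 1"
  by (induction F) auto

text \<open>Up to powers of l, the hardest table costs 2^r and shrinkage allows at most Y / 4^r,
  whence 8^r is at most Y; and n exceeds 2^r by a factor 32 l^2 at most. The constants are 32768 =
  32^3 and 49152 = 12 * 4096.\<close>

lemma size_lower_bound:
  fixes c \<epsilon> :: real
  assumes r: "addr_width n \<ge> 9" and F: "formula_computes n F (hard_function n)"
    and c: "c \<ge> 3" "\<epsilon> > 0" "c powr \<epsilon> = 2" and t: "formula_size F \<le> (c / (c - 1)) ^ t" "t \<ge> 1"
  shows "real n ^ 3 \<le> 32768 * 49152 * real (bit_length n) ^ 9 * ((3 * real t) ^ 3 * formula_size F powr (1 + \<epsilon>))"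
proof -
  define r where "r = addr_width n"
  define w where "w = field_width n"
  define l where "l = bit_length n"
  define Y where "Y = (3 * real t) ^ 3 * formula_size F powr (1 + \<epsilon>)"
  define X where "X = 16 * (4 * r / (2 ^ (r - 1) - 1))\<^sup>2 * Y"
  have r9: "r \<ge> 9" using r by (simp add: r_def)
  have Y: "Y \<ge> 0" by (simp add: Y_def)
  then have X: "X \<ge> 0" by (simp add: X_def)
  define s where "s = nat \<lfloor>3 * (2 + X)\<rfloor>"
  have "cost (table_function r A) \<le> s" for A
  proof -
    have "real (cost (table_function r A)) \<le> 3 * (2 + X)"
      using table_cost[OF r_def w_def _ F[unfolded hard_function_def] c t, of A] r9
      by (simp add: X_def Y_def mult.assoc)
    then show ?thesis unfolding s_def by (rule le_nat_floor)
  qed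
  then have "2 ^ r \<le> (r + 2) * (2 * s + 1)" by (rule exists_hard_table)
  then have "real (2 ^ r) \<le> real ((r + 2) * (2 * s + 1))" by (rule of_nat_mono)
  then have "2 ^ r \<le> (real r + 2) * (2 * real s + 1)" by (simp add: algebra_simps)
  also have "\<dots> \<le> (real r + 2) * (2 * (3 * (2 + X)) + 1)"
  proof -
    have "real s \<le> 3 * (2 + X)" unfolding s_def using X by simp
    then show ?thesis by (intro mult_left_mono) auto
  qed
  also have "\<dots> = 13 * (real r + 2) + 6 * (real r + 2) * X" by (simp add: algebra_simps)
  finally have a: "2 ^ r \<le> 13 * (real r + 2) + 6 * (real r + 2) * X" .
  \<comment> \<open>Makes the additive term of the estimate at most half of 2^r; r = 9 is the first
    value for which this holds.\<close>
  have "26 * (r + 2) \<le> 2 ^ r" using r9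
  proof (induction r rule: dec_induct)
    case (step k)
    then show ?case by simp
  qed simp
  then have "real (26 * (r + 2)) \<le> real (2 ^ r)" by (rule of_nat_mono)
  then have "26 * (real r + 2) \<le> 2 ^ r" by simp
  moreover define P where "P = (real r + 2) * X"
  ultimately have b: "2 ^ r \<le> 12 * (real r + 2) * X" using a unfolding mult.assoc P_def[symmetric] by linarith
  \<comment> \<open>Replacing 2^(r-1) - 1 by 2^r / 4 gives 16 * 16^2 = 4096.\<close>
  have Xle: "X \<le> 4096 * (real r)\<^sup>2 / (2 ^ r)\<^sup>2 * Y"
  proof -
    have "(2 :: real) ^ r = 2 * 2 ^ (r - 1)" using r9 by (cases r) auto
    moreover have "(2 :: real) ^ (r - 1) \<ge> 2 ^ 1" using r9 by (intro power_increasing) auto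
    ultimately have "2 ^ (r - 1) - 1 \<ge> (2 :: real) ^ r / 4" by simp
    then have "4 * real r / (2 ^ (r - 1) - 1) \<le> 4 * real r / (2 ^ r / 4)"
      by (intro frac_le) auto
    then have "(4 * real r / (2 ^ (r - 1) - 1))\<^sup>2 \<le> (4 * real r / (2 ^ r / 4))\<^sup>2"
      using \<open>2 ^ (r - 1) \<ge> (2 :: real) ^ 1\<close> by (intro power_mono) auto
    then have "X \<le> 16 * (4 * real r / (2 ^ r / 4))\<^sup>2 * Y"
      unfolding X_def using Y by (intro mult_right_mono) auto
    then show ?thesis by (simp add: power_divide power_mult_distrib)
  qed
  have "(2 ^ r) ^ 3 = (2 :: real) ^ r * (2 ^ r)\<^sup>2" by (simp add: power2_eq_square power3_eq_cube)
  also have "\<dots> \<le> 12 * (real r + 2) * (4096 * (real r)\<^sup>2 / (2 ^ r)\<^sup>2 * Y) * (2 ^ r)\<^sup>2"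
    using b Xle by (intro mult_right_mono order_trans[OF b] mult_left_mono) auto
  also have "\<dots> = 49152 * ((real r + 2) * (real r)\<^sup>2) * Y" by simp
  also have "\<dots> \<le> 49152 * real l ^ 3 * Y"
  proof -
    have "r + 2 \<le> l" using r9 by (simp add: r_def l_def addr_width_def)
    then have "(real r + 2) * (real r)\<^sup>2 \<le> real l * (real l)\<^sup>2"
      by (intro mult_mono power_mono) auto
    then show ?thesis using Y by (intro mult_right_mono mult_left_mono) (auto simp: power2_eq_square power3_eq_cube)
  qed
  finally have d: "(2 ^ r) ^ 3 \<le> 49152 * real l ^ 3 * Y" .
  \<comment> \<open>Since 2^w is at most 2l, the factor 2^(3 + 2w) lost in \<open>addr_width\<close>
    is at most 8 (2l)^2 = 32 l^2.\<close>
  have nr: "real n \<le> 32 * (real l)\<^sup>2 * 2 ^ r"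
  proof -
    have l0: "l > 0" using r9 by (auto simp: r_def l_def addr_width_def)
    have "n < 2 ^ l" unfolding l_def bit_length_def by (rule length_binary_bounds(2))
    also have "\<dots> \<le> 2 ^ (r + 3 + 2 * w)" by (intro power_increasing) (auto simp: r_def l_def w_def addr_width_def)
    also have "\<dots> = 8 * (2 ^ w)\<^sup>2 * 2 ^ r" by (simp add: power_add power_mult[symmetric] mult.commute)
    also have "\<dots> \<le> 8 * (2 * l)\<^sup>2 * 2 ^ r"
      using length_binary_bounds(1)[OF l0]
      by (intro mult_right_mono mult_left_mono power_mono) (auto simp: w_def field_width_def l_def bit_length_def)
    finally have "real n \<le> real (8 * (2 * l)\<^sup>2 * 2 ^ r)" by (intro of_nat_mono) simp
    then show ?thesis by (simp add: power_mult_distrib)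
  qed
  have "real n ^ 3 \<le> (32 * (real l)\<^sup>2 * 2 ^ r) ^ 3" using nr by (intro power_mono) auto
  also have "\<dots> = 32768 * real l ^ 6 * (2 ^ r) ^ 3" by (simp add: power_mult_distrib flip: power_mult)
  also have "\<dots> \<le> 32768 * real l ^ 6 * (49152 * real l ^ 3 * Y)" using d by (intro mult_left_mono) auto
  also have "\<dots> = 32768 * 49152 * (real l ^ 6 * real l ^ 3) * Y" by simp
  also have "real l ^ 6 * real l ^ 3 = real l ^ 9" by (simp flip: power_add)
  finally show ?thesis by (simp add: l_def Y_def)
qed

lemma bit_length_le: "n \<ge> 1 \<Longrightarrow> real (bit_length n) \<le> 1 + 2 * ln (real n)"
proof -
  assume n: "n \<ge> 1"
  have "real (2 ^ bit_length n) \<le> real (2 * n)"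
    using length_binary_bounds(1)[of n] n unfolding bit_length_def by (intro of_nat_mono) simp
  then have "ln (2 ^ bit_length n) \<le> ln (2 * real n)" using n by (subst ln_le_cancel_iff) auto
  then have a: "real (bit_length n) * ln 2 \<le> ln 2 + ln (real n)"
    using n by (simp add: ln_realpow ln_mult)
  have l2: "ln (2 :: real) \<ge> 1 / 2" using exp_half_le2 by (subst ln_ge_iff) auto
  have "(real (bit_length n) - 1) * (1 / 2) \<le> ln (real n)"
  proof (cases "bit_length n \<ge> 1")
    case True
    then have "(real (bit_length n) - 1) * (1 / 2) \<le> (real (bit_length n) - 1) * ln 2"
      using l2 by (intro mult_left_mono) auto
    also have "\<dots> \<le> ln (real n)" using a by (simp add: left_diff_distrib)
    finally show ?thesis .
  next
    case False
    moreover have "ln (real n) \<ge> 0" using n by simp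
    ultimately show ?thesis by simp
  qed
  then show ?thesis by simp
qed

lemma eventually_addr_width_ge: "eventually (\<lambda>n. addr_width n \<ge> 9) sequentially"
proof -
  have "eventually (\<lambda>x :: real. 2 ^ 9 * (32 * (1 + 2 * ln x)\<^sup>2) < x) at_top" by real_asymp
  then have "eventually (\<lambda>n. 2 ^ 9 * (32 * (1 + 2 * ln (real n))\<^sup>2) < real n) sequentially"
    by (rule eventually_compose_filterlim[OF _ filterlim_real_sequentially])
  then show ?thesis using eventually_ge_at_top[of 1]
  proof eventually_elim
    case (elim n)
    define l where "l = bit_length n"
    show ?case
    proof (rule ccontr)
      assume "\<not> addr_width n \<ge> 9"
      then have r: "addr_width n \<le> 9" by simp
      have l0: "l > 0" using elim(2) length_binary_bounds(2)[of n] by (auto simp: l_def bit_length_def intro!: Nat.gr0I)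
      have "n < 2 ^ l" unfolding l_def bit_length_def by (rule length_binary_bounds(2))
      also have "\<dots> \<le> 2 ^ (addr_width n + 3 + 2 * field_width n)" by (intro power_increasing) (auto simp: l_def addr_width_def)
      also have "\<dots> = 8 * (2 ^ field_width n)\<^sup>2 * 2 ^ addr_width n" by (simp add: power_add power_mult[symmetric] mult.commute)
      also have "\<dots> \<le> 8 * (2 * l)\<^sup>2 * 2 ^ 9"
        using length_binary_bounds(1)[OF l0] r
        by (intro mult_mono power_mono power_increasing) (auto simp: field_width_def l_def bit_length_def)
      finally have "real n \<le> real (8 * (2 * l)\<^sup>2 * 2 ^ 9)" by (intro of_nat_mono) simp
      also have "\<dots> = 2 ^ 9 * (32 * (real l)\<^sup>2)" by (simp add: power_mult_distrib)
      also have "\<dots> \<le> 2 ^ 9 * (32 * (1 + 2 * ln (real n))\<^sup>2)"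
        using bit_length_le[OF elim(2)] by (intro mult_left_mono power_mono) (auto simp: l_def)
      finally show False using elim(1) by simp
    qed
  qed
qed

lemma hard_function_lower_bound:
  fixes \<delta> :: real
  assumes \<delta>: "0 < \<delta>" "\<delta> \<le> 1"
  shows "eventually (\<lambda>n. real n powr (3 - \<delta>) \<le> formula_complexity n (hard_function n)) sequentially"
proof -
  \<comment> \<open>Then (3 - \<delta>)(1 + \<epsilon>) is at most 3 - \<delta>/2, and the remaining
    gap n^(\<delta>/2) outgrows all logarithms.\<close>
  define \<epsilon> where "\<epsilon> = \<delta> / 6"
  define c where "c = (2 :: real) powr (1 / \<epsilon>)"
  have \<epsilon>: "\<epsilon> > 0" using \<delta> by (simp add: \<epsilon>_def)
  have c2: "c powr \<epsilon> = 2" using \<epsilon> by (simp add: c_def powr_powr)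
  have "2 powr 2 \<le> c" unfolding c_def using \<delta> by (intro powr_mono) (auto simp: \<epsilon>_def field_simps)
  then have c3: "c \<ge> 3" by simp
  have "eventually (\<lambda>x :: real. 32768 * 49152 * (1 + 2 * ln x) ^ 9 *
      ((9 * c * ln x + 6) ^ 3 * x powr (3 - \<delta> / 2)) < x ^ 3) at_top"
    using \<delta> c3 by real_asymp
  then have "eventually (\<lambda>n. 32768 * 49152 * (1 + 2 * ln (real n)) ^ 9 *
      ((9 * c * ln (real n) + 6) ^ 3 * real n powr (3 - \<delta> / 2)) < real n ^ 3) sequentially"
    by (rule eventually_compose_filterlim[OF _ filterlim_real_sequentially])
  then show ?thesis using eventually_ge_at_top[of 1] eventually_addr_width_ge
  proof eventually_elim
    case (elim n)
    show ?case
    proof (rule ccontr)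
      assume small: "\<not> real n powr (3 - \<delta>) \<le> formula_complexity n (hard_function n)"
      obtain F where F: "formula_computes n F (hard_function n)" "formula_size F = formula_complexity n (hard_function n)"
        using hard_function_optimal_formula[OF elim(2)] by blast
      define s where "s = real (formula_size F)"
      have n1: "real n \<ge> 1" using elim(2) by simp
      have ln0: "ln (real n) \<ge> 0" using n1 by simp
      have s: "s \<le> real n powr (3 - \<delta>)" using small F(2) by (simp add: s_def)
      \<comment> \<open>As c/(c - 1) is at least exp(1/c), 3 c ln n rounds suffice for formulas of
        size n^3. \<open>Suc\<close> makes t positive even for n = 1.\<close>
      define t where "t = Suc (nat \<lceil>3 * c * ln (real n)\<rceil>)"
      have t: "real t \<ge> 3 * c * ln (real n)" unfolding t_def by linarith
      have t': "real t \<le> 3 * c * ln (real n) + 2"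
      proof -
        have "3 * c * ln (real n) \<ge> 0" using c3 ln0 by simp
        then show ?thesis unfolding t_def by linarith
      qed
      have "s \<le> (c / (c - 1)) ^ t"
      proof -
        have "s \<le> real n powr 3" using s n1 \<delta> by (elim order_trans) (intro powr_mono, auto)
        also have "\<dots> = exp (3 * ln (real n))" using n1 by (simp add: powr_def)
        also have "\<dots> \<le> exp (real t * (1 / c))" using t c3 by (simp add: field_simps)
        also have "\<dots> = exp (1 / c) ^ t" by (rule exp_of_nat_mult)
        also have "\<dots> \<le> (c / (c - 1)) ^ t"
        proof (rule power_mono)
          have "1 - 1 / c \<le> exp (- (1 / c))" using exp_ge_add_one_self[of "- (1 / c)"] by simp
          then have "1 / exp (- (1 / c)) \<le> 1 / (1 - 1 / c)" using c3 by (intro divide_left_mono) auto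
          also have "1 / (1 - 1 / c) = c / (c - 1)" using c3 by (simp add: field_simps)
          finally show "exp (1 / c) \<le> c / (c - 1)" by (simp add: exp_minus inverse_eq_divide)
        qed simp
        finally show ?thesis .
      qed
      then have "real n ^ 3 \<le> 32768 * 49152 * real (bit_length n) ^ 9 * ((3 * real t) ^ 3 * s powr (1 + \<epsilon>))"
        unfolding s_def by (intro size_lower_bound[OF elim(3) F(1) c3 \<epsilon> c2]) (auto simp: t_def)
      also have "\<dots> \<le> 32768 * 49152 * (1 + 2 * ln (real n)) ^ 9 *
          ((9 * c * ln (real n) + 6) ^ 3 * real n powr (3 - \<delta> / 2))"
      proof (intro mult_mono power_mono)
        show "real (bit_length n) \<le> 1 + 2 * ln (real n)" using bit_length_le elim(2) by simp
        show "3 * real t \<le> 9 * c * ln (real n) + 6" using t' by simp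
        have "s powr (1 + \<epsilon>) \<le> (real n powr (3 - \<delta>)) powr (1 + \<epsilon>)"
          using s \<epsilon> by (intro powr_mono2) (auto simp: s_def)
        also have "\<dots> = real n powr ((3 - \<delta>) * (1 + \<epsilon>))" by (simp add: powr_powr)
        also have "\<dots> \<le> real n powr (3 - \<delta> / 2)"
        proof (intro powr_mono n1)
          have "(3 - \<delta>) * (1 + \<epsilon>) = 3 - \<delta> / 2 - \<delta> * \<epsilon>" by (simp add: \<epsilon>_def field_simps)
          then show "(3 - \<delta>) * (1 + \<epsilon>) \<le> 3 - \<delta> / 2" using \<delta> \<epsilon> by simp
        qed
        finally show "s powr (1 + \<epsilon>) \<le> real n powr (3 - \<delta> / 2)" .
      qed (use ln0 c3 in auto)
      finally show False using elim(1) by simp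
    qed
  qed
qed

lemma hard_function_exponent:
  "\<exists>\<epsilon> :: nat \<Rightarrow> real. \<epsilon> \<in> o(\<lambda>_. 1) \<and>
     (\<forall>n\<ge>1. real n powr (3 - \<epsilon> n) \<le> real (formula_complexity n (hard_function n)))"
proof -
  define L where "L n = real (formula_complexity n (hard_function n))" for n
  \<comment> \<open>The exact deficit of the exponent, cut off at 0. At n = 1 division by ln 1 = 0
    yields 0, so the value is 3, which is harmless because 1 to any power is 1.\<close>
  define \<epsilon> where "\<epsilon> n = max 0 (3 - ln (L n) / ln (real n))" for n
  have L1: "L n \<ge> 1" if n: "n \<ge> 1" for n
  proof -
    obtain F where "formula_size F = formula_complexity n (hard_function n)"
      using hard_function_optimal_formula[OF n] by blast
    then show ?thesis using formula_size_pos[of F] by (simp add: L_def)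
  qed
  have "real n powr (3 - \<epsilon> n) \<le> L n" if n: "n \<ge> 1" for n
  proof (cases "n = 1")
    case True
    then show ?thesis using L1[OF n] by simp
  next
    case False
    then have n2: "real n > 1" using n by simp
    have "real n powr (3 - \<epsilon> n) \<le> real n powr (ln (L n) / ln (real n))"
      using n2 by (intro powr_mono) (auto simp: \<epsilon>_def)
    also have "\<dots> = L n" using n2 L1[OF n] by (simp add: powr_def)
    finally show ?thesis .
  qed
  moreover have "\<epsilon> \<in> o(\<lambda>_. 1)"
  proof (rule smalloI_tendsto)
    have "(\<epsilon> \<longlongrightarrow> 0) sequentially"
    proof (rule tendstoI)
      fix e :: real assume e: "e > 0"
      define \<delta> where "\<delta> = min 1 (e / 2)"
      have \<delta>: "0 < \<delta>" "\<delta> \<le> 1" "\<delta> < e" using e by (auto simp: \<delta>_def)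
      show "eventually (\<lambda>n. dist (\<epsilon> n) 0 < e) sequentially"
        using hard_function_lower_bound[OF \<delta>(1,2)] eventually_ge_at_top[of 2]
      proof eventually_elim
        case (elim n)
        have n: "real n > 1" using elim(2) by simp
        have "ln (real n powr (3 - \<delta>)) \<le> ln (L n)"
          using elim n L1[of n] by (subst ln_le_cancel_iff) (auto simp: L_def)
        then have "(3 - \<delta>) * ln (real n) \<le> ln (L n)" using n by (simp add: ln_powr)
        then have "3 - \<delta> \<le> ln (L n) / ln (real n)" using n by (simp add: pos_le_divide_eq)
        then have "\<epsilon> n \<le> \<delta>" using \<delta> by (simp add: \<epsilon>_def)
        moreover have "\<epsilon> n \<ge> 0" by (simp add: \<epsilon>_def)
        ultimately show ?case using \<delta>(3) by simp
      qed
    qed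
    then show "((\<lambda>n. \<epsilon> n / 1) \<longlongrightarrow> 0) sequentially" by simp
  qed simp
  ultimately show ?thesis unfolding L_def by blast
qed

subsection \<open>Structured programs for transducers\<close>

type_synonym test = "insym \<Rightarrow> nat list \<Rightarrow> bool"
type_synonym 'o act = "move \<times> (nat \<times> move) list \<times> 'o option"

text \<open>A while language over machine steps: \<open>Do\<close> is one transition that depends on
  the scanned symbols, and tests see these symbols only. States appear first in the
  compilation.\<close>

datatype 'o cmd =
    Do "insym \<Rightarrow> nat list \<Rightarrow> 'o act"
  | Seq "'o cmd" "'o cmd" (infixr ";;" 60)
  | Cond test "'o cmd" "'o cmd"
  | While test "'o cmd"

type_synonym 'o store = "nat \<times> ((nat \<Rightarrow> nat) \<times> nat) list \<times> 'o list"

definition scanned :: "((nat \<Rightarrow> nat) \<times> nat) list \<Rightarrow> nat list" where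
  "scanned wk = map (\<lambda>(t, p). t p) wk"

fun do_act :: "bool list \<Rightarrow> 'o act \<Rightarrow> 'o store \<Rightarrow> 'o store" where
  "do_act x (mv, acts, em) (h, wk, out) =
     (min (length x + 1) (move_head mv h),
      map2 (\<lambda>(t, p) (s, m). (t(p := s), move_head m p)) wk acts,
      out @ (case em of None \<Rightarrow> [] | Some b \<Rightarrow> [b]))"

definition bounded :: "nat \<Rightarrow> ((nat \<Rightarrow> nat) \<times> nat) list \<Rightarrow> bool" where
  "bounded s wk \<longleftrightarrow> (\<forall>(t, p)\<in>set wk. p < s)"

text \<open>Every action must leave the heads below s, so a terminating execution carries its own
  space bound.\<close>

inductive exec :: "bool list \<Rightarrow> nat \<Rightarrow> 'o cmd \<Rightarrow> 'o store \<Rightarrow> 'o store \<Rightarrow> bool" for x s where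
  Do: "do_act x (f (read_input x h) (scanned wk)) (h, wk, out) = (h', wk', out') \<Longrightarrow> bounded s wk' \<Longrightarrow>
       exec x s (Do f) (h, wk, out) (h', wk', out')"
| Seq: "exec x s c \<sigma> \<sigma>' \<Longrightarrow> exec x s d \<sigma>' \<sigma>'' \<Longrightarrow> exec x s (c ;; d) \<sigma> \<sigma>''"
| CondTrue: "b (read_input x h) (scanned wk) \<Longrightarrow> exec x s c (h, wk, out) \<sigma>' \<Longrightarrow>
           exec x s (Cond b c d) (h, wk, out) \<sigma>'"
| CondFalse: "\<not> b (read_input x h) (scanned wk) \<Longrightarrow> exec x s d (h, wk, out) \<sigma>' \<Longrightarrow>
           exec x s (Cond b c d) (h, wk, out) \<sigma>'"
| WhileFalse: "\<not> b (read_input x h) (scanned wk) \<Longrightarrow> exec x s (While b c) (h, wk, out) (h, wk, out)"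
| WhileTrue: "b (read_input x h) (scanned wk) \<Longrightarrow> exec x s c (h, wk, out) \<sigma>' \<Longrightarrow>
           exec x s (While b c) \<sigma>' \<sigma>'' \<Longrightarrow> exec x s (While b c) (h, wk, out) \<sigma>''"

primrec csize :: "'o cmd \<Rightarrow> nat" where
  "csize (Do f) = 1"
| "csize (c ;; d) = csize c + csize d"
| "csize (Cond b c d) = 1 + csize c + csize d"
| "csize (While b c) = 1 + csize c"

text \<open>Rewrites the scanned symbols, so that a test takes a step but changes the state
  alone.\<close>

definition goto :: "nat \<Rightarrow> nat list \<Rightarrow> 'o action" where
  "goto q ws = \<lparr>next_state = q, in_move = Stay, work_acts = map (\<lambda>s. (s, Stay)) ws, emit = None\<rparr>"

text \<open>\<open>code c q\<^sub>0 e\<close> is the transition function of \<open>c\<close>, whose states are the \<open>csize c\<close> numbers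
  from \<open>q\<^sub>0\<close> on, entered in \<open>q\<^sub>0\<close> and left to \<open>e\<close>.\<close>

primrec code :: "'o cmd \<Rightarrow> nat \<Rightarrow> nat \<Rightarrow> nat \<Rightarrow> insym \<Rightarrow> nat list \<Rightarrow> 'o action option" where
  "code (Do f) q\<^sub>0 e q a ws = Some (case f a ws of (mv, acts, em) \<Rightarrow>
     \<lparr>next_state = e, in_move = mv, work_acts = acts, emit = em\<rparr>)"
| "code (c ;; d) q\<^sub>0 e q a ws =
     (if q < q\<^sub>0 + csize c then code c q\<^sub>0 (q\<^sub>0 + csize c) q a ws else code d (q\<^sub>0 + csize c) e q a ws)"
| "code (Cond b c d) q\<^sub>0 e q a ws =
     (if q = q\<^sub>0 then Some (goto (if b a ws then q\<^sub>0 + 1 else q\<^sub>0 + 1 + csize c) ws)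
      else if q < q\<^sub>0 + 1 + csize c then code c (q\<^sub>0 + 1) e q a ws
      else code d (q\<^sub>0 + 1 + csize c) e q a ws)"
| "code (While b c) q\<^sub>0 e q a ws =
     (if q = q\<^sub>0 then Some (goto (if b a ws then q\<^sub>0 + 1 else e) ws) else code c (q\<^sub>0 + 1) q\<^sub>0 q a ws)"

text \<open>The extra state \<open>csize c\<close> is the exit of the program; no transition leaves
  it, so the machine halts there.\<close>

definition machine :: "nat \<Rightarrow> nat \<Rightarrow> 'o cmd \<Rightarrow> 'o transducer" where
  "machine syms tapes c = \<lparr>num_states = Suc (csize c), num_symbols = syms, num_tapes = tapes,
     delta = (\<lambda>q a ws. if q < csize c then code c 0 (csize c) q a ws else None)\<rparr>"

lemma csize_pos: "csize c > 0"
  by (induction c) auto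

definition wf_act :: "nat \<Rightarrow> nat \<Rightarrow> (insym \<Rightarrow> nat list \<Rightarrow> 'o act) \<Rightarrow> bool" where
  "wf_act syms tapes f \<longleftrightarrow> (\<forall>a ws. length ws = tapes \<and> set ws \<subseteq> {..<syms} \<longrightarrow>
     length (fst (snd (f a ws))) = tapes \<and> fst ` set (fst (snd (f a ws))) \<subseteq> {..<syms})"

primrec wf_cmd :: "nat \<Rightarrow> nat \<Rightarrow> 'o cmd \<Rightarrow> bool" where
  "wf_cmd syms tapes (Do f) = wf_act syms tapes f"
| "wf_cmd syms tapes (c ;; d) = (wf_cmd syms tapes c \<and> wf_cmd syms tapes d)"
| "wf_cmd syms tapes (Cond b c d) = (wf_cmd syms tapes c \<and> wf_cmd syms tapes d)"
| "wf_cmd syms tapes (While b c) = wf_cmd syms tapes c"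

lemma wf_code:
  assumes "wf_cmd syms tapes c" "q\<^sub>0 \<le> q" "q < q\<^sub>0 + csize c" "length ws = tapes" "set ws \<subseteq> {..<syms}"
    and "code c q\<^sub>0 e q a ws = Some act"
  shows "(next_state act = e \<or> next_state act < q\<^sub>0 + csize c) \<and> length (work_acts act) = tapes \<and>
         fst ` set (work_acts act) \<subseteq> {..<syms}"
  using assms
proof (induction c arbitrary: q\<^sub>0 e)
  case (Do f)
  obtain mv acts em where f: "f a ws = (mv, acts, em)" by (cases "f a ws")
  have "length (fst (snd (f a ws))) = tapes \<and> fst ` set (fst (snd (f a ws))) \<subseteq> {..<syms}"
    using Do.prems by (simp add: wf_act_def)
  then show ?case using Do.prems(6) f by (simp del: One_nat_def) (metis action.select_convs(1,3))
next
  case (Seq c d)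
  show ?case
  proof (cases "q < q\<^sub>0 + csize c")
    case True
    then show ?thesis using Seq.IH(1)[of q\<^sub>0 "q\<^sub>0 + csize c"] Seq.prems csize_pos[of d] by auto
  next
    case False
    then show ?thesis using Seq.IH(2)[of "q\<^sub>0 + csize c" e] Seq.prems by auto
  qed
next
  case (Cond b c d)
  consider "q = q\<^sub>0" | "q \<noteq> q\<^sub>0" "q < q\<^sub>0 + 1 + csize c" | "q \<noteq> q\<^sub>0" "\<not> q < q\<^sub>0 + 1 + csize c" by blast
  then show ?case
  proof cases
    case 1
    then show ?thesis using Cond.prems csize_pos[of c] csize_pos[of d] by (auto simp: goto_def)
  next
    case 2
    then show ?thesis using Cond.IH(1)[of "q\<^sub>0 + 1" e] Cond.prems by auto
  next
    case 3
    then show ?thesis using Cond.IH(2)[of "q\<^sub>0 + 1 + csize c" e] Cond.prems by auto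
  qed
next
  case (While b c)
  show ?case
  proof (cases "q = q\<^sub>0")
    case True
    then show ?thesis using While.prems csize_pos[of c] by (auto simp: goto_def)
  next
    case False
    then show ?thesis using While.IH[of "q\<^sub>0 + 1" q\<^sub>0] While.prems by auto
  qed
qed

lemma wf_machine: "wf_cmd syms tapes c \<Longrightarrow> syms > 0 \<Longrightarrow> wf_transducer (machine syms tapes c)"
  unfolding wf_transducer_def machine_def using wf_code[where q\<^sub>0 = 0 and e = "csize c"]
  by (fastforce split: if_splits)

fun conf :: "nat \<Rightarrow> 'o store \<Rightarrow> 'o config" where
  "conf q (h, wk, out) = \<lparr>state = q, in_head = h, work = wk, out_tape = out\<rparr>"

section \<open>Correctness of the compilation\<close>

definition reach :: "'o transducer \<Rightarrow> bool list \<Rightarrow> nat \<Rightarrow> 'o config \<Rightarrow> 'o config \<Rightarrow> bool" where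
  "reach M x s k k' \<longleftrightarrow> (\<exists>t. (step M x ^^ t) k = k' \<and> (\<forall>i\<le>t. bounded s (work ((step M x ^^ i) k))))"

lemma reach_trans:
  assumes "reach M x s a b" "reach M x s b c"
  shows "reach M x s a c"
proof -
  obtain t where t: "(step M x ^^ t) a = b" "\<forall>i\<le>t. bounded s (work ((step M x ^^ i) a))"
    using assms(1) by (auto simp: reach_def)
  obtain u where u: "(step M x ^^ u) b = c" "\<forall>i\<le>u. bounded s (work ((step M x ^^ i) b))"
    using assms(2) by (auto simp: reach_def)
  have add: "(step M x ^^ (i + t)) a = (step M x ^^ i) b" for i
    by (simp add: funpow_add t(1))
  have "bounded s (work ((step M x ^^ i) a))" if "i \<le> u + t" for i
  proof (cases "i \<le> t")
    case True
    then show ?thesis using t(2) by simp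
  next
    case False
    then have "i = (i - t) + t" "i - t \<le> u" using that by auto
    then show ?thesis using u(2) add[of "i - t"] by metis
  qed
  then show ?thesis unfolding reach_def using add[of u] u(1) by (intro exI[of _ "u + t"]) auto
qed

lemma reach_step: "step M x a = b \<Longrightarrow> bounded s (work a) \<Longrightarrow> bounded s (work b) \<Longrightarrow> reach M x s a b"
  unfolding reach_def by (rule exI[of _ 1]) (auto simp: le_Suc_eq)

lemma goto_step:
  assumes "delta M q (read_input x h) (scanned wk) = Some (goto q' (scanned wk))"
    and "h \<le> length x + 1"
  shows "step M x (conf q (h, wk, out)) = conf q' (h, wk, out)"
proof -
  have "map2 (\<lambda>(t, p) (s, m). (t(p := s), move_head m p)) wk (map (\<lambda>s. (s, Stay)) (scanned wk)) = wk"
    unfolding scanned_def by (induction wk) auto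
  then show ?thesis
    using assms by (simp add: step_def chosen_action_def scanned_def perform_def goto_def)
qed

lemma exec_head: "exec x s c \<sigma> \<sigma>' \<Longrightarrow> fst \<sigma> \<le> length x + 1 \<Longrightarrow> fst \<sigma>' \<le> length x + 1"
proof (induction rule: exec.induct)
  case (Do f h wk out h' wk' out')
  obtain mv acts em where "f (read_input x h) (scanned wk) = (mv, acts, em)" by (cases "f (read_input x h) (scanned wk)")
  then show ?case using Do by auto
qed auto

lemma exec_bounded: "exec x s c \<sigma> \<sigma>' \<Longrightarrow> bounded s (fst (snd \<sigma>)) \<Longrightarrow> bounded s (fst (snd \<sigma>'))"
  by (induction rule: exec.induct) auto

text \<open>The machine need only agree with \<open>code\<close> on the states of c. This lets the
  induction descend into subcommands, whose code is a segment of the whole.\<close>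

lemma exec_reach:
  assumes "exec x s c \<sigma> \<sigma>'" "bounded s (fst (snd \<sigma>))" "fst \<sigma> \<le> length x + 1"
    and "\<And>q a ws. q\<^sub>0 \<le> q \<Longrightarrow> q < q\<^sub>0 + csize c \<Longrightarrow> delta M q a ws = code c q\<^sub>0 e q a ws"
  shows "reach M x s (conf q\<^sub>0 \<sigma>) (conf e \<sigma>')"
  using assms
proof (induction arbitrary: q\<^sub>0 e rule: exec.induct)
  case (Do f h wk out h' wk' out')
  obtain mv acts em where f: "f (read_input x h) (scanned wk) = (mv, acts, em)"
    by (cases "f (read_input x h) (scanned wk)")
  have "step M x (conf q\<^sub>0 (h, wk, out)) = conf e (h', wk', out')"
    using Do f by (auto simp: step_def chosen_action_def scanned_def[symmetric] perform_def)
  then show ?case using Do by (intro reach_step) auto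
next
  case (Seq c \<sigma> \<sigma>' d \<sigma>'')
  have "reach M x s (conf q\<^sub>0 \<sigma>) (conf (q\<^sub>0 + csize c) \<sigma>')"
    using Seq.prems by (intro Seq.IH(1)) auto
  moreover have "reach M x s (conf (q\<^sub>0 + csize c) \<sigma>') (conf e \<sigma>'')"
    using Seq.prems exec_head[OF Seq.hyps(1)] exec_bounded[OF Seq.hyps(1)] by (intro Seq.IH(2)) auto
  ultimately show ?case by (rule reach_trans)
next
  case (CondTrue b h wk c out \<sigma>' d)
  have "reach M x s (conf q\<^sub>0 (h, wk, out)) (conf (q\<^sub>0 + 1) (h, wk, out))"
    using CondTrue by (intro reach_step goto_step) auto
  moreover have "reach M x s (conf (q\<^sub>0 + 1) (h, wk, out)) (conf e \<sigma>')"
    using CondTrue.prems by (intro CondTrue.IH) auto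
  ultimately show ?case by (rule reach_trans)
next
  case (CondFalse b h wk d out \<sigma>' c)
  have "reach M x s (conf q\<^sub>0 (h, wk, out)) (conf (q\<^sub>0 + 1 + csize c) (h, wk, out))"
    using CondFalse by (intro reach_step goto_step) auto
  moreover have "reach M x s (conf (q\<^sub>0 + 1 + csize c) (h, wk, out)) (conf e \<sigma>')"
    using CondFalse.prems by (intro CondFalse.IH) auto
  ultimately show ?case by (rule reach_trans)
next
  case (WhileFalse b h wk c out)
  then show ?case by (intro reach_step goto_step) auto
next
  case (WhileTrue b h wk c out \<sigma>' \<sigma>'')
  have "reach M x s (conf q\<^sub>0 (h, wk, out)) (conf (q\<^sub>0 + 1) (h, wk, out))"
    using WhileTrue by (intro reach_step goto_step) auto
  moreover have "reach M x s (conf (q\<^sub>0 + 1) (h, wk, out)) (conf q\<^sub>0 \<sigma>')"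
    using WhileTrue.prems by (intro WhileTrue.IH(1)) auto
  moreover have "reach M x s (conf q\<^sub>0 \<sigma>') (conf e \<sigma>'')"
    using WhileTrue.prems exec_head[OF WhileTrue.hyps(2)] exec_bounded[OF WhileTrue.hyps(2)]
    by (intro WhileTrue.IH(2)) auto
  ultimately show ?case by (meson reach_trans)
qed

lemma exec_outputs:
  assumes "exec x s c (0, replicate tapes (\<lambda>_. 0, 0), []) (h, wk, out)" "s > 0"
  shows "outputs_in_space (machine syms tapes c) x out s"
proof -
  let ?M = "machine syms tapes c"
  have b: "bounded s (replicate tapes (\<lambda>_ :: nat. 0 :: nat, 0))"
    using assms(2) by (auto simp: bounded_def)
  have "reach ?M x s (conf 0 (0, replicate tapes (\<lambda>_. 0, 0), [])) (conf (csize c) (h, wk, out))"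
    using assms(1) b by (intro exec_reach) (auto simp: machine_def)
  moreover have "conf 0 (0, replicate tapes (\<lambda>_. 0, 0), []) = init_config ?M"
    by (simp add: init_config_def machine_def)
  ultimately obtain t where t: "run ?M x t = conf (csize c) (h, wk, out)"
    "\<forall>i\<le>t. bounded s (work (run ?M x i))"
    by (auto simp: reach_def run_def)
  then show ?thesis unfolding outputs_in_space_def
    by (intro exI[of _ t]) (auto simp: chosen_action_def machine_def bounded_def)
qed

section \<open>Commands for binary counters on work tapes\<close>

definition touch :: "nat \<Rightarrow> (nat \<Rightarrow> nat) \<Rightarrow> move \<Rightarrow> token cmd" where
  "touch k g m = Do (\<lambda>a ws. (Stay, (map (\<lambda>s. (s, Stay)) ws)[k := (g (ws ! k), m)], None))"

definition put :: "(nat list \<Rightarrow> token) \<Rightarrow> token cmd" where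
  "put f = Do (\<lambda>a ws. (Stay, map (\<lambda>s. (s, Stay)) ws, Some (f ws)))"

definition skip :: "token cmd" where
  "skip = Do (\<lambda>a ws. (Stay, map (\<lambda>s. (s, Stay)) ws, None))"

definition advance_input :: "token cmd" where
  "advance_input = Do (\<lambda>a ws. (MoveRight, map (\<lambda>s. (s, Stay)) ws, None))"

text \<open>Symbol 3 marks cell 0, where \<open>home\<close> stops. Symbols 1 and 2 are the bits
  false and true from cell 1 on, and the blank 0 ends the number.\<close>

definition init_tapes :: "token cmd" where
  "init_tapes = Do (\<lambda>a ws. (Stay, map (\<lambda>_. (3, Stay)) ws, None))"

abbreviation "right k \<equiv> touch k id MoveRight"

definition home :: "nat \<Rightarrow> token cmd" where
  "home k = While (\<lambda>_ ws. ws ! k \<noteq> 3) (touch k id MoveLeft)"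

definition scan :: "nat \<Rightarrow> token cmd \<Rightarrow> token cmd" where
  "scan k c = While (\<lambda>_ ws. ws ! k \<noteq> 0) (c ;; right k)"

text \<open>Clears the leading run of ones and stops on the next cell without writing there, so that
  the caller can tell a digit from the blank behind an overflowing counter.\<close>

definition carry :: "nat \<Rightarrow> token cmd" where
  "carry k = right k ;; While (\<lambda>_ ws. ws ! k = 2) (touch k (\<lambda>_. 1) MoveRight)"

definition increment :: "nat \<Rightarrow> token cmd" where
  "increment k = carry k ;; touch k (\<lambda>_. 2) Stay ;; home k"

definition reset :: "nat \<Rightarrow> token cmd" where
  "reset k = right k ;; While (\<lambda>_ ws. ws ! k \<noteq> 0) (touch k (\<lambda>_. 1) MoveRight) ;; home k"

definition print :: "nat \<Rightarrow> token cmd" where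
  "print k = right k ;; scan k (put (\<lambda>ws. BitTok (ws ! k = 2))) ;; home k"

text \<open>Entered with the counter \<open>0\<close>. Between two rounds the head of tape \<open>k\<close> rests on the digit that
  stops the carry, which is the blank right of the counter after the last round.\<close>

definition for_all :: "nat \<Rightarrow> token cmd \<Rightarrow> token cmd" where
  "for_all k c = While (\<lambda>_ ws. ws ! k \<noteq> 0)
     ((Cond (\<lambda>_ ws. ws ! k = 1) (touch k (\<lambda>_. 2) Stay) skip ;; home k) ;; c ;; carry k) ;; home k"

definition tape :: "bool list \<Rightarrow> nat \<Rightarrow> nat" where
  "tape bs p = (if p = 0 then 3 else if p \<le> length bs then (if bs ! (p - 1) then 2 else 1) else 0)"

definition tapes :: "(bool list \<times> nat) list \<Rightarrow> ((nat \<Rightarrow> nat) \<times> nat) list" where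
  "tapes l = map (\<lambda>(bs, p). (tape bs, p)) l"

definition syms :: "(bool list \<times> nat) list \<Rightarrow> nat list" where
  "syms l = map (\<lambda>(bs, p). tape bs p) l"

lemma scanned_tapes: "scanned (tapes l) = syms l"
  by (simp add: scanned_def tapes_def syms_def comp_def case_prod_beta)

lemma nth_syms: "k < length l \<Longrightarrow> l ! k = (bs, p) \<Longrightarrow> syms l ! k = tape bs p"
  by (simp add: syms_def)

lemma tape_0 [simp]: "tape bs 0 = 3"
  by (simp add: tape_def)

lemma tape_eq_0 [simp]: "tape bs p = 0 \<longleftrightarrow> p > length bs"
  by (auto simp: tape_def)

lemma tape_eq_3 [simp]: "tape bs p = 3 \<longleftrightarrow> p = 0"
  by (auto simp: tape_def)

lemma tape_middle: "tape (ps @ b # bs) (Suc (length ps)) = (if b then 2 else 1)"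
  by (simp add: tape_def)

lemma tape_write: "(tape (ps @ b # bs))(Suc (length ps) := (if b' then 2 else 1)) = tape (ps @ b' # bs)"
  by (rule ext) (auto simp: tape_def nth_append nth_Cons split: nat.split)

lemma tape_extend: "(tape ps)(Suc (length ps) := (if b then 2 else 1)) = tape (ps @ [b])"
  by (rule ext) (auto simp: tape_def nth_append)

lemma tape_erase: "(tape (ps @ [b]))(Suc (length ps) := 0) = tape ps"
  by (rule ext) (auto simp: tape_def nth_append)

text \<open>The result of incrementing in the form in which \<open>carry\<close> computes it. For a
  list of ones \<open>tl\<close> acts on the empty list, and the new digit is appended.\<close>

lemma binc_split:
  "binc bs = replicate (length (takeWhile (\<lambda>b. b) bs)) False @ True # tl (dropWhile (\<lambda>b. b) bs)"
  by (induction bs) auto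

lemma dropWhile_hd: "dropWhile (\<lambda>b. b) bs \<noteq> [] \<Longrightarrow> dropWhile (\<lambda>b. b) bs = False # tl (dropWhile (\<lambda>b. b) bs)"
  by (metis (full_types) hd_dropWhile list.exhaust_sel)

text \<open>The carry leaves the counter exactly at its last value. Reading a blank is how
  \<open>for_all\<close> notices that the enumeration is complete.\<close>

lemma carry_counter:
  assumes "v < 2 ^ r"
  shows "Suc v < 2 ^ r \<Longrightarrow> dropWhile (\<lambda>b. b) (counter r v) \<noteq> []"
    and "Suc v = 2 ^ r \<Longrightarrow> dropWhile (\<lambda>b. b) (counter r v) = []"
proof -
  let ?c = "counter r v"
  have len: "length ?c = r" using assms by (rule length_counter)
  have all: "Suc (bval bs) = 2 ^ length bs \<longleftrightarrow> (\<forall>b\<in>set bs. b)" for bs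
  proof (induction bs)
    case (Cons b bs)
    show ?case
    proof (cases b)
      case True
      have "Suc (Suc (2 * bval bs)) = 2 * 2 ^ length bs \<longleftrightarrow> Suc (bval bs) = 2 ^ length bs" by presburger
      then show ?thesis using Cons True by simp
    next
      case False
      have "Suc (2 * bval bs) \<noteq> 2 * 2 ^ length bs" by presburger
      then show ?thesis using False by simp
    qed
  qed simp
  have "(dropWhile (\<lambda>b. b) ?c = []) = (\<forall>b\<in>set ?c. b)" by (simp add: dropWhile_eq_Nil_conv)
  also have "\<dots> \<longleftrightarrow> Suc v = 2 ^ r" unfolding all[symmetric] len bval_counter ..
  finally show "Suc v < 2 ^ r \<Longrightarrow> dropWhile (\<lambda>b. b) ?c \<noteq> []" "Suc v = 2 ^ r \<Longrightarrow> dropWhile (\<lambda>b. b) ?c = []"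
    by auto
qed

section \<open>Hoare-style rules for tape contents\<close>

locale space =
  fixes x :: "bool list" and s :: nat
begin

definition ok :: "(bool list \<times> nat) list \<Rightarrow> bool" where
  "ok l \<longleftrightarrow> (\<forall>(bs, p)\<in>set l. p < s)"

text \<open>The invariants on head positions are part of the definition, so that the rules compose
  without side conditions about the state in between.\<close>

definition runs :: "token cmd \<Rightarrow> nat \<times> (bool list \<times> nat) list \<times> token list \<Rightarrow>
    nat \<times> (bool list \<times> nat) list \<times> token list \<Rightarrow> bool" where
  "runs c = (\<lambda>(h, l, out) (h', l', out'). h \<le> length x + 1 \<and> ok l \<longrightarrow>
     h' \<le> length x + 1 \<and> ok l' \<and> exec x s c (h, tapes l, out) (h', tapes l', out'))"

lemma ok_bounded: "ok l \<longleftrightarrow> bounded s (tapes l)"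
  by (auto simp: ok_def bounded_def tapes_def)

lemma ok_update: "ok l \<Longrightarrow> p < s \<Longrightarrow> ok (l[k := (bs, p)])"
  unfolding ok_def using set_update_subset_insert[of l k "(bs, p)"] by auto

lemma runs_eq: "runs c a b \<Longrightarrow> b = b' \<Longrightarrow> runs c a b'"
  by simp

lemma runs_Seq: "runs c a b \<Longrightarrow> runs d b e \<Longrightarrow> runs (c ;; d) a e"
  unfolding runs_def by (auto split: prod.splits intro: exec.Seq)

lemma runs_Cond:
  assumes "b (read_input x h) (syms l) \<Longrightarrow> runs c (h, l, out) a"
    and "\<not> b (read_input x h) (syms l) \<Longrightarrow> runs d (h, l, out) a"
  shows "runs (Cond b c d) (h, l, out) a"
  using assms unfolding runs_def
  by (cases "b (read_input x h) (syms l)") (auto split: prod.splits intro: exec.CondTrue exec.CondFalse simp: scanned_tapes)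

lemma runs_While_False: "\<not> b (read_input x h) (syms l) \<Longrightarrow> runs (While b c) (h, l, out) (h, l, out)"
  unfolding runs_def by (auto intro: exec.WhileFalse simp: scanned_tapes)

lemma runs_While_True:
  assumes "b (read_input x h) (syms l)" "runs c (h, l, out) a" "runs (While b c) a e"
  shows "runs (While b c) (h, l, out) e"
  using assms unfolding runs_def by (auto split: prod.splits intro: exec.WhileTrue simp: scanned_tapes)

lemma stay_acts:
  "map2 (\<lambda>(t, p) (s, m). (t(p := s), move_head m p)) (tapes l) (map (\<lambda>s. (s, Stay)) (syms l)) = tapes l"
  unfolding tapes_def syms_def by (induction l) auto

lemma runs_put: "runs (put f) (h, l, out) (h, l, out @ [f (syms l)])"
  unfolding runs_def put_def
  by (auto intro!: exec.Do simp: scanned_tapes stay_acts ok_bounded[symmetric])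

lemma runs_skip: "runs skip (h, l, out) (h, l, out)"
  unfolding runs_def skip_def
  by (auto intro!: exec.Do simp: scanned_tapes stay_acts ok_bounded[symmetric])

lemma runs_advance: "h \<le> length x \<Longrightarrow> runs advance_input (h, l, out) (Suc h, l, out)"
  unfolding runs_def advance_input_def
  by (auto intro!: exec.Do simp: scanned_tapes stay_acts ok_bounded[symmetric])

lemma runs_touch:
  assumes "k < length l" "l ! k = (bs, p)" "(tape bs)(p := g (tape bs p)) = tape bs'" "move_head m p < s"
  shows "runs (touch k g m) (h, l, out) (h, l[k := (bs', move_head m p)], out)"
proof -
  have "map2 (\<lambda>(t, p) (s, m). (t(p := s), move_head m p)) (tapes l)
      ((map (\<lambda>s. (s, Stay)) (syms l))[k := (g (syms l ! k), m)]) = tapes (l[k := (bs', move_head m p)])"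
  proof (rule nth_equalityI)
    show "length (map2 (\<lambda>(t, p) (s, m). (t(p := s), move_head m p)) (tapes l)
      ((map (\<lambda>s. (s, Stay)) (syms l))[k := (g (syms l ! k), m)])) = length (tapes (l[k := (bs', move_head m p)]))"
      by (simp add: tapes_def syms_def)
    fix i assume "i < length (map2 (\<lambda>(t, p) (s, m). (t(p := s), move_head m p)) (tapes l)
      ((map (\<lambda>s. (s, Stay)) (syms l))[k := (g (syms l ! k), m)]))"
    then have i: "i < length l" by (simp add: tapes_def syms_def)
    obtain cs r where "l ! i = (cs, r)" by (cases "l ! i")
    then show "map2 (\<lambda>(t, p) (s, m). (t(p := s), move_head m p)) (tapes l)
      ((map (\<lambda>s. (s, Stay)) (syms l))[k := (g (syms l ! k), m)]) ! i = tapes (l[k := (bs', move_head m p)]) ! i"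
      using i assms by (cases "i = k") (auto simp: tapes_def syms_def)
  qed
  then show ?thesis
    unfolding runs_def touch_def using assms(4) ok_update
    by (auto intro!: exec.Do simp: scanned_tapes ok_bounded[symmetric])
qed

lemma runs_right:
  assumes "k < length l" "l ! k = (bs, p)" "Suc p < s"
  shows "runs (right k) (h, l, out) (h, l[k := (bs, Suc p)], out)"
  using runs_touch[of k l bs p id bs MoveRight] assms by simp

lemma runs_home:
  "k < length l \<Longrightarrow> l ! k = (bs, p) \<Longrightarrow> p < s \<Longrightarrow> runs (home k) (h, l, out) (h, l[k := (bs, 0)], out)"
proof (induction p arbitrary: l)
  case 0
  have "l[k := (bs, 0)] = l" using 0 by (simp add: list_update_same_conv)
  then show ?case unfolding home_def using 0
    by (auto intro!: runs_While_False simp: nth_syms)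
next
  case (Suc p)
  have 1: "runs (touch k id MoveLeft) (h, l, out) (h, l[k := (bs, p)], out)"
    using runs_touch[of k l bs "Suc p" id bs MoveLeft] Suc.prems by simp
  have 2: "runs (home k) (h, l[k := (bs, p)], out) (h, l[k := (bs, 0)], out)"
    using Suc.IH[of "l[k := (bs, p)]"] Suc.prems by simp
  show ?case
    unfolding home_def
    by (rule runs_While_True[OF _ 1 2[unfolded home_def]]) (use Suc.prems in \<open>simp add: nth_syms\<close>)
qed

text \<open>L i describes the tapes at the start of round i. The body reaches L (i + 1) except that
  the head of tape k has yet to move. The start i0 is free so that a scan can skip bit 0.\<close>

lemma runs_scan:
  assumes "i\<^sub>0 \<le> N" "\<And>i. i \<le> N \<Longrightarrow> k < length (L i) \<and> L i ! k = (z, Suc i)" "length z = N" "Suc N < s"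
    and body: "\<And>i out. i\<^sub>0 \<le> i \<Longrightarrow> i < N \<Longrightarrow>
       runs c (h, L i, out) (h, (L (Suc i))[k := (z, Suc i)], out @ f i)"
  shows "runs (scan k c) (h, L i\<^sub>0, out) (h, L N, out @ concat (map f [i\<^sub>0..<N]))"
  using assms(1) body
proof (induction "N - i\<^sub>0" arbitrary: i\<^sub>0 out)
  case 0
  then show ?case using assms(2)[of N] assms(3)
    by (auto simp: scan_def nth_syms intro!: runs_While_False)
next
  case (Suc d)
  then have i: "i\<^sub>0 < N" by simp
  have 1: "runs c (h, L i\<^sub>0, out) (h, (L (Suc i\<^sub>0))[k := (z, Suc i\<^sub>0)], out @ f i\<^sub>0)"
    using Suc.prems i by simp
  have 2: "runs (right k) (h, (L (Suc i\<^sub>0))[k := (z, Suc i\<^sub>0)], out @ f i\<^sub>0) (h, L (Suc i\<^sub>0), out @ f i\<^sub>0)"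
  proof -
    have "(L (Suc i\<^sub>0))[k := (z, Suc (Suc i\<^sub>0))] = L (Suc i\<^sub>0)"
      using assms(2)[of "Suc i\<^sub>0"] i by (simp add: list_update_same_conv)
    then show ?thesis
      using runs_right[of k "(L (Suc i\<^sub>0))[k := (z, Suc i\<^sub>0)]" z "Suc i\<^sub>0" h "out @ f i\<^sub>0"]
        assms(2)[of "Suc i\<^sub>0"] assms(4) i by simp
  qed
  have 3: "runs (scan k c) (h, L (Suc i\<^sub>0), out @ f i\<^sub>0) (h, L N, (out @ f i\<^sub>0) @ concat (map f [Suc i\<^sub>0..<N]))"
    using Suc.prems i Suc.hyps(2) by (intro Suc.hyps(1)) auto
  have "out @ concat (map f [i\<^sub>0..<N]) = (out @ f i\<^sub>0) @ concat (map f [Suc i\<^sub>0..<N])"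
    using i by (simp add: upt_conv_Cons)
  moreover have "syms (L i\<^sub>0) ! k \<noteq> 0"
    using assms(2)[of i\<^sub>0] i assms(3) by (simp add: nth_syms)
  ultimately show ?case
    unfolding scan_def by (metis (no_types, lifting) runs_While_True[OF _ runs_Seq[OF 1 2] 3[unfolded scan_def]])
qed

lemma runs_print:
  assumes "k < length l" "l ! k = (bs, 0)" "Suc (length bs) < s"
  shows "runs (print k) (h, l, out) (h, l, out @ map BitTok bs)"
proof -
  define L where "L i = l[k := (bs, Suc i)]" for i
  have "runs (scan k (put (\<lambda>ws. BitTok (ws ! k = 2)))) (h, L 0, out)
      (h, L (length bs), out @ concat (map (\<lambda>i. [BitTok (bs ! i)]) [0..<length bs]))"
  proof (rule runs_scan)
    show "k < length (L i) \<and> L i ! k = (bs, Suc i)" for i using assms by (simp add: L_def)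
    fix i out assume i: "i < length bs"
    have "syms (L i) ! k = tape bs (Suc i)" using assms by (simp add: L_def nth_syms)
    then have "(syms (L i) ! k = 2) = bs ! i" using i by (simp add: tape_def)
    then show "runs (put (\<lambda>ws. BitTok (ws ! k = 2))) (h, L i, out) (h, (L (Suc i))[k := (bs, Suc i)], out @ [BitTok (bs ! i)])"
      using runs_put[of "\<lambda>ws. BitTok (ws ! k = 2)" h "L i" out] by (simp add: L_def)
  qed (use assms in auto)
  moreover have "concat (map (\<lambda>i. [BitTok (bs ! i)]) [0..<length bs]) = map BitTok bs"
    by (rule nth_equalityI) (auto simp: concat_map_singleton)
  moreover have "runs (right k) (h, l, out) (h, L 0, out)"
    using runs_right[of k l bs 0] assms by (simp add: L_def)
  moreover have "runs (home k) (h, L (length bs), out') (h, l, out')" for out'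
  proof -
    have "l[k := (bs, 0)] = l" using assms by (simp add: list_update_same_conv)
    then show ?thesis using runs_home[of k "L (length bs)" bs "Suc (length bs)"] assms by (simp add: L_def)
  qed
  ultimately show ?thesis unfolding print_def by (metis (no_types, lifting) runs_Seq)
qed

lemma runs_carry_loop:
  "k < length l \<Longrightarrow> l ! k = (ps @ bs, Suc (length ps)) \<Longrightarrow> Suc (length (ps @ bs)) < s \<Longrightarrow>
   runs (While (\<lambda>_ ws. ws ! k = 2) (touch k (\<lambda>_. 1) MoveRight)) (h, l, out)
     (h, l[k := (ps @ replicate (length (takeWhile (\<lambda>b. b) bs)) False @ dropWhile (\<lambda>b. b) bs,
                 Suc (length ps + length (takeWhile (\<lambda>b. b) bs)))], out)"
proof (induction bs arbitrary: ps l)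
  case Nil
  have "l[k := (ps, Suc (length ps))] = l" using Nil by (simp add: list_update_same_conv)
  moreover have "syms l ! k \<noteq> 2" using Nil by (simp add: nth_syms tape_def)
  ultimately show ?case by (auto intro!: runs_While_False)
next
  case (Cons b bs)
  show ?case
  proof (cases b)
    case False
    have "l[k := (ps @ b # bs, Suc (length ps))] = l" using Cons by (simp add: list_update_same_conv)
    moreover have "syms l ! k \<noteq> 2" using Cons False by (simp add: nth_syms tape_middle)
    ultimately show ?thesis using False by (auto intro!: runs_While_False)
  next
    case True
    define l' where "l' = l[k := ((ps @ [False]) @ bs, Suc (length (ps @ [False])))]"
    have "(tape (ps @ b # bs))(Suc (length ps) := 1) = tape ((ps @ [False]) @ bs)"
      using tape_write[of ps b bs False] by simp
    then have 1: "runs (touch k (\<lambda>_. 1) MoveRight) (h, l, out) (h, l', out)"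
      using runs_touch[of k l "ps @ b # bs" "Suc (length ps)" "\<lambda>_. 1" "(ps @ [False]) @ bs" MoveRight h out] Cons.prems
      by (simp add: l'_def)
    have 2: "runs (While (\<lambda>_ ws. ws ! k = 2) (touch k (\<lambda>_. 1) MoveRight)) (h, l', out)
     (h, l'[k := ((ps @ [False]) @ replicate (length (takeWhile (\<lambda>b. b) bs)) False @ dropWhile (\<lambda>b. b) bs,
                 Suc (length (ps @ [False]) + length (takeWhile (\<lambda>b. b) bs)))], out)"
      using Cons.prems by (intro Cons.IH) (auto simp: l'_def)
    show ?thesis
      by (rule runs_While_True[OF _ 1 2[THEN runs_eq]])
        (use Cons.prems True in \<open>auto simp: nth_syms tape_middle l'_def\<close>)
  qed
qed

lemma runs_carry:
  assumes "k < length l" "l ! k = (bs, 0)" "Suc (length bs) < s"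
  shows "runs (carry k) (h, l, out)
    (h, l[k := (replicate (length (takeWhile (\<lambda>b. b) bs)) False @ dropWhile (\<lambda>b. b) bs, Suc (length (takeWhile (\<lambda>b. b) bs)))], out)"
proof -
  have 1: "runs (right k) (h, l, out) (h, l[k := (bs, Suc 0)], out)"
    using runs_right[of k l bs 0] assms by simp
  show ?thesis unfolding carry_def
    using runs_Seq[OF 1 runs_carry_loop[of k "l[k := (bs, Suc 0)]" "[]" bs h out]] assms by simp
qed

lemma runs_increment:
  assumes "k < length l" "l ! k = (bs, 0)" "Suc (length bs) < s"
  shows "runs (increment k) (h, l, out) (h, l[k := (binc bs, 0)], out)"
proof -
  define m where "m = length (takeWhile (\<lambda>b. b) bs)"
  define cs where "cs = replicate m False @ dropWhile (\<lambda>b. b) bs"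
  have m: "m \<le> length bs" by (simp add: m_def length_takeWhile_le)
  have w: "(tape cs)(Suc m := 2) = tape (binc bs)"
  proof (cases "dropWhile (\<lambda>b. b) bs = []")
    case True
    show ?thesis unfolding cs_def binc_split True m_def[symmetric]
      using tape_extend[of "replicate m False" True] by simp
  next
    case False
    show ?thesis
      using tape_write[of "replicate m False" False "tl (dropWhile (\<lambda>b. b) bs)" True] dropWhile_hd[OF False]
      by (simp add: cs_def binc_split[of bs] m_def)
  qed
  have 1: "runs (carry k) (h, l, out) (h, l[k := (cs, Suc m)], out)"
    unfolding cs_def m_def by (rule runs_carry[OF assms])
  have 2: "runs (touch k (\<lambda>_. 2) Stay) (h, l[k := (cs, Suc m)], out) (h, l[k := (binc bs, Suc m)], out)"
    using runs_touch[of k "l[k := (cs, Suc m)]" cs "Suc m" "\<lambda>_. 2" "binc bs" Stay h out] w m assms by simp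
  have 3: "runs (home k) (h, l[k := (binc bs, Suc m)], out) (h, l[k := (binc bs, 0)], out)"
    using runs_home[of k "l[k := (binc bs, Suc m)]" "binc bs" "Suc m" h out] m assms by simp
  show ?thesis unfolding increment_def by (rule runs_Seq[OF 1 runs_Seq[OF 2 3]])
qed

lemma runs_reset_loop:
  "k < length l \<Longrightarrow> l ! k = (ps @ bs, Suc (length ps)) \<Longrightarrow> Suc (length (ps @ bs)) < s \<Longrightarrow>
   runs (While (\<lambda>_ ws. ws ! k \<noteq> 0) (touch k (\<lambda>_. 1) MoveRight)) (h, l, out)
     (h, l[k := (ps @ replicate (length bs) False, Suc (length (ps @ bs)))], out)"
proof (induction bs arbitrary: ps l)
  case Nil
  have "l[k := (ps, Suc (length ps))] = l" using Nil by (simp add: list_update_same_conv)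
  moreover have "syms l ! k = 0" using Nil by (simp add: nth_syms)
  ultimately show ?case by (auto intro!: runs_While_False)
next
  case (Cons b bs)
  define l' where "l' = l[k := ((ps @ [False]) @ bs, Suc (length (ps @ [False])))]"
  have "(tape (ps @ b # bs))(Suc (length ps) := 1) = tape ((ps @ [False]) @ bs)"
    using tape_write[of ps b bs False] by simp
  then have 1: "runs (touch k (\<lambda>_. 1) MoveRight) (h, l, out) (h, l', out)"
    using runs_touch[of k l "ps @ b # bs" "Suc (length ps)" "\<lambda>_. 1" "(ps @ [False]) @ bs" MoveRight h out] Cons.prems
    by (simp add: l'_def)
  have 2: "runs (While (\<lambda>_ ws. ws ! k \<noteq> 0) (touch k (\<lambda>_. 1) MoveRight)) (h, l', out)
   (h, l'[k := ((ps @ [False]) @ replicate (length bs) False, Suc (length ((ps @ [False]) @ bs)))], out)"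
    using Cons.prems by (intro Cons.IH) (auto simp: l'_def)
  show ?case
    by (rule runs_While_True[OF _ 1 2[THEN runs_eq]])
      (use Cons.prems in \<open>auto simp: nth_syms l'_def\<close>)
qed

lemma runs_reset:
  assumes "k < length l" "l ! k = (bs, 0)" "Suc (length bs) < s"
  shows "runs (reset k) (h, l, out) (h, l[k := (replicate (length bs) False, 0)], out)"
proof -
  have 1: "runs (right k) (h, l, out) (h, l[k := (bs, Suc 0)], out)"
    using runs_right[of k l bs 0] assms by simp
  have 2: "runs (While (\<lambda>_ ws. ws ! k \<noteq> 0) (touch k (\<lambda>_. 1) MoveRight)) (h, l[k := (bs, Suc 0)], out)
     (h, l[k := (replicate (length bs) False, Suc (length bs))], out)"
    using runs_reset_loop[of k "l[k := (bs, Suc 0)]" "[]" bs h out] assms by simp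
  have 3: "runs (home k) (h, l[k := (replicate (length bs) False, Suc (length bs))], out)
     (h, l[k := (replicate (length bs) False, 0)], out)"
    using runs_home[of k "l[k := (replicate (length bs) False, Suc (length bs))]" "replicate (length bs) False"
        "Suc (length bs)" h out] assms by simp
  show ?thesis unfolding reset_def by (rule runs_Seq[OF 1 runs_Seq[OF 2 3]])
qed

lemma runs_for_all:
  assumes k: "k < length l" "l ! k = (replicate r False, 0)" and s: "Suc r < s"
    and body: "\<And>v out. v < 2 ^ r \<Longrightarrow>
      runs c (h, l[k := (counter r v, 0)], out) (h, l[k := (counter r v, 0)], out @ f (counter r v))"
  shows "runs (for_all k c) (h, l, out) (h, l, out @ concat (map f (all_bits r)))"
proof -
  let ?b = "\<lambda>_ ws. ws ! k \<noteq> (0 :: nat)"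
  let ?c = "(Cond (\<lambda>_ ws. ws ! k = 1) (touch k (\<lambda>_. 2) Stay) skip ;; home k) ;; c ;; carry k"
  have body': "runs (c ;; carry k) (h, l[k := (counter r v, 0)], out)
     (h, l[k := (replicate (length (takeWhile (\<lambda>b. b) (counter r v))) False @ dropWhile (\<lambda>b. b) (counter r v),
           Suc (length (takeWhile (\<lambda>b. b) (counter r v))))], out @ f (counter r v))" if v: "v < 2 ^ r" for v out
    using runs_Seq[OF body[OF v] runs_carry[of k "l[k := (counter r v, 0)]" "counter r v" h]] k s v
    by (simp add: length_counter)
  \<comment> \<open>At the head of the loop the counter is not yet v: in general the carry is done
    but its last digit is still missing. Hence bs and p are arbitrary, and \<open>pre\<close> only
    says that the first command of the body completes them to v.\<close>
  have rest: "runs (While ?b ?c) (h, l[k := (bs, p)], out)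
      (h, l[k := (replicate r False, Suc r)], out @ concat (map (\<lambda>v. f (counter r v)) [v..<2 ^ r]))"
    if v: "v < 2 ^ r" and p: "p < s" "p \<le> length bs"
      and pre: "\<And>out. runs (Cond (\<lambda>_ ws. ws ! k = 1) (touch k (\<lambda>_. 2) Stay) skip ;; home k)
        (h, l[k := (bs, p)], out) (h, l[k := (counter r v, 0)], out)" for v bs p out
    using that
  proof (induction "2 ^ r - v" arbitrary: v bs p out)
    case (Suc d)
    define m where "m = length (takeWhile (\<lambda>b. b) (counter r v))"
    define cs where "cs = replicate m False @ dropWhile (\<lambda>b. b) (counter r v)"
    have m: "m \<le> r" using length_takeWhile_le[of "\<lambda>b. b" "counter r v"] length_counter[OF Suc.prems(1)] by (simp add: m_def)
    have one: "runs ?c (h, l[k := (bs, p)], out) (h, l[k := (cs, Suc m)], out @ f (counter r v))"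
      unfolding cs_def m_def by (rule runs_Seq[OF Suc.prems(4) body'[OF Suc.prems(1)]])
    have test: "?b (read_input x h) (syms (l[k := (bs, p)]))" using k Suc.prems(3) by (simp add: nth_syms)
    have two: "runs (While ?b ?c) (h, l[k := (cs, Suc m)], out @ f (counter r v))
       (h, l[k := (replicate r False, Suc r)], (out @ f (counter r v)) @ concat (map (\<lambda>v. f (counter r v)) [Suc v..<2 ^ r]))"
    proof (cases "Suc v < 2 ^ r")
      case True
      have dw: "dropWhile (\<lambda>b. b) (counter r v) \<noteq> []" by (rule carry_counter(1)[OF Suc.prems(1) True])
      have mr: "Suc m \<le> length cs" using dw by (simp add: cs_def Suc_le_eq)
      have w: "(tape cs)(Suc m := 2) = tape (counter r (Suc v))"
        using tape_write[of "replicate m False" False "tl (dropWhile (\<lambda>b. b) (counter r v))" True] dropWhile_hd[OF dw]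
        by (simp add: cs_def counter_def binc_split[of "(binc ^^ v) (replicate r False)"] m_def)
      have cur: "syms (l[k := (cs, Suc m)]) ! k = 1"
        using k tape_middle[of "replicate m False" False "tl (dropWhile (\<lambda>b. b) (counter r v))"] dropWhile_hd[OF dw]
        by (simp add: nth_syms cs_def)
      have "runs (Cond (\<lambda>_ ws. ws ! k = 1) (touch k (\<lambda>_. 2) Stay) skip ;; home k)
        (h, l[k := (cs, Suc m)], out) (h, l[k := (counter r (Suc v), 0)], out)" for out
      proof (rule runs_Seq)
        show "runs (Cond (\<lambda>_ ws. ws ! k = 1) (touch k (\<lambda>_. 2) Stay) skip) (h, l[k := (cs, Suc m)], out)
          (h, l[k := (counter r (Suc v), Suc m)], out)"
        proof (rule runs_Cond)
          show "runs (touch k (\<lambda>_. 2) Stay) (h, l[k := (cs, Suc m)], out) (h, l[k := (counter r (Suc v), Suc m)], out)"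
            using runs_touch[of k "l[k := (cs, Suc m)]" cs "Suc m" "\<lambda>_. 2" "counter r (Suc v)" Stay h out] w m k s by simp
        qed (use cur in simp)
        show "runs (home k) (h, l[k := (counter r (Suc v), Suc m)], out) (h, l[k := (counter r (Suc v), 0)], out)"
          using runs_home[of k "l[k := (counter r (Suc v), Suc m)]" "counter r (Suc v)" "Suc m" h out] m k s by simp
      qed
      then show ?thesis using Suc.hyps True mr m s by (intro Suc.hyps(1)) auto
    next
      \<comment> \<open>After the last value the carry has turned all ones into zeros, so the loop
        leaves the counter at 0, ready for the next enumeration.\<close>
      case False
      then have v: "Suc v = 2 ^ r" using Suc.prems(1) by simp
      have dw: "dropWhile (\<lambda>b. b) (counter r v) = []" by (rule carry_counter(2)[OF Suc.prems(1) v])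
      have tw: "takeWhile (\<lambda>b. b) (counter r v) = counter r v"
        using takeWhile_dropWhile_id[of "\<lambda>b. b" "counter r v", unfolded dw] by simp
      have mr: "m = r" unfolding m_def tw by (rule length_counter[OF Suc.prems(1)])
      have "cs = replicate r False" by (simp add: cs_def dw mr)
      then show ?thesis using k by (auto simp: mr v nth_syms intro!: runs_While_False)
    qed
    have "out @ concat (map (\<lambda>v. f (counter r v)) [v..<2 ^ r])
        = (out @ f (counter r v)) @ concat (map (\<lambda>v. f (counter r v)) [Suc v..<2 ^ r])"
      using Suc.prems(1) by (simp add: upt_conv_Cons)
    then show ?case using runs_While_True[of ?b, OF test one two] by simp
  qed simp
  have l: "l[k := (replicate r False, 0)] = l" using k by (simp add: list_update_same_conv)
  have c0: "counter r 0 = replicate r False" by (simp add: counter_def)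
  \<comment> \<open>In the first round the head stands on the mark 3 and not on a digit, so nothing
    is written.\<close>
  have start: "runs (Cond (\<lambda>_ ws. ws ! k = 1) (touch k (\<lambda>_. 2) Stay) skip ;; home k)
        (h, l[k := (replicate r False, 0)], out) (h, l[k := (counter r 0, 0)], out)" for out
  proof (rule runs_Seq)
    show "runs (Cond (\<lambda>_ ws. ws ! k = 1) (touch k (\<lambda>_. 2) Stay) skip) (h, l[k := (replicate r False, 0)], out) (h, l, out)"
      unfolding l by (rule runs_Cond) (use k in \<open>auto simp: nth_syms runs_skip\<close>)
    show "runs (home k) (h, l, out) (h, l[k := (counter r 0, 0)], out)"
      using runs_home[OF k, of h out] s by (simp add: c0)
  qed
  have 1: "runs (While ?b ?c) (h, l, out)
      (h, l[k := (replicate r False, Suc r)], out @ concat (map (\<lambda>v. f (counter r v)) [0..<2 ^ r]))"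
    using rest[of 0 0 "replicate r False" out, OF _ _ _ start] s by (simp add: l)
  have 2: "runs (home k) (h, l[k := (replicate r False, Suc r)], out') (h, l, out')" for out'
    using runs_home[of k "l[k := (replicate r False, Suc r)]" "replicate r False" "Suc r" h out'] k s by (simp add: l)
  show ?thesis unfolding for_all_def using runs_Seq[OF 1 2] by (simp add: all_bits_def comp_def)
qed

end

subsection \<open>A transducer for the formulas\<close>

text \<open>The tapes of the table address z, the value u, the position j, the block number i and
  the bit number t. Before the printing, \<open>tZ\<close> holds n and \<open>tT\<close> holds the
  bit length of n.\<close>

abbreviation "tZ \<equiv> 0 :: nat"
abbreviation "tU \<equiv> Suc 0"
abbreviation "tJ \<equiv> Suc (Suc 0)"
abbreviation "tI \<equiv> Suc (Suc (Suc 0))"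
abbreviation "tT \<equiv> Suc (Suc (Suc (Suc 0)))"

text \<open>Deletes the last digit and does nothing on an empty tape, like subtraction on natural
  numbers.\<close>

definition erase :: "token cmd" where
  "erase = Cond (\<lambda>_ ws. ws ! tZ \<noteq> 3) (touch tZ (\<lambda>_. 0) MoveLeft) skip"

definition count_input :: "token cmd" where
  "count_input = init_tapes ;; advance_input ;;
     While (\<lambda>a _. a \<noteq> RightEnd) (increment tZ ;; advance_input)"

text \<open>The digits of n are counted in binary on \<open>tT\<close>, which thereby gets
  \<open>field_width n\<close> digits. Two digits of \<open>tZ\<close> are erased per digit of
  \<open>tT\<close>, and then three more, which leaves \<open>addr_width n\<close> of them.\<close>

definition compute_widths :: "token cmd" where
  "compute_widths = right tZ ;; scan tZ (increment tT) ;; touch tZ id MoveLeft ;;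
     right tT ;; scan tT (erase ;; erase) ;; home tT ;; erase ;; erase ;; erase ;; home tZ"

text \<open>Lengths are copied in unary, from \<open>tZ\<close> to the tapes of u and j and from
  \<open>tT\<close> to that of i, and everything is set to zero.\<close>

definition make_fields :: "token cmd" where
  "make_fields = right tZ ;; right tU ;; right tJ ;;
     scan tZ (touch tU (\<lambda>_. 1) MoveRight ;; touch tJ (\<lambda>_. 1) MoveRight) ;;
     home tZ ;; home tU ;; home tJ ;; reset tZ ;;
     right tT ;; right tI ;; scan tT (touch tI (\<lambda>_. 1) MoveRight) ;; home tT ;; home tI ;; reset tT"

text \<open>The enclosing scans keep the head of \<open>tU\<close> on bit t of u and that of
  \<open>tZ\<close> on bit i of z; the sign of the literal and the bit b of its index are read off
  there.\<close>

definition literal_cmd :: "token cmd" where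
  "literal_cmd = put (\<lambda>ws. if ws ! tU = 2 then PosTok else NegTok) ;; print tJ ;;
     put (\<lambda>ws. BitTok (ws ! tZ = 2)) ;; print tI ;; print tT ;; put (\<lambda>_. BitTok True) ;; increment tT"

text \<open>The two moves on \<open>tU\<close> and the increment of \<open>tT\<close> skip bit 0:
  the scan starts at bit 1 with t = 1.\<close>

definition cell_cmd :: "token cmd" where
  "cell_cmd = put (\<lambda>_. AndTok) ;; right tU ;; increment tT ;; right tU ;; scan tU literal_cmd ;;
     home tU ;; reset tT ;; put (\<lambda>_. EndTok)"

definition value_cmd :: "token cmd" where
  "value_cmd = put (\<lambda>_. OrTok) ;; for_all tJ cell_cmd ;; put (\<lambda>_. EndTok)"

definition row_cmd :: "token cmd" where
  "row_cmd = put (\<lambda>_. AndTok) ;; put (\<lambda>_. PosTok) ;; print tZ ;; put (\<lambda>_. BitTok True) ;;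
     right tZ ;; scan tZ (for_all tU value_cmd ;; increment tI) ;; home tZ ;; reset tI ;; put (\<lambda>_. EndTok)"

definition formula_cmd :: "token cmd" where
  "formula_cmd = put (\<lambda>_. OrTok) ;; for_all tZ row_cmd ;; put (\<lambda>_. EndTok)"

text \<open>A blank in cell 1 or cell 2 of \<open>tZ\<close> means an address width below 2. The
  output is then the code of variable 0, whose index has no digits.\<close>

definition program :: "token cmd" where
  "program = count_input ;; compute_widths ;; make_fields ;; right tZ ;;
     Cond (\<lambda>_ ws. ws ! tZ = 0) (put (\<lambda>_. PosTok))
       (right tZ ;; Cond (\<lambda>_ ws. ws ! tZ = 0) (put (\<lambda>_. PosTok)) (home tZ ;; formula_cmd))"

lemma wf_program: "wf_cmd 4 5 program"
proof -
  have touch: "wf_cmd 4 5 (touch k g m)" if "k < 5" "\<And>a. a < 4 \<Longrightarrow> g a < 4" for k g m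
  proof -
    have "fst ` set ((map (\<lambda>s. (s, Stay)) ws)[k := (g (ws ! k), m)]) \<subseteq> {..<4}"
      if "length ws = 5" "set ws \<subseteq> {..<4}" for ws
    proof -
      have "ws ! k < 4" 
        using subsetD[OF that(2) nth_mem[of k ws]] that(1) \<open>k < 5\<close> by simp
      then show ?thesis
        using that set_update_subset_insert[of "map (\<lambda>s. (s, Stay)) ws" k "(g (ws ! k), m)"]
          \<open>\<And>a. a < 4 \<Longrightarrow> g a < 4\<close> by fastforce
    qed
    then show ?thesis by (auto simp: touch_def wf_act_def)
  qed
  show ?thesis
    unfolding program_def count_input_def compute_widths_def make_fields_def formula_cmd_def row_cmd_def
      value_cmd_def cell_cmd_def literal_cmd_def erase_def home_def scan_def carry_def increment_def
      reset_def print_def for_all_def wf_cmd.simps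
    by (intro conjI touch) (auto simp: put_def skip_def advance_input_def init_tapes_def wf_act_def)
qed

lemma tape_bit: "i < length bs \<Longrightarrow> (tape bs (Suc i) = 2) = bs ! i"
  by (simp add: tape_def)

lemma concat_map_Nil: "concat (map (\<lambda>_. []) xs) = []"
  by (induction xs) auto

lemma counter_Suc: "counter w (Suc i) = binc (counter w i)"
  by (simp add: counter_def)

lemma length_binary_mono: "i \<le> m \<Longrightarrow> length (binary i) \<le> length (binary m)"
proof (induction m rule: dec_induct)
  case (step m)
  have "length bs \<le> length (binc bs)" for bs by (induction bs) auto
  then show ?case using step(3) unfolding binc_binary[symmetric] by (meson order_trans)
qed simp

lemma binary_Suc: "binary (Suc i) = binc (binary i)"
  by (simp add: binc_binary)

lemma length_butlast_pow: "length ((butlast ^^ m) z) = length z - m"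
  by (induction m) auto

section \<open>Runs of the formula printer\<close>

context space
begin

text \<open>In this and the following rules the final state is a variable constrained by an
  equation, so that they apply to a target written in any form.\<close>

lemma put_to: "out' = out @ [f (syms l)] \<Longrightarrow> runs (put f) (h, l, out) (h, l, out')"
  using runs_put by simp

lemma right_to:
  "k < length l \<Longrightarrow> Suc (snd (l ! k)) < s \<Longrightarrow> l' = l[k := (fst (l ! k), Suc (snd (l ! k)))] \<Longrightarrow>
   runs (right k) (h, l, out) (h, l', out)"
  using runs_right[of k l "fst (l ! k)" "snd (l ! k)"] by simp

lemma home_to:
  "k < length l \<Longrightarrow> snd (l ! k) < s \<Longrightarrow> l' = l[k := (fst (l ! k), 0)] \<Longrightarrow>
   runs (home k) (h, l, out) (h, l', out)"
  using runs_home[of k l "fst (l ! k)" "snd (l ! k)"] by simp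

lemma print_to:
  "k < length l \<Longrightarrow> snd (l ! k) = 0 \<Longrightarrow> Suc (length (fst (l ! k))) < s \<Longrightarrow>
   out' = out @ map BitTok (fst (l ! k)) \<Longrightarrow> runs (print k) (h, l, out) (h, l, out')"
  using runs_print[of k l "fst (l ! k)"] by (simp add: prod_eq_iff)

lemma increment_to:
  "k < length l \<Longrightarrow> snd (l ! k) = 0 \<Longrightarrow> Suc (length (fst (l ! k))) < s \<Longrightarrow>
   l' = l[k := (binc (fst (l ! k)), 0)] \<Longrightarrow> runs (increment k) (h, l, out) (h, l', out)"
  using runs_increment[of k l "fst (l ! k)"] by (simp add: prod_eq_iff)

lemma reset_to:
  "k < length l \<Longrightarrow> snd (l ! k) = 0 \<Longrightarrow> Suc (length (fst (l ! k))) < s \<Longrightarrow>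
   l' = l[k := (replicate (length (fst (l ! k))) False, 0)] \<Longrightarrow> runs (reset k) (h, l, out) (h, l', out)"
  using runs_reset[of k l "fst (l ! k)"] by (simp add: prod_eq_iff)

lemma extend_to:
  "k < length l \<Longrightarrow> snd (l ! k) = Suc (length (fst (l ! k))) \<Longrightarrow> Suc (snd (l ! k)) < s \<Longrightarrow>
   l' = l[k := (fst (l ! k) @ [False], Suc (snd (l ! k)))] \<Longrightarrow>
   runs (touch k (\<lambda>_. 1) MoveRight) (h, l, out) (h, l', out)"
  using runs_touch[of k l "fst (l ! k)" "snd (l ! k)" "\<lambda>_. 1" "fst (l ! k) @ [False]" MoveRight]
    tape_extend[of "fst (l ! k)" False] by (simp add: prod_eq_iff)

lemma runs_literal:
  assumes "Suc r < s" "Suc w < s" "r < 2 ^ w" "length z = r" "length u = r" "length j = r" "i < r" "t < r"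
  shows "runs literal_cmd
    (h, [(z, Suc i), (u, Suc t), (j, 0), (counter w i, 0), (counter w t, 0)], out)
    (h, [(z, Suc i), (u, Suc t), (j, 0), (counter w i, 0), (counter w (Suc t), 0)],
     out @ lit_code ((if u ! t then Pos else Neg) (xvar w ((i, z ! i), j, t))))"
proof -
  let ?l = "[(z, Suc i), (u, Suc t), (j, 0), (counter w i, 0), (counter w t, 0)]"
  have len: "length (counter w i) = w" "length (counter w t) = w" using assms by (auto intro: length_counter)
  define o1 where "o1 = out @ [if u ! t then PosTok else NegTok]"
  define o2 where "o2 = o1 @ map BitTok j"
  define o3 where "o3 = o2 @ [BitTok (z ! i)]"
  define o4 where "o4 = o3 @ map BitTok (counter w i)"
  define o5 where "o5 = o4 @ map BitTok (counter w t)"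
  define o6 where "o6 = o5 @ [BitTok True]"
  have 1: "runs (put (\<lambda>ws. if ws ! tU = 2 then PosTok else NegTok)) (h, ?l, out) (h, ?l, o1)"
    by (rule put_to) (use assms in \<open>simp add: o1_def syms_def tape_bit\<close>)
  have 2: "runs (print tJ) (h, ?l, o1) (h, ?l, o2)"
    by (rule print_to) (use assms in \<open>simp_all add: o2_def\<close>)
  have 3: "runs (put (\<lambda>ws. BitTok (ws ! tZ = 2))) (h, ?l, o2) (h, ?l, o3)"
    by (rule put_to) (use assms in \<open>simp add: o3_def syms_def tape_bit\<close>)
  have 4: "runs (print tI) (h, ?l, o3) (h, ?l, o4)"
    by (rule print_to) (use assms len in \<open>simp_all add: o4_def\<close>)
  have 5: "runs (print tT) (h, ?l, o4) (h, ?l, o5)"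
    by (rule print_to) (use assms len in \<open>simp_all add: o5_def\<close>)
  have 6: "runs (put (\<lambda>_. BitTok True)) (h, ?l, o5) (h, ?l, o6)"
    by (rule put_to) (simp add: o6_def)
  have 7: "runs (increment tT) (h, ?l, o6)
      (h, [(z, Suc i), (u, Suc t), (j, 0), (counter w i, 0), (counter w (Suc t), 0)], o6)"
    by (rule increment_to) (use assms len in \<open>simp_all add: counter_Suc\<close>)
  have "o6 = out @ lit_code ((if u ! t then Pos else Neg) (xvar w ((i, z ! i), j, t)))"
    by (simp add: o6_def o5_def o4_def o3_def o2_def o1_def binary_xvar)
  then show ?thesis unfolding literal_cmd_def
    using runs_Seq[OF 1 runs_Seq[OF 2 runs_Seq[OF 3 runs_Seq[OF 4 runs_Seq[OF 5 runs_Seq[OF 6 7]]]]]] by simp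
qed

lemma runs_cell:
  assumes "Suc r < s" "Suc w < s" "2 \<le> r" "r < 2 ^ w" "length z = r" "length u = r" "length j = r" "i < r"
  shows "runs cell_cmd
    (h, [(z, Suc i), (u, 0), (j, 0), (counter w i, 0), (replicate w False, 0)], out)
    (h, [(z, Suc i), (u, 0), (j, 0), (counter w i, 0), (replicate w False, 0)],
     out @ uformula_code (cell_formula r w (i, z ! i) u j))"
proof -
  define L where "L t = [(z, Suc i), (u, Suc t), (j, 0), (counter w i, 0), (counter w t, 0)]" for t
  let ?l = "[(z, Suc i), (u, 0), (j, 0), (counter w i, 0), (replicate w False, 0)]"
  let ?f = "\<lambda>t. lit_code ((if u ! t then Pos else Neg) (xvar w ((i, z ! i), j, t)))"
  have w0: "replicate w False = counter w 0" by (simp add: counter_def)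
  have len: "length (counter w r) = w" using assms by (auto intro: length_counter)
  define o1 where "o1 = out @ [AndTok]"
  define o2 where "o2 = o1 @ concat (map ?f [1..<r])"
  have 1: "runs (put (\<lambda>_. AndTok)) (h, ?l, out) (h, ?l, o1)" by (rule put_to) (simp add: o1_def)
  have 2: "runs (right tU) (h, ?l, o1) (h, [(z, Suc i), (u, 1), (j, 0), (counter w i, 0), (replicate w False, 0)], o1)"
    by (rule right_to) (use assms in simp_all)
  have 3: "runs (increment tT) (h, [(z, Suc i), (u, 1), (j, 0), (counter w i, 0), (replicate w False, 0)], o1)
      (h, [(z, Suc i), (u, 1), (j, 0), (counter w i, 0), (counter w 1, 0)], o1)"
    by (rule increment_to) (use assms in \<open>simp_all add: w0 counter_Suc length_counter\<close>)
  have 4: "runs (right tU) (h, [(z, Suc i), (u, 1), (j, 0), (counter w i, 0), (counter w 1, 0)], o1) (h, L 1, o1)"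
    by (rule right_to) (use assms in \<open>simp_all add: L_def\<close>)
  have 5: "runs (scan tU literal_cmd) (h, L 1, o1) (h, L r, o2)"
    unfolding o2_def
  proof (rule runs_scan)
    show "tU < length (L t) \<and> L t ! tU = (u, Suc t)" for t by (simp add: L_def)
    fix t out assume t: "t < r"
    have "(L (Suc t))[tU := (u, Suc t)] = [(z, Suc i), (u, Suc t), (j, 0), (counter w i, 0), (counter w (Suc t), 0)]"
      by (simp add: L_def)
    then show "runs literal_cmd (h, L t, out) (h, (L (Suc t))[tU := (u, Suc t)], out @ ?f t)"
      using runs_literal[of r w z u j i t h out] assms t unfolding L_def by simp
  qed (use assms in auto)
  have 6: "runs (home tU) (h, L r, o2) (h, [(z, Suc i), (u, 0), (j, 0), (counter w i, 0), (counter w r, 0)], o2)"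
    by (rule home_to) (use assms in \<open>simp_all add: L_def\<close>)
  have 7: "runs (reset tT) (h, [(z, Suc i), (u, 0), (j, 0), (counter w i, 0), (counter w r, 0)], o2) (h, ?l, o2)"
    by (rule reset_to) (use assms len in simp_all)
  have 8: "runs (put (\<lambda>_. EndTok)) (h, ?l, o2) (h, ?l, o2 @ [EndTok])" by (rule put_to) simp
  have "o2 @ [EndTok] = out @ uformula_code (cell_formula r w (i, z ! i) u j)"
    by (simp add: o2_def o1_def cell_formula_def comp_def)
  then show ?thesis unfolding cell_cmd_def
    using runs_Seq[OF 1 runs_Seq[OF 2 runs_Seq[OF 3 runs_Seq[OF 4 runs_Seq[OF 5 runs_Seq[OF 6 runs_Seq[OF 7 8]]]]]]] by simp
qed

lemma runs_value:
  assumes "Suc r < s" "Suc w < s" "2 \<le> r" "r < 2 ^ w" "length z = r" "length u = r" "i < r"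
  shows "runs value_cmd
    (h, [(z, Suc i), (u, 0), (replicate r False, 0), (counter w i, 0), (replicate w False, 0)], out)
    (h, [(z, Suc i), (u, 0), (replicate r False, 0), (counter w i, 0), (replicate w False, 0)],
     out @ uformula_code (value_formula r w (i, z ! i) u))"
proof -
  let ?l = "[(z, Suc i), (u, 0), (replicate r False, 0), (counter w i, 0), (replicate w False, 0)]"
  let ?f = "\<lambda>j. uformula_code (cell_formula r w (i, z ! i) u j)"
  have 1: "runs (put (\<lambda>_. OrTok)) (h, ?l, out) (h, ?l, out @ [OrTok])" by (rule put_to) simp
  have 2: "runs (for_all tJ cell_cmd) (h, ?l, out @ [OrTok]) (h, ?l, (out @ [OrTok]) @ concat (map ?f (all_bits r)))"
  proof (rule runs_for_all)
    fix v out assume "v < (2 :: nat) ^ r"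
    then show "runs cell_cmd (h, ?l[tJ := (counter r v, 0)], out)
        (h, ?l[tJ := (counter r v, 0)], out @ ?f (counter r v))"
      using runs_cell[of r w z u "counter r v" i h out] assms by (simp add: length_counter)
  qed (use assms in auto)
  have 3: "runs (put (\<lambda>_. EndTok)) (h, ?l, (out @ [OrTok]) @ concat (map ?f (all_bits r)))
      (h, ?l, out @ uformula_code (value_formula r w (i, z ! i) u))"
    by (rule put_to) (simp add: value_formula_def comp_def)
  show ?thesis unfolding value_cmd_def by (rule runs_Seq[OF 1 runs_Seq[OF 2 3]])
qed

lemma runs_row:
  assumes "Suc r < s" "Suc w < s" "2 \<le> r" "r < 2 ^ w" "length z = r"
  shows "runs row_cmd
    (h, [(z, 0), (replicate r False, 0), (replicate r False, 0), (replicate w False, 0), (replicate w False, 0)], out)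
    (h, [(z, 0), (replicate r False, 0), (replicate r False, 0), (replicate w False, 0), (replicate w False, 0)],
     out @ uformula_code (row_formula r w z))"
proof -
  let ?l = "[(z, 0), (replicate r False, 0), (replicate r False, 0), (replicate w False, 0), (replicate w False, 0)]"
  define L where "L i = [(z, Suc i), (replicate r False, 0), (replicate r False, 0), (counter w i, 0), (replicate w False, 0)]" for i
  let ?f = "\<lambda>i. concat (map (\<lambda>u. uformula_code (value_formula r w (i, z ! i) u)) (all_bits r))"
  define o1 where "o1 = out @ [AndTok]"
  define o2 where "o2 = o1 @ [PosTok]"
  define o3 where "o3 = o2 @ map BitTok z"
  define o4 where "o4 = o3 @ [BitTok True]"
  define o5 where "o5 = o4 @ concat (map ?f [0..<r])"
  have w0: "replicate w False = counter w 0" by (simp add: counter_def)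
  have len: "length (counter w i) = w" if "i \<le> r" for i using that assms by (auto intro: length_counter)
  have 1: "runs (put (\<lambda>_. AndTok)) (h, ?l, out) (h, ?l, o1)" by (rule put_to) (simp add: o1_def)
  have 2: "runs (put (\<lambda>_. PosTok)) (h, ?l, o1) (h, ?l, o2)" by (rule put_to) (simp add: o2_def)
  have 3: "runs (print tZ) (h, ?l, o2) (h, ?l, o3)" by (rule print_to) (use assms in \<open>simp_all add: o3_def\<close>)
  have 4: "runs (put (\<lambda>_. BitTok True)) (h, ?l, o3) (h, ?l, o4)" by (rule put_to) (simp add: o4_def)
  have 5: "runs (right tZ) (h, ?l, o4) (h, L 0, o4)"
    by (rule right_to) (use assms in \<open>simp_all add: L_def counter_def\<close>)
  have 6: "runs (scan tZ (for_all tU value_cmd ;; increment tI)) (h, L 0, o4) (h, L r, o5)"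
    unfolding o5_def
  proof (rule runs_scan)
    show "tZ < length (L i) \<and> L i ! tZ = (z, Suc i)" for i by (simp add: L_def)
    fix i out assume i: "i < r"
    have a: "runs (for_all tU value_cmd) (h, L i, out) (h, L i, out @ ?f i)"
    proof (rule runs_for_all)
      fix v out assume "v < (2 :: nat) ^ r"
      then show "runs value_cmd (h, (L i)[tU := (counter r v, 0)], out)
          (h, (L i)[tU := (counter r v, 0)], out @ uformula_code (value_formula r w (i, z ! i) (counter r v)))"
        using runs_value[of r w z "counter r v" i h out] assms i by (simp add: length_counter L_def)
    qed (use assms in \<open>auto simp: L_def\<close>)
    have b: "runs (increment tI) (h, L i, out') (h, (L (Suc i))[tZ := (z, Suc i)], out')" for out'
      by (rule increment_to) (use assms i len[of i] in \<open>simp_all add: L_def counter_Suc\<close>)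
    show "runs (for_all tU value_cmd ;; increment tI) (h, L i, out) (h, (L (Suc i))[tZ := (z, Suc i)], out @ ?f i)"
      by (rule runs_Seq[OF a b])
  qed (use assms in auto)
  have 7: "runs (home tZ) (h, L r, o5) (h, (L r)[tZ := (z, 0)], o5)"
    by (rule home_to) (use assms in \<open>simp_all add: L_def\<close>)
  have 8: "runs (reset tI) (h, (L r)[tZ := (z, 0)], o5) (h, ?l, o5)"
    by (rule reset_to) (use assms len[of r] in \<open>simp_all add: L_def\<close>)
  have 9: "runs (put (\<lambda>_. EndTok)) (h, ?l, o5) (h, ?l, o5 @ [EndTok])" by (rule put_to) simp
  have "concat (concat xss) = concat (map concat xss)" for xss :: "token list list list"
    by (induction xss) auto
  then have "o5 @ [EndTok] = out @ uformula_code (row_formula r w z)"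
    by (simp add: o5_def o4_def o3_def o2_def o1_def row_formula_def binary_fvar map_concat comp_def)
  then show ?thesis unfolding row_cmd_def
    using runs_Seq[OF 1 runs_Seq[OF 2 runs_Seq[OF 3 runs_Seq[OF 4 runs_Seq[OF 5 runs_Seq[OF 6 runs_Seq[OF 7 runs_Seq[OF 8 9]]]]]]]] by simp
qed

lemma runs_formula:
  assumes "Suc r < s" "Suc w < s" "2 \<le> r" "r < 2 ^ w"
  shows "runs formula_cmd
    (h, [(replicate r False, 0), (replicate r False, 0), (replicate r False, 0), (replicate w False, 0), (replicate w False, 0)], out)
    (h, [(replicate r False, 0), (replicate r False, 0), (replicate r False, 0), (replicate w False, 0), (replicate w False, 0)],
     out @ uformula_code (UOr (map (row_formula r w) (all_bits r))))"
proof -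
  let ?l = "[(replicate r False, 0), (replicate r False, 0), (replicate r False, 0), (replicate w False, 0), (replicate w False, 0)]"
  let ?f = "\<lambda>z. uformula_code (row_formula r w z)"
  have 1: "runs (put (\<lambda>_. OrTok)) (h, ?l, out) (h, ?l, out @ [OrTok])" by (rule put_to) simp
  have 2: "runs (for_all tZ row_cmd) (h, ?l, out @ [OrTok]) (h, ?l, (out @ [OrTok]) @ concat (map ?f (all_bits r)))"
  proof (rule runs_for_all)
    fix v out assume "v < (2 :: nat) ^ r"
    then show "runs row_cmd (h, ?l[tZ := (counter r v, 0)], out)
        (h, ?l[tZ := (counter r v, 0)], out @ ?f (counter r v))"
      using runs_row[of r w "counter r v" h out] assms by (simp add: length_counter)
  qed (use assms in auto)
  have 3: "runs (put (\<lambda>_. EndTok)) (h, ?l, (out @ [OrTok]) @ concat (map ?f (all_bits r)))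
      (h, ?l, out @ uformula_code (UOr (map (row_formula r w) (all_bits r))))"
    by (rule put_to) (simp add: comp_def)
  show ?thesis unfolding formula_cmd_def by (rule runs_Seq[OF 1 runs_Seq[OF 2 3]])
qed

lemma erase_to:
  assumes "fst (l ! 0) = z" "snd (l ! 0) = length z" "0 < length l" "length z < s"
    and "l' = l[0 := (butlast z, length (butlast z))]"
  shows "runs erase (h, l, out) (h, l', out)"
  unfolding erase_def
proof (rule runs_Cond)
  have l0: "l ! 0 = (z, length z)" using assms by (simp add: prod_eq_iff)
  have cur: "syms l ! tZ = tape z (length z)" using nth_syms[OF assms(3) l0] .
  show "runs (touch tZ (\<lambda>_. 0) MoveLeft) (h, l, out) (h, l', out)" if "syms l ! tZ \<noteq> 3"
  proof -
    have "z \<noteq> []" using that cur by auto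
    then obtain ps b where z: "z = ps @ [b]" by (cases z rule: rev_cases) auto
    show ?thesis
      using runs_touch[of 0 l z "length z" "\<lambda>_. 0" ps MoveLeft h out] tape_erase[of ps b] assms l0
      by (simp add: z)
  qed
  show "runs skip (h, l, out) (h, l', out)" if "\<not> syms l ! tZ \<noteq> 3"
  proof -
    have "z = []" using that cur by simp
    then have "l' = l" using assms l0 by (simp add: list_update_same_conv)
    then show ?thesis using runs_skip by simp
  qed
qed

lemma runs_count_loop:
  assumes "x = replicate n True" "i \<le> n" "Suc (length (binary n)) < s"
  shows "runs (While (\<lambda>a _. a \<noteq> RightEnd) (increment tZ ;; advance_input))
    (Suc i, (binary i, 0) # l, out) (Suc n, (binary n, 0) # l, out)"
  using assms(2)
proof (induction "n - i" arbitrary: i)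
  case 0
  then have i: "i = n" by simp
  have "read_input x (Suc n) = RightEnd" using assms(1) by (simp add: read_input_def)
  then show ?case unfolding i by (intro runs_While_False) simp
next
  case (Suc d)
  then have i: "i < n" by simp
  have 1: "runs (increment tZ) (Suc i, (binary i, 0) # l, out) (Suc i, (binary (Suc i), 0) # l, out)"
    by (rule increment_to) (use i assms(3) length_binary_mono[of i n] in \<open>simp_all add: binary_Suc\<close>)
  have 2: "runs advance_input (Suc i, (binary (Suc i), 0) # l, out) (Suc (Suc i), (binary (Suc i), 0) # l, out)"
    by (rule runs_advance) (use i assms(1) in simp)
  have 3: "runs (While (\<lambda>a _. a \<noteq> RightEnd) (increment tZ ;; advance_input))
      (Suc (Suc i), (binary (Suc i), 0) # l, out) (Suc n, (binary n, 0) # l, out)"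
    using Suc i by (intro Suc.hyps(1)) auto
  show ?case
    by (rule runs_While_True[OF _ runs_Seq[OF 1 2] 3]) (use i assms(1) in \<open>simp add: read_input_def\<close>)
qed

text \<open>Only the length of the remaining digits matters, since \<open>make_fields\<close>
  overwrites them.\<close>

lemma runs_compute_widths:
  assumes "Suc (bit_length n) < s" "Suc (field_width n) < s"
  shows "\<exists>z. length z = addr_width n \<and> runs compute_widths
    (h, [(binary n, 0), ([], 0), ([], 0), ([], 0), ([], 0)], out)
    (h, [(z, 0), ([], 0), ([], 0), ([], 0), (binary (bit_length n), 0)], out)"
proof -
  define b where "b = binary n"
  define m where "m = bit_length n"
  define c where "c = binary m"
  define v where "v = field_width n"
  have lb: "length b = m" and lc: "length c = v"
    by (simp_all add: b_def m_def c_def v_def bit_length_def field_width_def)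
  have sm: "Suc m < s" "Suc v < s" using assms by (auto simp: m_def v_def)
  define E where "E i = (butlast ^^ i) b" for i
  have lE: "length (E i) = m - i" for i by (simp add: E_def length_butlast_pow lb)
  have ES: "butlast (E i) = E (Suc i)" for i by (simp add: E_def)
  define L where "L i = [(b, Suc i), ([], 0), ([], 0), ([], 0), (binary i, 0)]" for i
  define K where "K i = [(E (2 * i), m - 2 * i), ([], 0), ([], 0), ([], 0), (c, Suc i)]" for i
  define P where "P i p = [(E i, p), ([], 0), ([], 0), ([], 0), (c, 0)]" for i and p :: nat
  have 1: "runs (right tZ) (h, [(b, 0), ([], 0), ([], 0), ([], 0), ([], 0)], out) (h, L 0, out)"
    by (rule right_to) (use sm in \<open>simp_all add: L_def\<close>)
  have "runs (scan tZ (increment tT)) (h, L 0, out) (h, L m, out @ concat (map (\<lambda>_. []) [0..<m]))"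
  proof (rule runs_scan)
    show "tZ < length (L i) \<and> L i ! tZ = (b, Suc i)" for i by (simp add: L_def)
    fix i out assume i: "i < m"
    have "length (binary i) \<le> v" using length_binary_mono[of i m] i lc by (simp add: c_def)
    then show "runs (increment tT) (h, L i, out) (h, (L (Suc i))[tZ := (b, Suc i)], out @ [])"
      using sm by (intro increment_to[where l = "L i", THEN runs_eq[where b' = "(h, _, out @ [])"]])
        (simp_all add: L_def binary_Suc)
  qed (use lb sm in auto)
  then have 2: "runs (scan tZ (increment tT)) (h, L 0, out) (h, L m, out)" by (simp only: concat_map_Nil append_Nil2)
  have 3: "runs (touch tZ id MoveLeft) (h, L m, out) (h, [(b, m), ([], 0), ([], 0), ([], 0), (c, 0)], out)"
    using runs_touch[of tZ "L m" b "Suc m" id b MoveLeft h out] sm by (simp add: L_def c_def)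
  have 4: "runs (right tT) (h, [(b, m), ([], 0), ([], 0), ([], 0), (c, 0)], out) (h, K 0, out)"
    by (rule right_to) (use sm in \<open>simp_all add: K_def E_def\<close>)
  have "runs (scan tT (erase ;; erase)) (h, K 0, out) (h, K v, out @ concat (map (\<lambda>_. []) [0..<v]))"
  proof (rule runs_scan)
    show "tT < length (K i) \<and> K i ! tT = (c, Suc i)" for i by (simp add: K_def)
    fix i out assume i: "i < v"
    let ?K = "[(E (Suc (2 * i)), m - Suc (2 * i)), ([], 0), ([], 0), ([], 0), (c, Suc i)]"
    have a: "runs erase (h, K i, out) (h, ?K, out)"
      by (rule erase_to[where z = "E (2 * i)"]) (use sm in \<open>simp_all add: K_def lE ES del: length_butlast\<close>)
    have b: "runs erase (h, ?K, out) (h, (K (Suc i))[tT := (c, Suc i)], out)"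
      by (rule erase_to[where z = "E (Suc (2 * i))"]) (use sm in \<open>simp_all add: K_def lE ES del: length_butlast\<close>)
    show "runs (erase ;; erase) (h, K i, out) (h, (K (Suc i))[tT := (c, Suc i)], out @ [])"
      using runs_Seq[OF a b] by simp
  qed (use lc sm in auto)
  then have 5: "runs (scan tT (erase ;; erase)) (h, K 0, out) (h, K v, out)" by (simp only: concat_map_Nil append_Nil2)
  have 6: "runs (home tT) (h, K v, out) (h, P (2 * v) (m - 2 * v), out)"
    by (rule home_to) (use sm in \<open>simp_all add: K_def P_def\<close>)
  have e: "runs erase (h, P i (m - i), out) (h, P (Suc i) (m - Suc i), out)" for i
    by (rule erase_to[where z = "E i"]) (use sm in \<open>simp_all add: P_def lE ES del: length_butlast\<close>)
  let ?r = "Suc (Suc (Suc (2 * v)))"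
  have 7: "runs (home tZ) (h, P ?r (m - ?r), out) (h, P ?r 0, out)"
    by (rule home_to) (use sm in \<open>simp_all add: P_def\<close>)
  have "runs compute_widths (h, [(b, 0), ([], 0), ([], 0), ([], 0), ([], 0)], out) (h, P ?r 0, out)"
    unfolding compute_widths_def
    by (rule runs_Seq[OF 1 runs_Seq[OF 2 runs_Seq[OF 3 runs_Seq[OF 4 runs_Seq[OF 5 runs_Seq[OF 6
          runs_Seq[OF e runs_Seq[OF e runs_Seq[OF e 7]]]]]]]]])
  moreover have "length (E ?r) = addr_width n" by (simp add: lE addr_width_def m_def v_def)
  ultimately show ?thesis unfolding P_def b_def c_def m_def by blast
qed

lemma runs_make_fields:
  assumes "length z = r" "length c = w" "Suc r < s" "Suc w < s"
  shows "runs make_fields (h, [(z, 0), ([], 0), ([], 0), ([], 0), (c, 0)], out)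
    (h, [(replicate r False, 0), (replicate r False, 0), (replicate r False, 0),
         (replicate w False, 0), (replicate w False, 0)], out)"
proof -
  define L where "L i = [(z, Suc i), (replicate i False, Suc i), (replicate i False, Suc i), ([], 0), (c, 0)]" for i
  let ?R = "replicate r False" and ?W = "replicate w False"
  define K where "K i = [(?R, 0), (?R, 0), (?R, 0), (replicate i False, Suc i), (c, Suc i)]" for i
  have rep: "replicate i False @ [False] = replicate (Suc i) False" for i
    by (simp add: replicate_append_same)
  have 1: "runs (right tZ) (h, [(z, 0), ([], 0), ([], 0), ([], 0), (c, 0)], out)
      (h, [(z, 1), ([], 0), ([], 0), ([], 0), (c, 0)], out)"
    by (rule right_to) (use assms in simp_all)
  have 2: "runs (right tU) (h, [(z, 1), ([], 0), ([], 0), ([], 0), (c, 0)], out)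
      (h, [(z, 1), ([], 1), ([], 0), ([], 0), (c, 0)], out)"
    by (rule right_to) (use assms in simp_all)
  have 3: "runs (right tJ) (h, [(z, 1), ([], 1), ([], 0), ([], 0), (c, 0)], out) (h, L 0, out)"
    by (rule right_to) (use assms in \<open>simp_all add: L_def\<close>)
  have "runs (scan tZ (touch tU (\<lambda>_. 1) MoveRight ;; touch tJ (\<lambda>_. 1) MoveRight)) (h, L 0, out)
      (h, L r, out @ concat (map (\<lambda>_. []) [0..<r]))"
  proof (rule runs_scan)
    show "tZ < length (L i) \<and> L i ! tZ = (z, Suc i)" for i by (simp add: L_def)
    fix i out assume i: "i < r"
    let ?M = "[(z, Suc i), (replicate (Suc i) False, Suc (Suc i)), (replicate i False, Suc i), ([], 0), (c, 0)]"
    have a: "runs (touch tU (\<lambda>_. 1) MoveRight) (h, L i, out) (h, ?M, out)"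
      by (rule extend_to) (use assms i in \<open>simp_all add: L_def rep del: replicate_Suc\<close>)
    have b: "runs (touch tJ (\<lambda>_. 1) MoveRight) (h, ?M, out) (h, (L (Suc i))[tZ := (z, Suc i)], out)"
      by (rule extend_to) (use assms i in \<open>simp_all add: L_def rep del: replicate_Suc\<close>)
    show "runs (touch tU (\<lambda>_. 1) MoveRight ;; touch tJ (\<lambda>_. 1) MoveRight) (h, L i, out)
        (h, (L (Suc i))[tZ := (z, Suc i)], out @ [])"
      using runs_Seq[OF a b] by simp
  qed (use assms in auto)
  then have 4: "runs (scan tZ (touch tU (\<lambda>_. 1) MoveRight ;; touch tJ (\<lambda>_. 1) MoveRight)) (h, L 0, out) (h, L r, out)"
    by (simp only: concat_map_Nil append_Nil2)
  have 5: "runs (home tZ) (h, L r, out) (h, [(z, 0), (?R, Suc r), (?R, Suc r), ([], 0), (c, 0)], out)"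
    by (rule home_to) (use assms in \<open>simp_all add: L_def\<close>)
  have 6: "runs (home tU) (h, [(z, 0), (?R, Suc r), (?R, Suc r), ([], 0), (c, 0)], out)
      (h, [(z, 0), (?R, 0), (?R, Suc r), ([], 0), (c, 0)], out)"
    by (rule home_to) (use assms in simp_all)
  have 7: "runs (home tJ) (h, [(z, 0), (?R, 0), (?R, Suc r), ([], 0), (c, 0)], out)
      (h, [(z, 0), (?R, 0), (?R, 0), ([], 0), (c, 0)], out)"
    by (rule home_to) (use assms in simp_all)
  have 8: "runs (reset tZ) (h, [(z, 0), (?R, 0), (?R, 0), ([], 0), (c, 0)], out)
      (h, [(?R, 0), (?R, 0), (?R, 0), ([], 0), (c, 0)], out)"
    by (rule reset_to) (use assms in simp_all)
  have 9: "runs (right tT) (h, [(?R, 0), (?R, 0), (?R, 0), ([], 0), (c, 0)], out)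
      (h, [(?R, 0), (?R, 0), (?R, 0), ([], 0), (c, 1)], out)"
    by (rule right_to) (use assms in simp_all)
  have 10: "runs (right tI) (h, [(?R, 0), (?R, 0), (?R, 0), ([], 0), (c, 1)], out) (h, K 0, out)"
    by (rule right_to) (use assms in \<open>simp_all add: K_def\<close>)
  have "runs (scan tT (touch tI (\<lambda>_. 1) MoveRight)) (h, K 0, out) (h, K w, out @ concat (map (\<lambda>_. []) [0..<w]))"
  proof (rule runs_scan)
    show "tT < length (K i) \<and> K i ! tT = (c, Suc i)" for i by (simp add: K_def)
    fix i out assume i: "i < w"
    have "runs (touch tI (\<lambda>_. 1) MoveRight) (h, K i, out) (h, (K (Suc i))[tT := (c, Suc i)], out)"
      by (rule extend_to) (use assms i in \<open>simp_all add: K_def rep del: replicate_Suc\<close>)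
    then show "runs (touch tI (\<lambda>_. 1) MoveRight) (h, K i, out) (h, (K (Suc i))[tT := (c, Suc i)], out @ [])" by simp
  qed (use assms in auto)
  then have 11: "runs (scan tT (touch tI (\<lambda>_. 1) MoveRight)) (h, K 0, out) (h, K w, out)" by (simp only: concat_map_Nil append_Nil2)
  have 12: "runs (home tT) (h, K w, out) (h, [(?R, 0), (?R, 0), (?R, 0), (?W, Suc w), (c, 0)], out)"
    by (rule home_to) (use assms in \<open>simp_all add: K_def\<close>)
  have 13: "runs (home tI) (h, [(?R, 0), (?R, 0), (?R, 0), (?W, Suc w), (c, 0)], out)
      (h, [(?R, 0), (?R, 0), (?R, 0), (?W, 0), (c, 0)], out)"
    by (rule home_to) (use assms in simp_all)
  have 14: "runs (reset tT) (h, [(?R, 0), (?R, 0), (?R, 0), (?W, 0), (c, 0)], out)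
      (h, [(?R, 0), (?R, 0), (?R, 0), (?W, 0), (?W, 0)], out)"
    by (rule reset_to) (use assms in simp_all)
  show ?thesis unfolding make_fields_def
    by (rule runs_Seq[OF 1 runs_Seq[OF 2 runs_Seq[OF 3 runs_Seq[OF 4 runs_Seq[OF 5 runs_Seq[OF 6 runs_Seq[OF 7
          runs_Seq[OF 8 runs_Seq[OF 9 runs_Seq[OF 10 runs_Seq[OF 11 runs_Seq[OF 12 runs_Seq[OF 13 14]]]]]]]]]]]]])
qed

lemma exec_program:
  assumes x: "x = replicate n True" and s: "Suc (bit_length n) < s" "Suc (field_width n) < s"
  shows "\<exists>h wk. exec x s program (0, replicate 5 (\<lambda>_. 0, 0), []) (h, wk, uformula_code (hard_formula n))"
proof -
  define r where "r = addr_width n"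
  define w where "w = field_width n"
  have rs: "Suc r < s" using s(1) by (simp add: r_def addr_width_def)
  have ws: "Suc w < s" using s(2) by (simp add: w_def)
  have rw: "r < 2 ^ w" unfolding r_def w_def by (rule addr_width_le)
  let ?l0 = "[([], 0), ([], 0), ([], 0), ([], 0), ([], 0)] :: (bool list \<times> nat) list"
  let ?R = "replicate r False" and ?W = "replicate w False"
  define l where "l p = [(?R, p), (?R, 0), (?R, 0), (?W, 0), (?W, 0)]" for p :: nat
  have t0: "(\<lambda>_ :: nat. 0 :: nat)(0 := 3) = tape []" by (rule ext) (simp add: tape_def)
  \<comment> \<open>This step is done by hand: the blank initial tapes lack the mark in cell 0 and
    are not of the form \<open>tapes l\<close>.\<close>
  have init: "exec x s init_tapes (0, replicate 5 (\<lambda>_. 0, 0), []) (0, tapes ?l0, [])"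
    unfolding init_tapes_def
    by (rule exec.Do) (use s in \<open>auto simp: tapes_def scanned_def bounded_def numeral_eq_Suc t0\<close>)
  have 1: "runs advance_input (0, ?l0, []) (1, ?l0, [])"
    using runs_advance[of 0 ?l0 "[]"] by simp
  have 2: "runs (While (\<lambda>a _. a \<noteq> RightEnd) (increment tZ ;; advance_input)) (1, ?l0, [])
      (Suc n, [(binary n, 0), ([], 0), ([], 0), ([], 0), ([], 0)], [])"
    using runs_count_loop[OF x, of 0 "[([], 0), ([], 0), ([], 0), ([], 0)]" "[]"] s by (simp add: bit_length_def)
  obtain z where z: "length z = r" and 3: "runs compute_widths
      (Suc n, [(binary n, 0), ([], 0), ([], 0), ([], 0), ([], 0)], [])
      (Suc n, [(z, 0), ([], 0), ([], 0), ([], 0), (binary (bit_length n), 0)], [])"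
    using runs_compute_widths[OF s] unfolding r_def by blast
  have 4: "runs make_fields (Suc n, [(z, 0), ([], 0), ([], 0), ([], 0), (binary (bit_length n), 0)], []) (Suc n, l 0, [])"
    unfolding l_def
    by (rule runs_make_fields[OF z _ rs ws]) (simp add: w_def field_width_def bit_length_def)
  have 5: "runs (right tZ) (Suc n, l 0, []) (Suc n, l 1, [])"
    by (rule right_to) (use rs in \<open>simp_all add: l_def\<close>)
  have cur: "syms (l p) ! tZ = 0 \<longleftrightarrow> r < p" for p by (simp add: l_def syms_def)
  have leaf: "runs (put (\<lambda>_. PosTok)) (Suc n, l p, []) (Suc n, l p, [PosTok])" for p
    by (rule put_to) simp
  have "\<exists>p. runs (Cond (\<lambda>_ ws. ws ! tZ = 0) (put (\<lambda>_. PosTok))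
      (right tZ ;; Cond (\<lambda>_ ws. ws ! tZ = 0) (put (\<lambda>_. PosTok)) (home tZ ;; formula_cmd)))
      (Suc n, l 1, []) (Suc n, l p, uformula_code (hard_formula n))"
  proof (cases "r \<ge> 2")
    case False
    then have code: "uformula_code (hard_formula n) = [PosTok]" by (simp add: hard_formula_def r_def)
    show ?thesis
    proof (cases "r = 0")
      case True
      then show ?thesis unfolding code using leaf[of 1] cur[of 1]
        by (intro exI[of _ 1] runs_Cond) auto
    next
      case r0: False
      have a: "runs (right tZ) (Suc n, l 1, []) (Suc n, l 2, [])"
        by (rule right_to) (use rs False r0 in \<open>simp_all add: l_def\<close>)
      have b: "runs (Cond (\<lambda>_ ws. ws ! tZ = 0) (put (\<lambda>_. PosTok)) (home tZ ;; formula_cmd)) (Suc n, l 2, []) (Suc n, l 2, [PosTok])"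
        using leaf[of 2] cur[of 2] False by (intro runs_Cond) auto
      show ?thesis unfolding code using runs_Seq[OF a b] cur[of 1] r0
        by (intro exI[of _ 2] runs_Cond) auto
    qed
  next
    case True
    have a: "runs (right tZ) (Suc n, l 1, []) (Suc n, l 2, [])"
      by (rule right_to) (use rs True in \<open>simp_all add: l_def\<close>)
    have b: "runs (home tZ) (Suc n, l 2, []) (Suc n, l 0, [])"
      by (rule home_to) (use rs True in \<open>simp_all add: l_def\<close>)
    have c: "runs formula_cmd (Suc n, l 0, []) (Suc n, l 0, uformula_code (hard_formula n))"
      using runs_formula[OF rs ws True rw, of "Suc n" "[]"] True
      by (simp add: l_def hard_formula_def r_def w_def)
    have d: "runs (Cond (\<lambda>_ ws. ws ! tZ = 0) (put (\<lambda>_. PosTok)) (home tZ ;; formula_cmd)) (Suc n, l 2, [])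
        (Suc n, l 0, uformula_code (hard_formula n))"
      using runs_Seq[OF b c] cur[of 2] True by (intro runs_Cond) auto
    show ?thesis using runs_Seq[OF a d] cur[of 1] True
      by (intro exI[of _ 0] runs_Cond) auto
  qed
  then obtain p where 6: "runs (Cond (\<lambda>_ ws. ws ! tZ = 0) (put (\<lambda>_. PosTok))
      (right tZ ;; Cond (\<lambda>_ ws. ws ! tZ = 0) (put (\<lambda>_. PosTok)) (home tZ ;; formula_cmd)))
      (Suc n, l 1, []) (Suc n, l p, uformula_code (hard_formula n))" by blast
  have lx: "length x = n" using x by simp
  have ok: "ok ?l0" using s by (auto simp: ok_def)
  have "exec x s (advance_input ;; While (\<lambda>a _. a \<noteq> RightEnd) (increment tZ ;; advance_input)) (0, tapes ?l0, [])
      (Suc n, tapes [(binary n, 0), ([], 0), ([], 0), ([], 0), ([], 0)], [])"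
    using runs_Seq[OF 1 2] ok by (simp add: runs_def)
  then have c: "exec x s count_input (0, replicate 5 (\<lambda>_. 0, 0), [])
      (Suc n, tapes [(binary n, 0), ([], 0), ([], 0), ([], 0), ([], 0)], [])"
    unfolding count_input_def by (rule exec.Seq[OF init])
  have ok': "ok [(binary n, 0), ([], 0), ([], 0), ([], 0), ([], 0)]" using s by (auto simp: ok_def)
  have "exec x s (compute_widths ;; make_fields ;; right tZ ;; Cond (\<lambda>_ ws. ws ! tZ = 0) (put (\<lambda>_. PosTok))
      (right tZ ;; Cond (\<lambda>_ ws. ws ! tZ = 0) (put (\<lambda>_. PosTok)) (home tZ ;; formula_cmd)))
      (Suc n, tapes [(binary n, 0), ([], 0), ([], 0), ([], 0), ([], 0)], []) (Suc n, tapes (l p), uformula_code (hard_formula n))"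
    using runs_Seq[OF 3 runs_Seq[OF 4 runs_Seq[OF 5 6]]] ok' lx by (simp add: runs_def)
  then show ?thesis unfolding program_def using exec.Seq[OF c] by blast
qed

end

section \<open>Logarithmic space and the conclusion\<close>

lemma bit_length_le_self: "bit_length m \<le> m"
proof (cases "m = 0")
  case False
  then have "2 ^ bit_length m \<le> 2 * m" unfolding bit_length_def by (intro length_binary_bounds) simp
  also have "\<dots> < 2 * 2 ^ m" using less_exp[of m] by (intro mult_strict_left_mono) auto
  also have "\<dots> = 2 ^ Suc m" by simp
  finally have "bit_length m < Suc m" by (rule power_less_imp_less_exp[rotated]) simp
  then show ?thesis by simp
qed (simp add: bit_length_def)

lemma hard_formula_outputs:
  "outputs_in_space (machine 4 5 program) (replicate n True) (uformula_code (hard_formula n)) (2 * bit_length n + 2)"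
proof -
  have "field_width n \<le> bit_length n" unfolding field_width_def by (rule bit_length_le_self)
  then obtain h wk where "exec (replicate n True) (2 * bit_length n + 2) program
      (0, replicate 5 (\<lambda>_. 0, 0), []) (h, wk, uformula_code (hard_formula n))"
    using space.exec_program[OF refl, of n "2 * bit_length n + 2"] by auto
  then show ?thesis by (rule exec_outputs) simp
qed

lemma uniform_hard_formula: "uniform_family hard_formula"
  unfolding uniform_family_def
proof (intro exI conjI allI impI)
  show "wf_transducer (machine 4 5 program)" by (rule wf_machine[OF wf_program]) simp
  show "(\<lambda>n. real (2 * bit_length n + 2)) \<in> O(\<lambda>n. ln (real n))"
  proof (rule bigoI)
    \<comment> \<open>By \<open>bit_length_le\<close> the space is at most 4 + 4 ln n, hence at most
      5 ln n from here on.\<close>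
    have "eventually (\<lambda>x :: real. 4 \<le> ln x) at_top" by real_asymp
    then have "eventually (\<lambda>n. 4 \<le> ln (real n)) sequentially"
      by (rule eventually_compose_filterlim[OF _ filterlim_real_sequentially])
    then show "eventually (\<lambda>n. norm (real (2 * bit_length n + 2)) \<le> 5 * norm (ln (real n))) sequentially"
      using eventually_ge_at_top[of 1]
    proof eventually_elim
      case (elim n)
      then show ?case using bit_length_le[of n] by simp
    qed
  qed
qed (rule hard_formula_outputs)

theorem theorem1p1:
  "\<exists>h :: nat \<Rightarrow> bool list \<Rightarrow> bool.
     (\<exists>F :: nat \<Rightarrow> uformula.
        uniform_family F \<and>
        (\<forall>n\<ge>1. uformula_computes n (F n) (h n) \<and> uformula_depth (F n) \<le> 4) \<and>
        (\<lambda>n. real (uformula_size (F n))) \<in> O(\<lambda>n. real n ^ 3)) \<and>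
     (\<exists>\<epsilon> :: nat \<Rightarrow> real. \<epsilon> \<in> o(\<lambda>_. 1) \<and>
        (\<forall>n\<ge>1. real n powr (3 - \<epsilon> n) \<le> real (formula_complexity n (h n))))"
proof (intro exI[of _ hard_function] exI[of _ hard_formula] conjI allI impI)
  show "uniform_family hard_formula" by (rule uniform_hard_formula)
  show "uformula_computes n (hard_formula n) (hard_function n)" if "n \<ge> 1" for n
    using hard_formula_over[OF that] by (simp add: uformula_computes_def hard_function_def)
  show "uformula_depth (hard_formula n) \<le> 4" for n by (rule hard_formula_depth)
  show "(\<lambda>n. real (uformula_size (hard_formula n))) \<in> O(\<lambda>n. real n ^ 3)"
  proof (rule bigoI)
    show "eventually (\<lambda>n. norm (real (uformula_size (hard_formula n))) \<le> 1 * norm (real n ^ 3)) sequentially"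
      using eventually_ge_at_top[of 1]
    proof eventually_elim
      case (elim n)
      have "real (uformula_size (hard_formula n)) \<le> real (n ^ 3)"
        using hard_formula_size[OF elim] by (rule of_nat_mono)
      then show ?case by simp
    qed
  qed
  show "\<exists>\<epsilon> :: nat \<Rightarrow> real. \<epsilon> \<in> o(\<lambda>_. 1) \<and>
      (\<forall>n\<ge>1. real n powr (3 - \<epsilon> n) \<le> real (formula_complexity n (hard_function n)))"
    by (rule hard_function_exponent)
qed

end
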